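(* Let $(Y(t))_{t\in\mathbb{R}^d}$ be a causal CARMA$(p,q)$ random field with companion matrices $A_1,\dots,A_d$, each having distinct eigenvalues, driven by a homogeneous Lévy basis $\Lambda$ with mean zero and finite second moment. For a discretization parameter $\Delta>0$ and a truncation parameter $M\in\mathbb{N}$ let $$Y_{S2}(t)=\sum_{s\in\{0,\Delta,\dots,M\Delta\}^d}g(s)\,Z(t-s),\qquad Z(t)=\Lambda\big([t-\Delta\mathbf e,t]\big),\quad t\in\mathbb{R}^d,$$ where $\mathbf e=(1,\dots,1)^\top\in\mathbb{R}^d$. Let $L=\{\Delta_0,\dots,N\Delta_0\}^d$ with $\Delta_0>0$, $N\in\mathbb{N}$ be a fixed lattice. Then $Y_{S2}(t)$ converges to $Y(t)$ in $L^2$ as simultaneously $\Delta\to0$ and $\Delta M\to\infty$, for every $t\in L$. Further, let $(\Delta_k)_{k\in\mathbb{N}}$ and $(M_k)_{k\in\mathbb{N}}$ be two sequences (of discretization and truncation parameters) satisfying $\Delta_k=\mathcal O(k^{-1-\varepsilon})$ for some $\varepsilon>0$ and $\Delta_kM_k\to\infty$ as $k\to\infty$. Then $Y_{S2}(t)$, formed with $\Delta=\Delta_k$ and $M=M_k$, also converges to $Y(t)$ almost surely as $k\to\infty$, for every $t\in L$.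
   Context: Homogeneous Lévy basis: an infinitely divisible, independently scattered random measure $\Lambda$ on $\mathbb{R}^d$ with $\mathbb{E}[e^{\mathrm{i}u\Lambda(B)}]=\exp\{\mathrm{Leb}(B)(\mathrm{i}\beta u-\tfrac12\sigma^2u^2+\int_{\mathbb{R}}(e^{\mathrm{i}uz}-1-\mathrm{i}uz\mathbf 1_{\{|z|<1\}})\,\nu(dz))\}$ for bounded Borel sets $B$; its characteristic triplet is $(\beta,\sigma^2,\nu)$. It has finite second moment iff $\int z^2\nu(dz)<\infty$, and then its variance is $\kappa_2=\sigma^2+\int z^2\nu(dz)$. Stochastic integrals are in the sense of Rajput and Rosinski. Causal CARMA$(p,q)$ random field: let $0\le q<p$ be integers, $b=(b_0,\dots,b_{p-1})^\top\in\mathbb{R}^p$ with $b_q\ne0$ and $b_i=0$ for $i>q$, $\mathbf e_p=(0,\dots,0,1)^\top\in\mathbb{R}^p$, and for $i=1,\dots,d$ let $A_i\in\mathbb{R}^{p\times p}$ be the companion matrix (ones on the superdiagonal, last row $(-a_{i,p},\dots,-a_{i,1})$, other entries $0$) of a monic real polynomial $a_i(z)=z^p+a_{i,1}z^{p-1}+\dots+a_{i,p}$ all of whose roots have strictly negative real parts. With $\Lambda$ a homogeneous Lévy basis with $\int\log(|z|)^d\mathbf 1_{\{|z|>1\}}\nu(dz)<\infty$, set $Y(t)=\int_{\mathbb{R}^d}g(t-s)\,\Lambda(ds)$, $t\in\mathbb{R}^d$, with kernel $g(s)=b^\top e^{A_1s_1}\cdots e^{A_ds_d}\mathbf e_p\,\mathbf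 1_{\{s\ge0\}}$ ($s\ge0$ componentwise). For $u,v\in\mathbb{R}^d$, $[u,v]=\{s\in\mathbb{R}^d\colon u\le s\le v\}$ with componentwise order. *)

theory Defs
  imports
    "HOL-Probability.Probability"
    "HOL-Library.Landau_Symbols"
    "Jordan_Normal_Form.Spectral_Radius"
begin

no_notation Matrix.vec_index (infixl "$" 100)

section \<open>Modes of convergence\<close>

definition tendsto_in_probability ::
  "'w measure \<Rightarrow> (nat \<Rightarrow> 'w \<Rightarrow> real) \<Rightarrow> ('w \<Rightarrow> real) \<Rightarrow> bool" where
  "tendsto_in_probability P X Y \<longleftrightarrow>
     (\<forall>n. X n \<in> borel_measurable P) \<and> Y \<in> borel_measurable P \<and>
     (\<forall>\<epsilon>>0. (\<lambda>n. measure P {\<omega> \<in> space P. \<epsilon> < \<bar>X n \<omega> - Y \<omega>\<bar>}) \<longlonglongrightarrow> 0)"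

definition square_integrable :: "'w measure \<Rightarrow> ('w \<Rightarrow> real) \<Rightarrow> bool" where
  "square_integrable P X \<longleftrightarrow> X \<in> borel_measurable P \<and> integrable P (\<lambda>\<omega>. (X \<omega>)\<^sup>2)"

text \<open>Square integrability is required explicitly because the Bochner integral of a
  non-integrable function is 0.\<close>

definition tendsto_L2 ::
  "'w measure \<Rightarrow> ('i \<Rightarrow> 'w \<Rightarrow> real) \<Rightarrow> ('w \<Rightarrow> real) \<Rightarrow> 'i filter \<Rightarrow> bool" where
  "tendsto_L2 P X Y F \<longleftrightarrow>
     square_integrable P Y \<and> (\<forall>\<^sub>F i in F. square_integrable P (X i)) \<and>
     ((\<lambda>i. \<integral>\<omega>. (X i \<omega> - Y \<omega>)\<^sup>2 \<partial>P) \<longlongrightarrow> 0) F"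

section \<open>Homogeneous L\'evy bases\<close>

definition levy_measure :: "real measure \<Rightarrow> bool" where
  "levy_measure \<nu> \<longleftrightarrow>
     sets \<nu> = sets borel \<and> emeasure \<nu> {0} = 0 \<and> integrable \<nu> (\<lambda>z. min 1 (z\<^sup>2))"

definition levy_khintchine_exponent ::
  "real \<Rightarrow> real \<Rightarrow> real measure \<Rightarrow> real \<Rightarrow> complex" where
  "levy_khintchine_exponent \<beta> \<sigma>2 \<nu> u =
     \<i> * \<beta> * u - \<sigma>2 * u\<^sup>2 / 2
     + (\<integral>z. (iexp (u * z) - 1 - \<i> * u * z * indicator {z. \<bar>z\<bar> < 1} z) \<partial>\<nu>)"

definition infinitely_divisible :: "real measure \<Rightarrow> bool" where
  "infinitely_divisible \<mu> \<longleftrightarrow> real_distribution \<mu> \<and>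
     (\<forall>n>0. \<exists>\<rho>. real_distribution \<rho> \<and> (\<forall>u. char \<mu> u = (char \<rho> u) ^ n))"

abbreviation bounded_borel :: "(real ^ 'd) set \<Rightarrow> bool" where
  "bounded_borel B \<equiv> B \<in> sets borel \<and> bounded B"

text \<open>A random measure \<open>\<Lambda>\<close> on the bounded Borel sets; its values on other sets are irrelevant.
  The parameter \<open>\<sigma>2\<close> is the Gaussian variance, i.e. the triplet is \<open>(\<beta>, \<sigma>2, \<nu>)\<close>.\<close>

definition independently_scattered ::
  "'w measure \<Rightarrow> ((real ^ 'd) set \<Rightarrow> 'w \<Rightarrow> real) \<Rightarrow> bool" where
  "independently_scattered P \<Lambda> \<longleftrightarrow>
     (\<forall>B. bounded_borel B \<longrightarrow> \<Lambda> B \<in> borel_measurable P) \<and>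
     (\<forall>B::nat \<Rightarrow> (real ^ 'd) set. (\<forall>n. bounded_borel (B n)) \<and> disjoint_family B \<longrightarrow>
        prob_space.indep_vars P (\<lambda>_. borel) (\<lambda>n. \<Lambda> (B n)) UNIV \<and>
        (bounded (\<Union>n. B n) \<longrightarrow> (AE \<omega> in P. (\<lambda>n. \<Lambda> (B n) \<omega>) sums \<Lambda> (\<Union>n. B n) \<omega>)))"

definition homogeneous_levy_basis ::
  "'w measure \<Rightarrow> ((real ^ 'd) set \<Rightarrow> 'w \<Rightarrow> real) \<Rightarrow> real \<Rightarrow> real \<Rightarrow> real measure \<Rightarrow> bool" where
  "homogeneous_levy_basis P \<Lambda> \<beta> \<sigma>2 \<nu> \<longleftrightarrow>
     prob_space P \<and> 0 \<le> \<sigma>2 \<and> levy_measure \<nu> \<and> independently_scattered P \<Lambda> \<and>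
     (\<forall>B. bounded_borel B \<longrightarrow>
        infinitely_divisible (distr P borel (\<Lambda> B)) \<and>
        (\<forall>u. char (distr P borel (\<Lambda> B)) u =
              exp (measure lborel B * levy_khintchine_exponent \<beta> \<sigma>2 \<nu> u)))"

definition mean_zero :: "'w measure \<Rightarrow> ((real ^ 'd) set \<Rightarrow> 'w \<Rightarrow> real) \<Rightarrow> bool" where
  "mean_zero P \<Lambda> \<longleftrightarrow>
     (\<forall>B. bounded_borel B \<longrightarrow> integrable P (\<Lambda> B) \<and> (\<integral>\<omega>. \<Lambda> B \<omega> \<partial>P) = 0)"

definition finite_second_moment :: "'w measure \<Rightarrow> ((real ^ 'd) set \<Rightarrow> 'w \<Rightarrow> real) \<Rightarrow> bool" where
  "finite_second_moment P \<Lambda> \<longleftrightarrow> (\<forall>B. bounded_borel B \<longrightarrow> square_integrable P (\<Lambda> B))"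

section \<open>The Rajput--Rosinski integral\<close>

text \<open>Simple functions are finite linear combinations of indicators of bounded Borel sets; the
  integral of one over a Borel set \<open>A\<close> is taken in its canonical representation.\<close>

definition levy_simple :: "(real ^ 'd \<Rightarrow> real) \<Rightarrow> bool" where
  "levy_simple f \<longleftrightarrow>
     f \<in> borel_measurable borel \<and> finite (range f) \<and> bounded {s. f s \<noteq> 0}"

definition levy_simple_integral ::
  "((real ^ 'd) set \<Rightarrow> 'w \<Rightarrow> real) \<Rightarrow> (real ^ 'd) set \<Rightarrow> (real ^ 'd \<Rightarrow> real) \<Rightarrow> 'w \<Rightarrow> real" where
  "levy_simple_integral \<Lambda> A f \<omega> = (\<Sum>x\<in>range f - {0}. x * \<Lambda> (A \<inter> f -` {x}) \<omega>)"

text \<open>\<open>has_levy_integral P \<Lambda> f Y\<close>: the Borel function \<open>f\<close> is \<open>\<Lambda>\<close>-integrable and \<open>Y\<close> is a version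
  of its integral over the whole space. In the Rajput--Rosinski definition almost-everywhere
  convergence refers to the control measure of \<open>\<Lambda>\<close>, which for a homogeneous basis is a constant
  multiple of Lebesgue measure (with constant 0 only if \<open>\<Lambda>\<close> vanishes).\<close>

definition has_levy_integral ::
  "'w measure \<Rightarrow> ((real ^ 'd) set \<Rightarrow> 'w \<Rightarrow> real) \<Rightarrow> (real ^ 'd \<Rightarrow> real) \<Rightarrow> ('w \<Rightarrow> real) \<Rightarrow> bool" where
  "has_levy_integral P \<Lambda> f Y \<longleftrightarrow>
     f \<in> borel_measurable borel \<and>
     (\<exists>\<phi>::nat \<Rightarrow> real ^ 'd \<Rightarrow> real.
        (\<forall>n. levy_simple (\<phi> n)) \<and>
        (AE s in lborel. (\<lambda>n. \<phi> n s) \<longlonglongrightarrow> f s) \<and>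
        (\<forall>A\<in>sets borel. \<exists>X. tendsto_in_probability P (\<lambda>n. levy_simple_integral \<Lambda> A (\<phi> n)) X) \<and>
        tendsto_in_probability P (\<lambda>n. levy_simple_integral \<Lambda> UNIV (\<phi> n)) Y)"

section \<open>Causal CARMA random fields\<close>

text \<open>With \<open>c = z^p + a\<^sub>1 z^(p-1) + \<dots> + a\<^sub>p\<close>, the last row is \<open>(-a\<^sub>p, \<dots>, -a\<^sub>1)\<close>, that is,
  the negated coefficients of \<open>c\<close> in increasing degree. Indices start at 0.\<close>

definition companion_mat :: "real poly \<Rightarrow> real mat" where
  "companion_mat c = Matrix.mat (degree c) (degree c) (\<lambda>(i, j).
     if i = degree c - 1 then - coeff c j else if j = i + 1 then 1 else 0)"

definition mat_exp :: "real mat \<Rightarrow> real mat" where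
  "mat_exp A = Matrix.mat (dim_row A) (dim_row A) (\<lambda>(i, j).
     (\<Sum>n. (A ^\<^sub>m n) $$ (i, j) / fact n))"

text \<open>The matrix exponentials need not commute: the product is taken in the order of the
  (linearly ordered, finite) coordinate index type.\<close>

definition carma_kernel ::
  "nat \<Rightarrow> real Matrix.vec \<Rightarrow> ('d::{finite,linorder} \<Rightarrow> real mat) \<Rightarrow> real ^ 'd::{finite,linorder} \<Rightarrow> real" where
  "carma_kernel p b A s =
     scalar_prod b
       (foldr (\<lambda>i B. mat_exp ((s $ i) \<cdot>\<^sub>m A i) * B) (sorted_list_of_set (UNIV :: 'd set)) (1\<^sub>m p)
        *\<^sub>v unit_vec p (p - 1))
     * indicator {s. \<forall>i. 0 \<le> s $ i} s"

definition causal_carma_field ::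
  "'w measure \<Rightarrow> ((real ^ 'd::{finite,linorder}) set \<Rightarrow> 'w \<Rightarrow> real) \<Rightarrow>
   real \<Rightarrow> real \<Rightarrow> real measure \<Rightarrow> nat \<Rightarrow> nat \<Rightarrow> real Matrix.vec \<Rightarrow> ('d::{finite,linorder} \<Rightarrow> real mat) \<Rightarrow>
   (real ^ 'd::{finite,linorder} \<Rightarrow> 'w \<Rightarrow> real) \<Rightarrow> bool" where
  "causal_carma_field P \<Lambda> \<beta> \<sigma>2 \<nu> p q b A Y \<longleftrightarrow>
     q < p \<and>
     b \<in> carrier_vec p \<and> vec_index b q \<noteq> 0 \<and> (\<forall>i<p. q < i \<longrightarrow> vec_index b i = 0) \<and>
     (\<forall>i. \<exists>a::real poly. lead_coeff a = 1 \<and> degree a = p \<and>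
        (\<forall>z::complex. poly (map_poly complex_of_real a) z = 0 \<longrightarrow> Re z < 0) \<and>
        A i = companion_mat a) \<and>
     homogeneous_levy_basis P \<Lambda> \<beta> \<sigma>2 \<nu> \<and>
     integrable \<nu> (\<lambda>z. (ln \<bar>z\<bar>) ^ CARD('d) * indicator {z. 1 < \<bar>z\<bar>} z) \<and>
     (\<forall>t. has_levy_integral P \<Lambda> (\<lambda>s. carma_kernel p b A (t - s)) (Y t))"

definition distinct_eigenvalues :: "real mat \<Rightarrow> bool" where
  "distinct_eigenvalues A \<longleftrightarrow> card (spectrum (map_mat complex_of_real A)) = dim_row A"

section \<open>The step-function approximation\<close>

definition grid :: "real \<Rightarrow> nat set \<Rightarrow> (real ^ 'd) set" where
  "grid \<delta> J = {s. \<forall>i. \<exists>j\<in>J. s $ i = real j * \<delta>}"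

text \<open>On \<open>real ^ 'd\<close> the order is componentwise and \<open>1\<close> is the vector \<open>(1, \<dots>, 1)\<close>.\<close>

definition Y_S2 ::
  "((real ^ 'd) set \<Rightarrow> 'w \<Rightarrow> real) \<Rightarrow> (real ^ 'd \<Rightarrow> real) \<Rightarrow> real \<Rightarrow> nat \<Rightarrow> real ^ 'd \<Rightarrow> 'w \<Rightarrow> real" where
  "Y_S2 \<Lambda> g \<Delta> M t \<omega> =
     (let Z = (\<lambda>t. \<Lambda> {t - \<Delta> *\<^sub>R 1 .. t} \<omega>) in \<Sum>s\<in>grid \<Delta> {0..M}. g s * Z (t - s))"

text \<open>The regime of pairs \<open>(\<Delta>, M)\<close> with \<open>\<Delta> > 0\<close>, \<open>\<Delta> \<rightarrow> 0\<close> and \<open>\<Delta> M \<rightarrow> \<infinity>\<close> simultaneously.\<close>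

definition refine_filter :: "(real \<times> nat) filter" where
  "refine_filter =
     inf (filtercomap fst (at_right 0)) (filtercomap (\<lambda>(\<Delta>, M). \<Delta> * real M) at_top)"

end

(*
  Second moments of integrals of simple functions are controlled by the Lebesgue measure: the
  variance of Lambda(B) is an additive function of Leb(B) and hence at most kappa * Leb(B), so
  E(I h)^2 <= kappa * int h^2 for simple h. A Rajput-Rosinski integral Y of a square integrable f
  is only a limit in probability along simple functions converging almost everywhere, but a
  gliding hump argument yields simple functions that converge to f in L^2 as well, so that
  E(I h - Y)^2 <= 2 kappa * int (h - f)^2.

  Distinct eigenvalues make the entries of exp(x A_i) combinations of exponentials
  exp(l x) with Re l < 0, so the kernel g decays exponentially and is Lipschitz with the same
  decay on the positive quadrant. Y_S2(t) is almost surely the integral of a step function, whose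
  distance to g(t - .) is of order Delta on the box of side (M + 1) Delta and a tail outside it.
  This gives the convergence in L^2. For almost sure convergence the discretization errors have
  summable second moments of order Delta_k^2. The truncation errors need not be summable; being
  integrals over nested sets, they are partial sums of independent variables and vanish by
  Kolmogorov's maximal inequality.
*)
theory Submission
  imports Defs
begin

section \<open>Square integrable random variables and Kolmogorov's inequality\<close>

text \<open>The obstacle is the definition of the integral. Almost everywhere convergence of simple
  functions and convergence in probability of their integrals provide no domination, so second
  moments cannot be read off the given sequence. What helps is the demand for a limit over every
  Borel set: two subsequences can be spliced along one set A, one used off A and the other on A. The
  spliced functions converge in L^2 and their integrals still converge to Y. The Levy-Khintchine
  exponent is never expanded; it only shows that the law of Lambda(B) depends on Leb(B) alone. The
  constant kappa is the second moment over a set of volume 1, and the factors 2 come from (x + y)^2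
  <= 2 x^2 + 2 y^2, used in place of norms and square roots. For the almost sure statement, Delta_k
  M_k may grow arbitrarily slowly and without monotonicity, so neither summability nor an ordered
  family of tails is at hand. Finitely many indices are reordered by box size before the maximal
  inequality is applied, and the bound depends only on the smallest box among them.\<close>

lemma square_integrable_mult:
  assumes "square_integrable M X" "square_integrable M Y"
  shows "integrable M (\<lambda>w. X w * Y w)"
proof (rule Bochner_Integration.integrable_bound)
  show "integrable M (\<lambda>w. (X w)\<^sup>2 + (Y w)\<^sup>2)"
    using assms unfolding square_integrable_def by auto
  show "(\<lambda>w. X w * Y w) \<in> borel_measurable M"
    using assms unfolding square_integrable_def by auto
  have "\<bar>x * y\<bar> \<le> x\<^sup>2 + y\<^sup>2" for x y :: real
  proof -
    have "0 \<le> (\<bar>x\<bar> - \<bar>y\<bar>)\<^sup>2" by simp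
    then have "2 * (\<bar>x\<bar> * \<bar>y\<bar>) \<le> x\<^sup>2 + y\<^sup>2"
      unfolding power2_diff by simp
    moreover have "0 \<le> \<bar>x\<bar> * \<bar>y\<bar>" by simp
    ultimately show ?thesis unfolding abs_mult by linarith
  qed
  then show "AE w in M. norm (X w * Y w) \<le> norm ((X w)\<^sup>2 + (Y w)\<^sup>2)"
    by auto
qed

lemma square_integrable_add:
  assumes "square_integrable M X" "square_integrable M Y"
  shows "square_integrable M (\<lambda>w. X w + Y w)"
  using assms square_integrable_mult[OF assms] unfolding square_integrable_def power2_sum
  by (auto simp: mult.assoc)

lemma square_integrable_cmult:
  assumes "square_integrable M X"
  shows "square_integrable M (\<lambda>w. c * X w)"
  using assms unfolding square_integrable_def power_mult_distrib by auto

lemma square_integrable_diff: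
  assumes "square_integrable M X" "square_integrable M Y"
  shows "square_integrable M (\<lambda>w. X w - Y w)"
  using square_integrable_add[OF assms(1) square_integrable_cmult[OF assms(2), of "-1"]] by simp

lemma square_integrable_sum:
  assumes "\<And>i. i \<in> I \<Longrightarrow> square_integrable M (X i)"
  shows "square_integrable M (\<lambda>w. \<Sum>i\<in>I. X i w)"
  using assms
proof (induction I rule: infinite_finite_induct)
  case (insert i I)
  then show ?case using square_integrable_add[of M "X i"] by simp
qed (simp_all add: square_integrable_def)

text \<open>Split by the first \<open>k\<close> at which the partial sum reaches \<open>a\<close>.
  On that event \<open>E k\<close> the truncated sum \<open>U\<close> depends on the first
  \<open>k\<close> variables only, hence is orthogonal to the increment \<open>T\<close>, so the
  full sum has at least as large a second moment on \<open>E k\<close> as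
  \<open>S k\<close>.\<close>

lemma (in prob_space) kolmogorov_maximal_inequality:
  fixes X :: "nat \<Rightarrow> 'a \<Rightarrow> real"
  assumes indep: "indep_vars (\<lambda>_. borel) X {..<n}"
    and sq: "\<And>i. i < n \<Longrightarrow> square_integrable M (X i)"
    and mean: "\<And>i. i < n \<Longrightarrow> expectation (X i) = 0"
    and a: "a > 0"
  shows "a\<^sup>2 * prob {w\<in>space M. \<exists>k\<le>n. a \<le> \<bar>\<Sum>i<k. X i w\<bar>}
    \<le> expectation (\<lambda>w. (\<Sum>i<n. X i w)\<^sup>2)"
proof -
  define S where "S k w = (\<Sum>i<k. X i w)" for k w
  define E where "E k = {w\<in>space M. a \<le> \<bar>S k w\<bar> \<and> (\<forall>j<k. \<bar>S j w\<bar> < a)}" for k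
  have [measurable]: "X i \<in> borel_measurable M" if "i < n" for i
    using sq[OF that] by (simp add: square_integrable_def)
  have Sm [measurable]: "S k \<in> borel_measurable M" if "k \<le> n" for k
    unfolding S_def using that by (intro borel_measurable_sum) auto
  have Ssq: "square_integrable M (S k)" if "k \<le> n" for k
    unfolding S_def using that by (intro square_integrable_sum sq) auto
  have Em: "E k \<in> events" if "k \<le> n" for k
  proof -
    have "{w\<in>space M. a \<le> \<bar>S k w\<bar>} \<in> events"
      using Sm[OF that] by measurable
    moreover have "{w\<in>space M. \<forall>j\<in>{..<k}. \<bar>S j w\<bar> < a} \<in> events"
      using that Sm by (intro sets.sets_Collect_finite_All) auto
    moreover have "E k = {w\<in>space M. a \<le> \<bar>S k w\<bar>} \<inter> {w\<in>space M. \<forall>j\<in>{..<k}. \<bar>S j w\<bar> < a}"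
      unfolding E_def by auto
    ultimately show ?thesis by auto
  qed
  have disj: "disjoint_family_on E {..n}"
    unfolding disjoint_family_on_def E_def
    by (auto simp: not_le[symmetric]) (metis linorder_neqE_nat not_le)
  have union: "{w\<in>space M. \<exists>k\<le>n. a \<le> \<bar>\<Sum>i<k. X i w\<bar>} = (\<Union>k\<in>{..n}. E k)"
  proof (intro equalityI subsetI)
    fix w assume w: "w \<in> {w\<in>space M. \<exists>k\<le>n. a \<le> \<bar>\<Sum>i<k. X i w\<bar>}"
    define k where "k = (LEAST k. a \<le> \<bar>S k w\<bar>)"
    obtain k' where k': "k' \<le> n" "a \<le> \<bar>S k' w\<bar>" using w unfolding S_def by auto
    have "a \<le> \<bar>S k w\<bar>" unfolding k_def by (rule LeastI[of _ k']) (use k' in auto)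
    moreover have "\<bar>S j w\<bar> < a" if "j < k" for j
      using not_less_Least[of j "\<lambda>k. a \<le> \<bar>S k w\<bar>"] that unfolding k_def by auto
    moreover have "k \<le> n" unfolding k_def using k' by (meson Least_le order_trans)
    ultimately show "w \<in> (\<Union>k\<in>{..n}. E k)" using w unfolding E_def by auto
  qed (auto simp: E_def S_def)
  have Snint: "integrable M (\<lambda>w. (S n w)\<^sup>2)"
    using Ssq[of n] by (auto simp: square_integrable_def)
  have key: "a\<^sup>2 * prob (E k) \<le> expectation (\<lambda>w. indicator (E k) w * (S n w)\<^sup>2)" if k: "k \<le> n" for k
  proof -
    note Em[OF k, measurable]
    define T where "T w = S n w - S k w" for w
    have T_eq: "T w = (\<Sum>i\<in>{k..<n}. X i w)" for w
      unfolding T_def S_def using k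
      by (metis (no_types, lifting) lessThan_atLeast0 sum_diff_nat_ivl zero_le)
    have Tsq: "square_integrable M T"
      unfolding T_def using k by (intro square_integrable_diff Ssq) auto
    define U where "U w = indicator (E k) w * S k w" for w
    have Usq: "square_integrable M U"
    proof -
      have "integrable M (\<lambda>w. (U w)\<^sup>2)"
        by (rule Bochner_Integration.integrable_bound[where f="\<lambda>w. (S k w)\<^sup>2"])
          (use Ssq[OF k] Em[OF k] in \<open>auto simp: square_integrable_def U_def indicator_def\<close>)
      then show ?thesis using Sm[OF k] Em[OF k] unfolding square_integrable_def U_def by auto
    qed
    have UT: "expectation (\<lambda>w. U w * T w) = 0"
    proof -
      \<comment> \<open>Independence is available for tuples restricted to two disjoint blocks of
        indices. \<open>F\<close> and \<open>G\<close> express \<open>U\<close> and \<open>T\<close>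
        as functions of these tuples.\<close>
      define F where "F f = (\<Sum>i<k. f i) *
        indicator {f::nat\<Rightarrow>real. a \<le> \<bar>\<Sum>i<k. f i\<bar> \<and> (\<forall>j\<in>{..<k}. \<bar>\<Sum>i<j. f i\<bar> < a)} f" for f :: "nat \<Rightarrow> real"
      define G where "G f = (\<Sum>i\<in>{k..<n}. f i)" for f :: "nat \<Rightarrow> real"
      have iv: "indep_var (PiM {..<k} (\<lambda>_. borel)) (\<lambda>w. restrict (\<lambda>i. X i w) {..<k})
           (PiM {k..<n} (\<lambda>_. borel)) (\<lambda>w. restrict (\<lambda>i. X i w) {k..<n})"
        by (rule indep_var_restrict[OF indep]) (use k in auto)
      have sm: "(\<lambda>f::nat\<Rightarrow>real. \<Sum>i<j. f i) \<in> borel_measurable (PiM {..<k} (\<lambda>_. borel))" if "j \<le> k" for j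
        using that by (intro borel_measurable_sum measurable_component_singleton) auto
      have "F \<in> borel_measurable (PiM {..<k} (\<lambda>_. borel))"
      proof -
        have "Measurable.pred (PiM {..<k} (\<lambda>_. borel)) (\<lambda>f::nat\<Rightarrow>real. a \<le> \<bar>\<Sum>i<k. f i\<bar>)"
          using sm[of k] by measurable
        moreover have "Measurable.pred (PiM {..<k} (\<lambda>_. borel)) (\<lambda>f::nat\<Rightarrow>real. \<forall>j\<in>{..<k}. \<bar>\<Sum>i<j. f i\<bar> < a)"
        proof (rule pred_intros_finite(3))
          fix j assume "j \<in> {..<k}"
          then have "(\<lambda>f::nat\<Rightarrow>real. \<Sum>i<j. f i) \<in> borel_measurable (PiM {..<k} (\<lambda>_. borel))"
            by (intro sm) auto
          then show "Measurable.pred (PiM {..<k} (\<lambda>_. borel)) (\<lambda>f::nat\<Rightarrow>real. \<bar>\<Sum>i<j. f i\<bar> < a)"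
            by measurable
        qed simp
        ultimately have "Measurable.pred (PiM {..<k} (\<lambda>_. borel)) (\<lambda>f::nat\<Rightarrow>real.
            a \<le> \<bar>\<Sum>i<k. f i\<bar> \<and> (\<forall>j\<in>{..<k}. \<bar>\<Sum>i<j. f i\<bar> < a))"
          by (rule pred_intros_logic(3))
        then show ?thesis unfolding F_def using sm[of k]
          by (intro borel_measurable_times borel_measurable_indicator') (auto simp: pred_def)
      qed
      moreover have "G \<in> borel_measurable (PiM {k..<n} (\<lambda>_. borel))"
        unfolding G_def by (intro borel_measurable_sum measurable_component_singleton) auto
      ultimately have "indep_var borel (F \<circ> (\<lambda>w. restrict (\<lambda>i. X i w) {..<k})) borel
           (G \<circ> (\<lambda>w. restrict (\<lambda>i. X i w) {k..<n}))"
        by (rule indep_var_compose[OF iv])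
      then have iv2: "indep_var borel (F \<circ> (\<lambda>w. restrict (\<lambda>i. X i w) {..<k})) borel T"
        by (simp add: G_def T_eq[abs_def] comp_def)
      have FU: "(F \<circ> (\<lambda>w. restrict (\<lambda>i. X i w) {..<k})) w = U w" if "w \<in> space M" for w
      proof -
        have "(\<Sum>i<j. restrict (\<lambda>i. X i w) {..<k} i) = S j w" if "j \<le> k" for j
          unfolding S_def using that by (intro sum.cong) auto
        then show ?thesis
          using that unfolding F_def U_def E_def indicator_def by auto
      qed
      let ?V = "F \<circ> (\<lambda>w. restrict (\<lambda>i. X i w) {..<k})"
      have intU: "integrable M U"
        using square_integrable_mult[OF Usq, of "\<lambda>_. 1"] by (simp add: square_integrable_def)
      have intT: "integrable M T"
        using square_integrable_mult[OF Tsq, of "\<lambda>_. 1"] by (simp add: square_integrable_def)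
      have intX: "integrable M (X i)" if "i < n" for i
        using square_integrable_mult[OF sq[OF that], of "\<lambda>_. 1"] by (simp add: square_integrable_def)
      have "integrable M ?V"
        using intU by (subst Bochner_Integration.integrable_cong[OF refl FU]) auto
      have "expectation (\<lambda>w. U w * T w) = expectation (\<lambda>w. ?V w * T w)"
        by (rule Bochner_Integration.integral_cong) (simp_all add: FU[simplified])
      also have "\<dots> = expectation ?V * expectation T"
        by (rule indep_var_lebesgue_integral[OF iv2 \<open>integrable M ?V\<close> intT])
      also have "expectation T = 0"
        unfolding T_eq by (subst Bochner_Integration.integral_sum) (auto intro: intX simp: mean)
      finally show ?thesis by simp
    qed
    have "a\<^sup>2 * prob (E k) = expectation (\<lambda>w. indicator (E k) w * a\<^sup>2)"
      using Em[OF k] by simp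
    also have "\<dots> \<le> expectation (\<lambda>w. (U w)\<^sup>2)"
    proof (rule integral_mono)
      show "integrable M (\<lambda>w. indicator (E k) w * a\<^sup>2)"
        using integrable_mult_indicator[OF Em[OF k], of "\<lambda>_. a\<^sup>2"] by simp
      show "integrable M (\<lambda>w. (U w)\<^sup>2)" using Usq by (simp add: square_integrable_def)
      have "a\<^sup>2 \<le> (S k w)\<^sup>2" if "w \<in> E k" for w
        using that a unfolding E_def by (metis (mono_tags, lifting) abs_le_square_iff abs_of_pos mem_Collect_eq)
      then show "indicator (E k) w * a\<^sup>2 \<le> (U w)\<^sup>2" for w
        unfolding U_def by (auto simp: indicator_def)
    qed
    \<comment> \<open>Adding the cross term changes nothing by \<open>UT\<close>, and only the
      nonnegative square of \<open>T\<close> is then missing from the square of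
      \<open>S n\<close>.\<close>
    also have "\<dots> = expectation (\<lambda>w. (U w)\<^sup>2 + 2 * (U w * T w))"
      using Usq square_integrable_mult[OF Usq Tsq] UT
      by (subst Bochner_Integration.integral_add) (auto simp: square_integrable_def)
    also have "\<dots> \<le> expectation (\<lambda>w. indicator (E k) w * (S n w)\<^sup>2)"
    proof (rule integral_mono)
      show "integrable M (\<lambda>w. (U w)\<^sup>2 + 2 * (U w * T w))"
        using Usq square_integrable_mult[OF Usq Tsq] by (auto simp: square_integrable_def)
      show "integrable M (\<lambda>w. indicator (E k) w * (S n w)\<^sup>2)"
        by (rule integrable_mult_indicator[OF Em[OF k] Snint, simplified])
      have "(S k w)\<^sup>2 + 2 * (S k w * T w) \<le> (S n w)\<^sup>2" for w
      proof -
        have "(S n w)\<^sup>2 = (S k w)\<^sup>2 + 2 * (S k w * T w) + (T w)\<^sup>2"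
          unfolding T_def by (simp add: power2_eq_square algebra_simps)
        then show ?thesis by simp
      qed
      then show "(U w)\<^sup>2 + 2 * (U w * T w) \<le> indicator (E k) w * (S n w)\<^sup>2" for w
        unfolding U_def by (auto simp: indicator_def)
    qed
    finally show ?thesis .
  qed
  have "a\<^sup>2 * prob (\<Union>k\<in>{..n}. E k) = (\<Sum>k\<le>n. a\<^sup>2 * prob (E k))"
    using Em disj by (subst finite_measure_finite_Union) (auto simp: sum_distrib_left)
  also have "\<dots> \<le> (\<Sum>k\<le>n. expectation (\<lambda>w. indicator (E k) w * (S n w)\<^sup>2))"
    by (intro sum_mono key) auto
  also have "\<dots> = expectation (\<lambda>w. \<Sum>k\<le>n. indicator (E k) w * (S n w)\<^sup>2)"
    by (rule Bochner_Integration.integral_sum[symmetric])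
      (use integrable_mult_indicator[OF Em Snint] in simp)
  also have "\<dots> \<le> expectation (\<lambda>w. (S n w)\<^sup>2)"
  proof (rule integral_mono)
    show "integrable M (\<lambda>w. \<Sum>k\<le>n. indicator (E k) w * (S n w)\<^sup>2)"
      using integrable_mult_indicator[OF Em Snint] by (intro Bochner_Integration.integrable_sum) simp
    show "integrable M (\<lambda>w. (S n w)\<^sup>2)" by (rule Snint)
    fix w
    have "(\<Sum>k\<le>n. indicator (E k) w * (S n w)\<^sup>2) = (\<Sum>k\<le>n. indicator (E k) w) * (S n w)\<^sup>2"
      by (simp add: sum_distrib_right)
    also have "(\<Sum>k\<le>n. indicator (E k) w) = (indicator (\<Union>k\<in>{..n}. E k) w :: real)"
      using disj by (intro indicator_UN_disjoint[symmetric]) auto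
    also have "\<dots> * (S n w)\<^sup>2 \<le> (S n w)\<^sup>2"
      by (auto simp: indicator_def)
    finally show "(\<Sum>k\<le>n. indicator (E k) w * (S n w)\<^sup>2) \<le> (S n w)\<^sup>2" .
  qed
  finally show ?thesis unfolding union by (simp add: S_def)
qed

text \<open>The squared L^2 norm with values in [0, \<infinity>], used on the probability space and
  for Lebesgue measure alike. Estimates can then be chained before integrability is known, and
  finiteness is concluded at the end.\<close>

definition sqnorm :: "'a measure \<Rightarrow> ('a \<Rightarrow> real) \<Rightarrow> ennreal" where
  "sqnorm M X = (\<integral>\<^sup>+w. ennreal ((X w)\<^sup>2) \<partial>M)"

lemma sqnorm_cong_AE:
  assumes "AE w in M. X w = Y w"
  shows "sqnorm M X = sqnorm M Y"
  unfolding sqnorm_def using assms by (intro nn_integral_cong_AE) auto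

lemma sqnorm_mono:
  assumes "\<And>w. w \<in> space M \<Longrightarrow> \<bar>X w\<bar> \<le> \<bar>Y w\<bar>"
  shows "sqnorm M X \<le> sqnorm M Y"
  unfolding sqnorm_def using assms
  by (intro nn_integral_mono ennreal_leI) (simp add: abs_le_square_iff)

lemma sqnorm_minus_commute: "sqnorm M (\<lambda>w. X w - Y w) = sqnorm M (\<lambda>w. Y w - X w)"
  unfolding sqnorm_def by (simp add: power2_commute)

lemma sqnorm_add:
  assumes [measurable]: "X \<in> borel_measurable M" "Y \<in> borel_measurable M"
  shows "sqnorm M (\<lambda>w. X w + Y w) \<le> 2 * (sqnorm M X + sqnorm M Y)"
proof -
  have "(x + y)\<^sup>2 \<le> 2 * (x\<^sup>2 + y\<^sup>2)" for x y :: real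
    using sum_squares_bound[of x y] unfolding power2_sum by simp
  then have "ennreal ((x + y)\<^sup>2) \<le> 2 * (ennreal (x\<^sup>2) + ennreal (y\<^sup>2))" for x y :: real
    by (metis ennreal_leI ennreal_mult' ennreal_numeral ennreal_plus zero_le_numeral zero_le_power2)
  then have "sqnorm M (\<lambda>w. X w + Y w) \<le>
      (\<integral>\<^sup>+w. 2 * (ennreal ((X w)\<^sup>2) + ennreal ((Y w)\<^sup>2)) \<partial>M)"
    unfolding sqnorm_def by (intro nn_integral_mono)
  also have "\<dots> = 2 * (sqnorm M X + sqnorm M Y)"
    unfolding sqnorm_def by (simp add: nn_integral_cmult nn_integral_add)
  finally show ?thesis .
qed

lemma sqnorm_diff:
  assumes [measurable]: "X \<in> borel_measurable M" "Y \<in> borel_measurable M"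
  shows "sqnorm M (\<lambda>w. X w - Y w) \<le> 2 * (sqnorm M X + sqnorm M Y)"
  using sqnorm_add[of X M "\<lambda>w. - Y w"] by (simp add: sqnorm_def)

lemma sqnorm_triangle:
  assumes [measurable]: "X \<in> borel_measurable M" "Y \<in> borel_measurable M" "Z \<in> borel_measurable M"
  shows "sqnorm M (\<lambda>w. X w - Z w) \<le>
    2 * (sqnorm M (\<lambda>w. X w - Y w) + sqnorm M (\<lambda>w. Y w - Z w))"
  using sqnorm_add[of "\<lambda>w. X w - Y w" M "\<lambda>w. Y w - Z w"] by simp

lemma square_integrable_iff_sqnorm:
  "square_integrable M X \<longleftrightarrow> X \<in> borel_measurable M \<and> sqnorm M X < \<infinity>"
  unfolding square_integrable_def sqnorm_def integrable_iff_bounded by auto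

lemma integral_square_eq_sqnorm:
  assumes "X \<in> borel_measurable M"
  shows "(\<integral>w. (X w)\<^sup>2 \<partial>M) = enn2real (sqnorm M X)"
  unfolding sqnorm_def using assms by (intro integral_eq_nn_integral) auto

lemma sqnorm_eq_integral:
  assumes "square_integrable M X"
  shows "sqnorm M X = ennreal (\<integral>w. (X w)\<^sup>2 \<partial>M)"
  unfolding sqnorm_def using assms
  by (intro nn_integral_eq_integral) (auto simp: square_integrable_def)

lemma sqnorm_zero_AE:
  assumes [measurable]: "X \<in> borel_measurable M" and "sqnorm M X = 0"
  shows "AE w in M. X w = 0"
  using assms(2) unfolding sqnorm_def by (subst (asm) nn_integral_0_iff_AE) auto

lemma (in prob_space) chebyshev_sqnorm:
  assumes [measurable]: "X \<in> borel_measurable M" and a: "a > 0"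
  shows "ennreal (a\<^sup>2 * prob {w\<in>space M. a \<le> \<bar>X w\<bar>}) \<le> sqnorm M X"
proof -
  have "ennreal (a\<^sup>2 * prob {w\<in>space M. a \<le> \<bar>X w\<bar>}) =
      (\<integral>\<^sup>+w. ennreal (a\<^sup>2) * indicator {w\<in>space M. a \<le> \<bar>X w\<bar>} w \<partial>M)"
    by (simp add: nn_integral_cmult_indicator emeasure_eq_measure ennreal_mult)
  also have "\<dots> \<le> sqnorm M X"
    unfolding sqnorm_def
  proof (rule nn_integral_mono)
    fix w
    have "a\<^sup>2 \<le> (X w)\<^sup>2" if "a \<le> \<bar>X w\<bar>"
      using that a by (metis abs_le_square_iff abs_of_pos)
    then show "ennreal (a\<^sup>2) * indicator {w\<in>space M. a \<le> \<bar>X w\<bar>} w \<le> ennreal ((X w)\<^sup>2)"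
      by (auto simp: indicator_def ennreal_leI)
  qed
  finally show ?thesis .
qed

section \<open>Convergence in probability\<close>

lemma tendsto_in_probability_subseq:
  assumes "tendsto_in_probability M X Y" "strict_mono r"
  shows "tendsto_in_probability M (\<lambda>n. X (r n)) Y"
  using assms LIMSEQ_subseq_LIMSEQ unfolding tendsto_in_probability_def comp_def by blast

lemma (in prob_space) tendsto_in_probability_add:
  assumes "tendsto_in_probability M X X'" "tendsto_in_probability M Y Y'"
  shows "tendsto_in_probability M (\<lambda>n w. X n w + Y n w) (\<lambda>w. X' w + Y' w)"
proof -
  have [measurable]: "X n \<in> borel_measurable M" "Y n \<in> borel_measurable M"
    "X' \<in> borel_measurable M" "Y' \<in> borel_measurable M" for n
    using assms unfolding tendsto_in_probability_def by auto
  show ?thesis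
    unfolding tendsto_in_probability_def
  proof (intro conjI allI impI)
    fix \<epsilon> :: real assume e: "\<epsilon> > 0"
    have "(\<lambda>n. prob {w\<in>space M. \<epsilon>/2 < \<bar>X n w - X' w\<bar>} + prob {w\<in>space M. \<epsilon>/2 < \<bar>Y n w - Y' w\<bar>})
        \<longlonglongrightarrow> 0 + 0"
      using assms half_gt_zero[OF e] unfolding tendsto_in_probability_def
      by (intro tendsto_add) blast+
    then have lim: "(\<lambda>n. prob {w\<in>space M. \<epsilon>/2 < \<bar>X n w - X' w\<bar>} + prob {w\<in>space M. \<epsilon>/2 < \<bar>Y n w - Y' w\<bar>})
        \<longlonglongrightarrow> 0" by simp
    show "(\<lambda>n. prob {w\<in>space M. \<epsilon> < \<bar>X n w + Y n w - (X' w + Y' w)\<bar>}) \<longlonglongrightarrow> 0"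
    proof (rule tendsto_sandwich[OF _ _ tendsto_const lim])
      show "\<forall>\<^sub>F n in sequentially. prob {w\<in>space M. \<epsilon> < \<bar>X n w + Y n w - (X' w + Y' w)\<bar>} \<le>
        prob {w\<in>space M. \<epsilon>/2 < \<bar>X n w - X' w\<bar>} + prob {w\<in>space M. \<epsilon>/2 < \<bar>Y n w - Y' w\<bar>}"
      proof (intro always_eventually allI)
        fix n
        have "prob {w\<in>space M. \<epsilon> < \<bar>X n w + Y n w - (X' w + Y' w)\<bar>} \<le>
          prob ({w\<in>space M. \<epsilon>/2 < \<bar>X n w - X' w\<bar>} \<union> {w\<in>space M. \<epsilon>/2 < \<bar>Y n w - Y' w\<bar>})"
        proof (intro finite_measure_mono subsetI)
          fix w assume w: "w \<in> {w\<in>space M. \<epsilon> < \<bar>X n w + Y n w - (X' w + Y' w)\<bar>}"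
          have "\<bar>X n w + Y n w - (X' w + Y' w)\<bar> \<le> \<bar>X n w - X' w\<bar> + \<bar>Y n w - Y' w\<bar>" by simp
          then have "\<epsilon>/2 < \<bar>X n w - X' w\<bar> \<or> \<epsilon>/2 < \<bar>Y n w - Y' w\<bar>" using w by auto
          then show "w \<in> {w\<in>space M. \<epsilon>/2 < \<bar>X n w - X' w\<bar>} \<union> {w\<in>space M. \<epsilon>/2 < \<bar>Y n w - Y' w\<bar>}"
            using w by auto
        qed measurable
        also have "\<dots> \<le> prob {w\<in>space M. \<epsilon>/2 < \<bar>X n w - X' w\<bar>} + prob {w\<in>space M. \<epsilon>/2 < \<bar>Y n w - Y' w\<bar>}"
          by (intro measure_Un_le) measurable
        finally show "prob {w\<in>space M. \<epsilon> < \<bar>X n w + Y n w - (X' w + Y' w)\<bar>} \<le>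
          prob {w\<in>space M. \<epsilon>/2 < \<bar>X n w - X' w\<bar>} + prob {w\<in>space M. \<epsilon>/2 < \<bar>Y n w - Y' w\<bar>}" .
      qed
    qed auto
  qed measurable
qed

text \<open>The basis is additive only up to null sets, so identities between integrals of simple
  functions hold almost surely; this rule carries them to the limit.\<close>

lemma (in prob_space) tendsto_in_probability_cong_AE:
  assumes "tendsto_in_probability M X Y" "\<And>n. AE w in M. X n w = X' n w"
    and [measurable]: "\<And>n. X' n \<in> borel_measurable M"
  shows "tendsto_in_probability M X' Y"
proof -
  have [measurable]: "X n \<in> borel_measurable M" "Y \<in> borel_measurable M" for n
    using assms unfolding tendsto_in_probability_def by auto
  have "prob {w \<in> space M. \<epsilon> < \<bar>X' n w - Y w\<bar>} = prob {w \<in> space M. \<epsilon> < \<bar>X n w - Y w\<bar>}" for n and \<epsilon> :: real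
    using assms(2)[of n] by (intro finite_measure_eq_AE) auto
  with assms(1) show ?thesis unfolding tendsto_in_probability_def by simp
qed

text \<open>The \<open>k\<close>-th member exceeds the threshold \<open>(1/2)^k\<close> with
  probability below \<open>(1/2)^k\<close>, so the first Borel-Cantelli lemma applies.\<close>

lemma (in prob_space) tendsto_in_probability_AE_subseq:
  assumes "tendsto_in_probability M X Y"
  obtains r :: "nat \<Rightarrow> nat" where "strict_mono r" "AE w in M. (\<lambda>n. X (r n) w) \<longlonglongrightarrow> Y w"
proof -
  have [measurable]: "X n \<in> borel_measurable M" "Y \<in> borel_measurable M" for n
    using assms unfolding tendsto_in_probability_def by auto
  let ?P = "\<lambda>k m. prob {w\<in>space M. (1/2)^k < \<bar>X m w - Y w\<bar>} < (1/2)^k"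
  have ev: "\<forall>\<^sub>F m in sequentially. ?P k m" for k
    using assms by (intro order_tendstoD(2)[of _ 0]) (auto simp: tendsto_in_probability_def)
  have "\<exists>r. \<forall>n. ?P n (r n) \<and> r n < r (Suc n)"
  proof (rule dependent_nat_choice)
    show "\<exists>x. ?P 0 x" using ev[of 0] by (auto simp: eventually_sequentially)
    show "\<exists>y. ?P (Suc n) y \<and> x < y" for x n
    proof -
      obtain N where "\<And>m. m \<ge> N \<Longrightarrow> ?P (Suc n) m"
        using ev[of "Suc n"] by (auto simp: eventually_sequentially)
      then show ?thesis by (intro exI[of _ "max N (Suc x)"]) auto
    qed
  qed
  then obtain r where r: "\<And>n. ?P n (r n)" and "\<And>n. r n < r (Suc n)" by auto
  then have "strict_mono r" by (simp add: strict_mono_Suc_iff)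
  moreover have "AE w in M. \<forall>\<^sub>F n in sequentially. w \<in> space M - {w\<in>space M. (1/2)^n < \<bar>X (r n) w - Y w\<bar>}"
  proof (rule borel_cantelli_AE1)
    show "summable (\<lambda>n. prob {w\<in>space M. (1/2)^n < \<bar>X (r n) w - Y w\<bar>})"
      by (rule summable_comparison_test_ev[where g="\<lambda>n. (1/2)^n"])
        (use r in \<open>auto simp: less_imp_le summable_geometric_iff\<close>)
  qed (auto simp: emeasure_eq_measure)
  then have "AE w in M. (\<lambda>n. X (r n) w) \<longlonglongrightarrow> Y w"
  proof eventually_elim
    case (elim w)
    have "(\<lambda>n. X (r n) w - Y w) \<longlonglongrightarrow> 0"
    proof (rule Lim_null_comparison)
      show "\<forall>\<^sub>F n in sequentially. norm (X (r n) w - Y w) \<le> (1/2)^n"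
        using elim by eventually_elim auto
      show "(\<lambda>n. (1/2::real)^n) \<longlonglongrightarrow> 0" by (intro LIMSEQ_realpow_zero) auto
    qed
    then show ?case by (simp add: LIM_zero_iff)
  qed
  ultimately show ?thesis using that by blast
qed

lemma (in prob_space) tendsto_in_probability_unique:
  assumes "tendsto_in_probability M X Y" "tendsto_in_probability M X Z"
  shows "AE w in M. Y w = Z w"
proof -
  obtain r where r: "strict_mono r" "AE w in M. (\<lambda>n. X (r n) w) \<longlonglongrightarrow> Y w"
    using tendsto_in_probability_AE_subseq[OF assms(1)] .
  obtain s where s: "strict_mono s" "AE w in M. (\<lambda>n. X (r (s n)) w) \<longlonglongrightarrow> Z w"
    using tendsto_in_probability_AE_subseq[OF tendsto_in_probability_subseq[OF assms(2) r(1)]] .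
  from r(2) s(2) show ?thesis
  proof eventually_elim
    case (elim w)
    have "(\<lambda>n. X (r (s n)) w) \<longlonglongrightarrow> Y w"
      using LIMSEQ_subseq_LIMSEQ[OF elim(1) s(1)] by (simp add: comp_def)
    with elim(2) show ?case by (rule LIMSEQ_unique[symmetric])
  qed
qed

text \<open>Fatou's lemma along an almost surely convergent subsequence.\<close>

lemma (in prob_space) sqnorm_le_in_probability:
  assumes "tendsto_in_probability M X Y" "\<And>n. sqnorm M (X n) \<le> c n" "c \<longlonglongrightarrow> C"
  shows "sqnorm M Y \<le> C"
proof -
  have [measurable]: "X n \<in> borel_measurable M" "Y \<in> borel_measurable M" for n
    using assms unfolding tendsto_in_probability_def by auto
  obtain r where r: "strict_mono r" "AE w in M. (\<lambda>n. X (r n) w) \<longlonglongrightarrow> Y w"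
    using tendsto_in_probability_AE_subseq[OF assms(1)] .
  have "sqnorm M Y = (\<integral>\<^sup>+w. liminf (\<lambda>n. ennreal ((X (r n) w)\<^sup>2)) \<partial>M)"
    unfolding sqnorm_def
  proof (rule nn_integral_cong_AE)
    from r(2) show "AE w in M. ennreal ((Y w)\<^sup>2) = liminf (\<lambda>n. ennreal ((X (r n) w)\<^sup>2))"
    proof eventually_elim
      case (elim w)
      then have "(\<lambda>n. ennreal ((X (r n) w)\<^sup>2)) \<longlonglongrightarrow> ennreal ((Y w)\<^sup>2)"
        by (intro tendsto_ennrealI tendsto_power)
      then show ?case by (intro lim_imp_Liminf[symmetric]) simp_all
    qed
  qed
  also have "\<dots> \<le> liminf (\<lambda>n. sqnorm M (X (r n)))"
    unfolding sqnorm_def by (rule nn_integral_liminf) measurable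
  also have "\<dots> \<le> liminf (\<lambda>n. c (r n))"
    by (intro Liminf_mono always_eventually allI assms)
  also have "\<dots> = C"
    using LIMSEQ_subseq_LIMSEQ[OF assms(3) r(1)] by (intro lim_imp_Liminf) (auto simp: comp_def)
  finally show ?thesis .
qed

section \<open>Integrals of simple functions\<close>

text \<open>Moves independence from the natural numbers, where independent scattering provides it,
  to other index sets.\<close>

lemma (in prob_space) indep_vars_reindex:
  assumes indep: "indep_vars N X (f ` I)" and inj: "inj_on f I"
  shows "indep_vars (\<lambda>i. N (f i)) (\<lambda>i. X (f i)) I"
proof -
  let ?F = "\<lambda>i. sigma_sets (space M) {X i -` A \<inter> space M |A. A \<in> sets (N i)}"
  have "indep_sets (\<lambda>i. ?F (f i)) I"
    unfolding indep_sets_def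
  proof (intro conjI ballI allI impI)
    fix i assume "i \<in> I"
    then show "?F (f i) \<subseteq> events"
      using indep unfolding indep_vars_def indep_sets_def by auto
  next
    fix J A assume J: "J \<subseteq> I" "J \<noteq> {}" "finite J" and A: "A \<in> (\<Pi> j\<in>J. ?F (f j))"
    have injJ: "inj_on f J" using inj J(1) by (rule inj_on_subset)
    let ?A = "\<lambda>m. A (inv_into J f m)"
    have "?A \<in> (\<Pi> m\<in>f ` J. ?F m)"
      using A injJ by (auto simp: Pi_iff)
    moreover have "\<forall>J\<subseteq>f ` I. J \<noteq> {} \<longrightarrow> finite J \<longrightarrow>
        (\<forall>A\<in>Pi J ?F. prob (\<Inter>j\<in>J. A j) = (\<Prod>j\<in>J. prob (A j)))"
      using indep unfolding indep_vars_def indep_sets_def by (elim conjE)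
    moreover have "f ` J \<subseteq> f ` I" "f ` J \<noteq> {}" "finite (f ` J)" using J by auto
    ultimately have "prob (\<Inter>m\<in>f ` J. ?A m) = (\<Prod>m\<in>f ` J. prob (?A m))"
      by blast
    then show "prob (\<Inter>j\<in>J. A j) = (\<Prod>j\<in>J. prob (A j))"
      using injJ by (simp add: prod.reindex)
  qed
  then show ?thesis
    using indep unfolding indep_vars_def by auto
qed

section \<open>Simple functions and their level sets\<close>

lemma levy_simple_combine:
  fixes f :: "real \<Rightarrow> real \<Rightarrow> real"
  assumes "levy_simple h" "levy_simple k" "f 0 0 = 0"
    and f: "(\<lambda>s. f (h s) (k s)) \<in> borel_measurable borel"
  shows "levy_simple (\<lambda>s. f (h s) (k s))"
proof -
  have "range (\<lambda>s. f (h s) (k s)) \<subseteq> (\<lambda>(x, y). f x y) ` (range h \<times> range k)" by auto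
  then have "finite (range (\<lambda>s. f (h s) (k s)))"
    by (rule finite_subset) (use assms in \<open>auto simp: levy_simple_def\<close>)
  moreover have "bounded {s. f (h s) (k s) \<noteq> 0}"
    by (rule bounded_subset[of "{s. h s \<noteq> 0} \<union> {s. k s \<noteq> 0}"])
      (use assms in \<open>auto simp: levy_simple_def\<close>)
  ultimately show ?thesis using f unfolding levy_simple_def by auto
qed

lemma levy_simple_add:
  assumes "levy_simple h" "levy_simple k"
  shows "levy_simple (\<lambda>s. h s + k s)"
  using assms by (intro levy_simple_combine[where f="(+)"]) (auto simp: levy_simple_def)

lemma levy_simple_diff:
  assumes "levy_simple h" "levy_simple k"
  shows "levy_simple (\<lambda>s. h s - k s)"
  using assms by (intro levy_simple_combine[where f="(-)"]) (auto simp: levy_simple_def)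

lemma levy_simple_indicator:
  assumes "levy_simple h" "A \<in> sets borel"
  shows "levy_simple (\<lambda>s. indicator A s * h s)"
proof -
  have "range (\<lambda>s. indicator A s * h s) \<subseteq> insert 0 (range h)"
    by (auto simp: indicator_def)
  then have "finite (range (\<lambda>s. indicator A s * h s))"
    by (rule finite_subset) (use assms in \<open>auto simp: levy_simple_def\<close>)
  moreover have "bounded {s. indicator A s * h s \<noteq> 0}"
    by (rule bounded_subset[of "{s. h s \<noteq> 0}"]) (use assms in \<open>auto simp: levy_simple_def\<close>)
  ultimately show ?thesis using assms unfolding levy_simple_def by auto
qed

text \<open>The value 0 is excluded because its level set is unbounded, and \<open>\<Lambda>\<close>
  means nothing there.\<close>

lemma levy_simple_level_set:
  assumes "levy_simple h" "x \<noteq> 0"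
  shows "bounded_borel (h -` {x})"
proof
  show "h -` {x} \<in> sets borel"
    using assms by (intro measurable_sets_borel) (auto simp: levy_simple_def)
  show "bounded (h -` {x})"
    by (rule bounded_subset[of "{s. h s \<noteq> 0}"]) (use assms in \<open>auto simp: levy_simple_def\<close>)
qed

lemma bounded_borel_Int:
  "bounded_borel B \<Longrightarrow> A \<in> sets borel \<Longrightarrow> bounded_borel (A \<inter> B)"
  using bounded_subset[of B "A \<inter> B"] by auto

text \<open>Additivity and orthogonality need only this much. The variance bound waits for a second
  locale because, for a homogeneous basis, it is itself derived from the orthogonality proved
  here.\<close>

locale centred_scattered_measure = prob_space P for P :: "'w measure" +
  fixes \<Lambda> :: "(real ^ 'd) set \<Rightarrow> 'w \<Rightarrow> real"
  assumes scattered: "independently_scattered P \<Lambda>"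
    and mean: "bounded_borel B \<Longrightarrow> expectation (\<Lambda> B) = 0"
    and square_integrable: "bounded_borel B \<Longrightarrow> square_integrable P (\<Lambda> B)"
begin

lemma measurable_basis: "bounded_borel B \<Longrightarrow> \<Lambda> B \<in> borel_measurable P"
  using square_integrable[of B] by (simp add: square_integrable_def)

lemma
  fixes B :: "nat \<Rightarrow> (real ^ 'd) set"
  assumes "\<And>n. bounded_borel (B n)" "disjoint_family B"
  shows indep_sequence: "indep_vars (\<lambda>_. borel) (\<lambda>n. \<Lambda> (B n)) UNIV"
    and AE_sums: "bounded (\<Union>n. B n) \<Longrightarrow> AE w in P. (\<lambda>n. \<Lambda> (B n) w) sums \<Lambda> (\<Union>n. B n) w"
proof -
  have "indep_vars (\<lambda>_. borel) (\<lambda>n. \<Lambda> (B n)) UNIV \<and>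
      (bounded (\<Union>n. B n) \<longrightarrow> (AE w in P. (\<lambda>n. \<Lambda> (B n) w) sums \<Lambda> (\<Union>n. B n) w))"
    using assms
    by (intro scattered[unfolded independently_scattered_def, THEN conjunct2, THEN spec, THEN mp]) simp
  then show "indep_vars (\<lambda>_. borel) (\<lambda>n. \<Lambda> (B n)) UNIV"
    and "bounded (\<Union>n. B n) \<Longrightarrow> AE w in P. (\<lambda>n. \<Lambda> (B n) w) sums \<Lambda> (\<Union>n. B n) w"
    by simp_all
qed

text \<open>The constant sequence of empty sets is disjoint, and a constant series converges only if
  its terms vanish.\<close>

lemma AE_empty: "AE w in P. \<Lambda> {} w = 0"
proof -
  have "AE w in P. (\<lambda>n::nat. \<Lambda> {} w) sums \<Lambda> (\<Union>n::nat. {}) w"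
    by (rule AE_sums) (auto simp: disjoint_family_on_def)
  then show ?thesis
  proof eventually_elim
    case (elim w)
    then have "summable (\<lambda>n::nat. \<Lambda> {} w)" by (rule sums_summable)
    then show ?case by (simp add: summable_const_iff)
  qed
qed

text \<open>The finite family is numbered and padded with empty sets to a disjoint sequence; by
  \<open>AE_empty\<close> the padding adds nothing to the sum.\<close>

lemma
  fixes I :: "'i set"
  assumes "finite I" "\<And>i. i \<in> I \<Longrightarrow> bounded_borel (C i)" "disjoint_family_on C I"
  shows indep_family: "indep_vars (\<lambda>_. borel) (\<lambda>i. \<Lambda> (C i)) I"
    and AE_additive: "AE w in P. \<Lambda> (\<Union>i\<in>I. C i) w = (\<Sum>i\<in>I. \<Lambda> (C i) w)"
proof -
  obtain f :: "'i \<Rightarrow> nat" where f: "bij_betw f I {0..<card I}"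
    using ex_bij_betw_finite_nat[OF assms(1)] by blast
  have inj: "inj_on f I" using f by (rule bij_betw_imp_inj_on)
  define B where "B m = (if m \<in> f ` I then C (inv_into I f m) else {})" for m
  have Bf: "B (f i) = C i" if "i \<in> I" for i
    using that inj by (simp add: B_def)
  have B: "bounded_borel (B n)" for n
    using assms(2) inj by (auto simp: B_def)
  have dj: "disjoint_family B"
    unfolding disjoint_family_on_def
  proof (intro ballI impI)
    fix m n :: nat assume mn: "m \<noteq> n"
    show "B m \<inter> B n = {}"
    proof (cases "m \<in> f ` I \<and> n \<in> f ` I")
      case True
      then obtain i j where "i \<in> I" "j \<in> I" "m = f i" "n = f j" by auto
      moreover have "i \<noteq> j" using calculation mn by auto
      ultimately show ?thesis using assms(3) by (simp add: Bf disjoint_family_on_def)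
    qed (auto simp: B_def)
  qed
  have UB: "(\<Union>n. B n) = (\<Union>i\<in>I. C i)"
  proof (intro equalityI subsetI)
    fix s assume "s \<in> (\<Union>n. B n)"
    then obtain n where "s \<in> B n" by auto
    then show "s \<in> (\<Union>i\<in>I. C i)"
      by (cases "n \<in> f ` I") (auto simp: B_def intro!: bexI[of _ "inv_into I f n"] inv_into_into)
  next
    fix s assume "s \<in> (\<Union>i\<in>I. C i)"
    then obtain i where "i \<in> I" "s \<in> C i" by auto
    then show "s \<in> (\<Union>n. B n)" using Bf by (intro UN_I[of "f i"]) auto
  qed
  have "indep_vars (\<lambda>_. borel) (\<lambda>n. \<Lambda> (B n)) UNIV"
    using B dj by (rule indep_sequence)
  then have "indep_vars (\<lambda>_. borel) (\<lambda>n. \<Lambda> (B n)) (f ` I)"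
    by (rule indep_vars_subset) simp
  from indep_vars_reindex[OF this inj]
  show "indep_vars (\<lambda>_. borel) (\<lambda>i. \<Lambda> (C i)) I"
    by (subst (asm) indep_vars_cong[OF refl, of _ _ "\<lambda>i. \<Lambda> (C i)" _ "\<lambda>_. borel"]) (auto simp: Bf)
  have "bounded (\<Union>n. B n)" unfolding UB using assms by (intro bounded_UN) auto
  then have "AE w in P. (\<lambda>n. \<Lambda> (B n) w) sums \<Lambda> (\<Union>n. B n) w"
    using B dj by (intro AE_sums)
  with AE_empty show "AE w in P. \<Lambda> (\<Union>i\<in>I. C i) w = (\<Sum>i\<in>I. \<Lambda> (C i) w)"
  proof eventually_elim
    case (elim w)
    have "(\<lambda>n. \<Lambda> (B n) w) sums (\<Sum>n\<in>f ` I. \<Lambda> (B n) w)"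
      using assms(1) elim(1) by (intro sums_finite) (auto simp: B_def)
    also have "(\<Sum>n\<in>f ` I. \<Lambda> (B n) w) = (\<Sum>i\<in>I. \<Lambda> (C i) w)"
      using inj by (simp add: sum.reindex Bf)
    finally show ?case using elim(2) sums_unique2 unfolding UB by blast
  qed
qed

text \<open>Values on disjoint sets are independent with mean zero, so all mixed terms
  vanish.\<close>

lemma expectation_sum_square:
  fixes I :: "'i set"
  assumes "finite I" "\<And>i. i \<in> I \<Longrightarrow> bounded_borel (C i)" "disjoint_family_on C I"
  shows "expectation (\<lambda>w. (\<Sum>i\<in>I. c i * \<Lambda> (C i) w)\<^sup>2) =
    (\<Sum>i\<in>I. (c i)\<^sup>2 * expectation (\<lambda>w. (\<Lambda> (C i) w)\<^sup>2))"
proof -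
  have int: "integrable P (\<lambda>w. \<Lambda> (C i) w * \<Lambda> (C j) w)" if "i \<in> I" "j \<in> I" for i j
    using that assms by (intro square_integrable_mult square_integrable) auto
  have int1: "integrable P (\<Lambda> (C i))" if "i \<in> I" for i
    using square_integrable_mult[OF square_integrable[OF assms(2)[OF that]], of "\<lambda>_. 1"]
    by (simp add: square_integrable_def)
  have orth: "expectation (\<lambda>w. \<Lambda> (C i) w * \<Lambda> (C j) w) = 0" if "i \<in> I" "j \<in> I" "i \<noteq> j" for i j
  proof -
    have "indep_vars (\<lambda>_. borel) (\<lambda>i. \<Lambda> (C i)) {i, j}"
      using indep_family[OF assms] by (rule indep_vars_subset) (use that in auto)
    then have "expectation (\<lambda>w. \<Prod>k\<in>{i,j}. \<Lambda> (C k) w) = (\<Prod>k\<in>{i,j}. expectation (\<Lambda> (C k)))"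
      by (rule indep_vars_lebesgue_integral[rotated]) (use that int1 in auto)
    then show ?thesis using that mean[OF assms(2)] by simp
  qed
  have "expectation (\<lambda>w. (\<Sum>i\<in>I. c i * \<Lambda> (C i) w)\<^sup>2) =
      expectation (\<lambda>w. \<Sum>i\<in>I. \<Sum>j\<in>I. (c i * c j) * (\<Lambda> (C i) w * \<Lambda> (C j) w))"
    by (simp add: power2_eq_square sum_product mult_ac)
  also have "\<dots> = (\<Sum>i\<in>I. \<Sum>j\<in>I. (c i * c j) * expectation (\<lambda>w. \<Lambda> (C i) w * \<Lambda> (C j) w))"
    using int by (simp add: Bochner_Integration.integral_sum)
  also have "\<dots> = (\<Sum>i\<in>I. \<Sum>j\<in>I. if j = i then (c i)\<^sup>2 * expectation (\<lambda>w. (\<Lambda> (C i) w)\<^sup>2) else 0)"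
    using orth by (intro sum.cong refl) (auto simp: power2_eq_square)
  also have "\<dots> = (\<Sum>i\<in>I. (c i)\<^sup>2 * expectation (\<lambda>w. (\<Lambda> (C i) w)\<^sup>2))"
    using assms(1) by simp
  finally show ?thesis .
qed

lemma AE_levy_simple_integral_eq:
  fixes I :: "'i set"
  assumes I: "finite I" "\<And>i. i \<in> I \<Longrightarrow> bounded_borel (C i)" "disjoint_family_on C I"
    and h: "levy_simple h" "\<And>s. h s = (\<Sum>i\<in>I. c i * indicator (C i) s)"
    and A: "A \<in> sets borel"
  shows "AE w in P. levy_simple_integral \<Lambda> A h w = (\<Sum>i\<in>I. c i * \<Lambda> (A \<inter> C i) w)"
proof -
  have hC: "h s = c i" if "i \<in> I" "s \<in> C i" for i s
  proof -
    have "h s = (\<Sum>j\<in>I. if j = i then c i else 0)"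
      unfolding h(2) using that I(3) unfolding disjoint_family_on_def
      by (intro sum.cong refl) (auto simp: indicator_def)
    then show ?thesis using that I(1) by simp
  qed
  have level: "h -` {x} = (\<Union>i\<in>{i\<in>I. c i = x}. C i)" if "x \<noteq> 0" for x
  proof
    show "h -` {x} \<subseteq> (\<Union>i\<in>{i\<in>I. c i = x}. C i)"
    proof
      fix s assume s: "s \<in> h -` {x}"
      then have "h s \<noteq> 0" using that by simp
      then have "\<not> (\<forall>i\<in>I. c i * indicator (C i) s = 0)"
        unfolding h(2) by (intro notI) simp
      then obtain i where "i \<in> I" "s \<in> C i" by (auto simp: indicator_def split: if_splits)
      then show "s \<in> (\<Union>i\<in>{i\<in>I. c i = x}. C i)" using hC[of i s] s by auto
    qed
    show "(\<Union>i\<in>{i\<in>I. c i = x}. C i) \<subseteq> h -` {x}"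
    proof
      fix s assume "s \<in> (\<Union>i\<in>{i\<in>I. c i = x}. C i)"
      then obtain i where "i \<in> I" "c i = x" "s \<in> C i" by auto
      then show "s \<in> h -` {x}" using hC[of i s] by simp
    qed
  qed
  have fin: "finite (range h - {0})" using h(1) by (auto simp: levy_simple_def)
  have "AE w in P. \<forall>x\<in>range h - {0}. \<Lambda> (A \<inter> h -` {x}) w = (\<Sum>i\<in>{i\<in>I. c i = x}. \<Lambda> (A \<inter> C i) w)"
  proof (rule AE_finite_allI[OF fin])
    fix x assume "x \<in> range h - {0}"
    then have "A \<inter> h -` {x} = (\<Union>i\<in>{i\<in>I. c i = x}. A \<inter> C i)" using level[of x] by auto
    moreover have "AE w in P. \<Lambda> (\<Union>i\<in>{i\<in>I. c i = x}. A \<inter> C i) w = (\<Sum>i\<in>{i\<in>I. c i = x}. \<Lambda> (A \<inter> C i) w)"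
      using I A by (intro AE_additive bounded_borel_Int) (auto simp: disjoint_family_on_def)
    ultimately show "AE w in P. \<Lambda> (A \<inter> h -` {x}) w = (\<Sum>i\<in>{i\<in>I. c i = x}. \<Lambda> (A \<inter> C i) w)"
      by simp
  qed
  with AE_empty show ?thesis
  proof eventually_elim
    case (elim w)
    have "levy_simple_integral \<Lambda> A h w =
        (\<Sum>x\<in>range h - {0}. \<Sum>i\<in>{i\<in>{i\<in>I. c i \<in> range h - {0}}. c i = x}. c i * \<Lambda> (A \<inter> C i) w)"
      unfolding levy_simple_integral_def
    proof (intro sum.cong refl)
      fix x assume x: "x \<in> range h - {0}"
      then have eq: "{i\<in>{i\<in>I. c i \<in> range h - {0}}. c i = x} = {i\<in>I. c i = x}" by auto
      have "x * \<Lambda> (A \<inter> h -` {x}) w = (\<Sum>i\<in>{i\<in>I. c i = x}. x * \<Lambda> (A \<inter> C i) w)"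
        unfolding bspec[OF elim(2) x] by (rule sum_distrib_left)
      also have "\<dots> = (\<Sum>i\<in>{i\<in>{i\<in>I. c i \<in> range h - {0}}. c i = x}. c i * \<Lambda> (A \<inter> C i) w)"
        unfolding eq by (intro sum.cong) auto
      finally show "x * \<Lambda> (A \<inter> h -` {x}) w =
          (\<Sum>i\<in>{i\<in>{i\<in>I. c i \<in> range h - {0}}. c i = x}. c i * \<Lambda> (A \<inter> C i) w)" .
    qed
    also have "\<dots> = (\<Sum>i\<in>{i\<in>I. c i \<in> range h - {0}}. c i * \<Lambda> (A \<inter> C i) w)"
      using I(1) fin by (intro sum.group) auto
    also have "\<dots> = (\<Sum>i\<in>I. c i * \<Lambda> (A \<inter> C i) w)"
    proof (rule sum.mono_neutral_left)
      show "\<forall>i\<in>I - {i \<in> I. c i \<in> range h - {0}}. c i * \<Lambda> (A \<inter> C i) w = 0"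
      proof
        fix i assume i: "i \<in> I - {i \<in> I. c i \<in> range h - {0}}"
        show "c i * \<Lambda> (A \<inter> C i) w = 0"
        \<comment> \<open>The coefficient of an empty cell need not be a value of \<open>h\<close>;
          its term vanishes because \<open>\<Lambda> {}\<close> does.\<close>
        proof (cases "C i = {}")
          case True then show ?thesis using elim(1) by simp
        next
          case False
          then obtain s where "s \<in> C i" by auto
          then have "c i \<in> range h" using i hC[of i s] by (metis DiffE rangeI)
          then have "c i = 0" using i by auto
          then show ?thesis by simp
        qed
      qed
    qed (use I(1) in auto)
    finally show ?case .
  qed
qed

lemma levy_simple_integral_measurable:
  assumes "levy_simple h" "A \<in> sets borel"
  shows "levy_simple_integral \<Lambda> A h \<in> borel_measurable P"
  unfolding levy_simple_integral_def using assms
  by (intro borel_measurable_sum borel_measurable_times borel_measurable_const measurable_basis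
      bounded_borel_Int levy_simple_level_set) auto

text \<open>Both functions are constant on the cells indexed by pairs of values, so all integrals
  are sums over this common refinement. The pair (0, 0) is left out, its cell being
  unbounded.\<close>

lemma
  assumes h: "levy_simple h" and k: "levy_simple k" and A: "A \<in> sets borel"
  shows AE_levy_simple_integral_diff: "AE w in P. levy_simple_integral \<Lambda> A (\<lambda>s. h s - k s) w =
      levy_simple_integral \<Lambda> A h w - levy_simple_integral \<Lambda> A k w"
    and AE_levy_simple_integral_add: "AE w in P. levy_simple_integral \<Lambda> A (\<lambda>s. h s + k s) w =
      levy_simple_integral \<Lambda> A h w + levy_simple_integral \<Lambda> A k w"
proof -
  define I where "I = range h \<times> range k - {(0, 0)}"
  define C where "C z = h -` {fst z} \<inter> k -` {snd z}" for z
  have fin: "finite I" using h k by (auto simp: I_def levy_simple_def)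
  have C: "bounded_borel (C z)" if "z \<in> I" for z
  proof -
    have "h -` {fst z} \<in> sets borel" "k -` {snd z} \<in> sets borel"
      using h k by (auto intro!: measurable_sets_borel simp: levy_simple_def)
    moreover have "bounded (C z)"
      by (rule bounded_subset[of "{s. h s \<noteq> 0} \<union> {s. k s \<noteq> 0}"])
        (use that h k in \<open>auto simp: levy_simple_def C_def I_def\<close>)
    ultimately show ?thesis by (auto simp: C_def)
  qed
  have disj: "disjoint_family_on C I"
    by (auto simp: disjoint_family_on_def C_def)
  have rep: "f (h s) (k s) = (\<Sum>z\<in>I. f (fst z) (snd z) * indicator (C z) s)"
    if "f 0 0 = 0" for f :: "real \<Rightarrow> real \<Rightarrow> real" and s
  proof -
    have "(\<Sum>z\<in>I. f (fst z) (snd z) * indicator (C z) s) =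
        (\<Sum>z\<in>I. if z = (h s, k s) then f (h s) (k s) else 0)"
      by (intro sum.cong refl) (auto simp: C_def indicator_def)
    also have "\<dots> = (if (h s, k s) \<in> I then f (h s) (k s) else 0)"
      using fin by simp
    also have "\<dots> = f (h s) (k s)" using that by (auto simp: I_def)
    finally show ?thesis by simp
  qed
  have d: "AE w in P. levy_simple_integral \<Lambda> A (\<lambda>s. h s - k s) w = (\<Sum>z\<in>I. (fst z - snd z) * \<Lambda> (A \<inter> C z) w)"
    by (rule AE_levy_simple_integral_eq[OF fin C disj levy_simple_diff[OF h k] rep[of "\<lambda>x y. x - y"] A]) simp_all
  have ph: "AE w in P. levy_simple_integral \<Lambda> A h w = (\<Sum>z\<in>I. fst z * \<Lambda> (A \<inter> C z) w)"
    by (rule AE_levy_simple_integral_eq[OF fin C disj h rep[of "\<lambda>x y. x"] A]) simp_all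
  have pk: "AE w in P. levy_simple_integral \<Lambda> A k w = (\<Sum>z\<in>I. snd z * \<Lambda> (A \<inter> C z) w)"
    by (rule AE_levy_simple_integral_eq[OF fin C disj k rep[of "\<lambda>x y. y"] A]) simp_all
  have a: "AE w in P. levy_simple_integral \<Lambda> A (\<lambda>s. h s + k s) w = (\<Sum>z\<in>I. (fst z + snd z) * \<Lambda> (A \<inter> C z) w)"
    by (rule AE_levy_simple_integral_eq[OF fin C disj levy_simple_add[OF h k] rep[of "\<lambda>x y. x + y"] A]) simp_all
  from d ph pk show "AE w in P. levy_simple_integral \<Lambda> A (\<lambda>s. h s - k s) w =
      levy_simple_integral \<Lambda> A h w - levy_simple_integral \<Lambda> A k w"
    by eventually_elim (simp only: sum_subtractf[symmetric] left_diff_distrib)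
  from a ph pk show "AE w in P. levy_simple_integral \<Lambda> A (\<lambda>s. h s + k s) w =
      levy_simple_integral \<Lambda> A h w + levy_simple_integral \<Lambda> A k w"
    by eventually_elim (simp only: sum.distrib[symmetric] distrib_right)
qed

lemma levy_simple_canonical:
  assumes "levy_simple h"
  shows "finite (range h - {0})" "\<And>x. x \<in> range h - {0} \<Longrightarrow> bounded_borel (h -` {x})"
    "disjoint_family_on (\<lambda>x. h -` {x}) (range h - {0})"
    "\<And>s. h s = (\<Sum>x\<in>range h - {0}. x * indicator (h -` {x}) s)"
proof -
  show fin: "finite (range h - {0})" using assms by (auto simp: levy_simple_def)
  show "\<And>x. x \<in> range h - {0} \<Longrightarrow> bounded_borel (h -` {x})"
    using levy_simple_level_set[OF assms] by auto
  show "disjoint_family_on (\<lambda>x. h -` {x}) (range h - {0})"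
    by (auto simp: disjoint_family_on_def)
  fix s
  have "(\<Sum>x\<in>range h - {0}. x * indicator (h -` {x}) s) = (\<Sum>x\<in>range h - {0}. if x = h s then h s else 0)"
    by (intro sum.cong refl) (auto simp: indicator_def)
  also have "\<dots> = h s" using fin by auto
  finally show "h s = (\<Sum>x\<in>range h - {0}. x * indicator (h -` {x}) s)" by simp
qed

text \<open>Lets an integral over a set be read as one of a cut-off function over the whole space,
  which is how different integrands on complementary sets are joined.\<close>

lemma AE_levy_simple_integral_indicator:
  assumes h: "levy_simple h" and A: "A \<in> sets borel" and B: "B \<in> sets borel"
  shows "AE w in P. levy_simple_integral \<Lambda> A (\<lambda>s. indicator B s * h s) w =
    levy_simple_integral \<Lambda> (A \<inter> B) h w"
proof -
  note c = levy_simple_canonical[OF h]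
  have "AE w in P. levy_simple_integral \<Lambda> A (\<lambda>s. indicator B s * h s) w =
      (\<Sum>x\<in>range h - {0}. x * \<Lambda> (A \<inter> (B \<inter> h -` {x})) w)"
  proof (rule AE_levy_simple_integral_eq[OF c(1) bounded_borel_Int[OF c(2) B] _ levy_simple_indicator[OF h B] _ A])
    show "disjoint_family_on (\<lambda>x. B \<inter> h -` {x}) (range h - {0})"
      by (auto simp: disjoint_family_on_def)
    show "indicator B s * h s = (\<Sum>x\<in>range h - {0}. x * indicator (B \<inter> h -` {x}) s)" for s
      by (subst c(4)) (simp add: sum_distrib_left indicator_inter_arith mult_ac)
  qed
  then show ?thesis by eventually_elim (simp add: levy_simple_integral_def Int_assoc)
qed

lemma levy_simple_integral_square_integrable:
  assumes "levy_simple h" "A \<in> sets borel"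
  shows "square_integrable P (levy_simple_integral \<Lambda> A h)"
  unfolding levy_simple_integral_def using assms
  by (intro square_integrable_sum square_integrable_cmult square_integrable
      bounded_borel_Int levy_simple_level_set) auto

end

text \<open>The variance enters as an upper bound and not as an identity since every later estimate
  is one-sided.\<close>

locale centred_random_measure = centred_scattered_measure P \<Lambda>
  for P :: "'w measure" and \<Lambda> :: "(real ^ 'd) set \<Rightarrow> 'w \<Rightarrow> real" +
  fixes \<kappa> :: real
  assumes variance_le: "bounded_borel B \<Longrightarrow> expectation (\<lambda>w. (\<Lambda> B w)\<^sup>2) \<le> \<kappa> * measure lborel B"
    and nonneg: "0 \<le> \<kappa>"
begin

text \<open>The level sets are disjoint, so the second moment is a weighted sum of variances.
  Replacing each variance by its bound turns this sum into the integral of the squared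
  function.\<close>

lemma sqnorm_levy_simple_integral_le:
  assumes h: "levy_simple h" and A: "A \<in> sets borel"
  shows "sqnorm P (levy_simple_integral \<Lambda> A h) \<le> ennreal \<kappa> * sqnorm lborel (\<lambda>s. indicator A s * h s)"
proof -
  note c = levy_simple_canonical[OF h]
  have d: "disjoint_family_on (\<lambda>x. A \<inter> h -` {x}) (range h - {0})"
    by (auto simp: disjoint_family_on_def)
  have mA: "A \<inter> h -` {x} \<in> sets borel" for x
    using h A by (intro sets.Int measurable_sets_borel[of h]) (auto simp: levy_simple_def)
  have em: "emeasure lborel (A \<inter> h -` {x}) = ennreal (measure lborel (A \<inter> h -` {x}))" if "x \<in> range h - {0}" for x
    using bounded_borel_Int[OF c(2)[OF that] A]
    by (intro emeasure_eq_ennreal_measure) (auto simp: less_top[symmetric] dest: emeasure_bounded_finite)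
  have "sqnorm P (levy_simple_integral \<Lambda> A h) =
      ennreal (expectation (\<lambda>w. (\<Sum>x\<in>range h - {0}. x * \<Lambda> (A \<inter> h -` {x}) w)\<^sup>2))"
    using sqnorm_eq_integral[OF levy_simple_integral_square_integrable[OF h A]]
    unfolding levy_simple_integral_def by simp
  also have "\<dots> = ennreal (\<Sum>x\<in>range h - {0}. x\<^sup>2 * expectation (\<lambda>w. (\<Lambda> (A \<inter> h -` {x}) w)\<^sup>2))"
    by (subst expectation_sum_square[OF c(1) bounded_borel_Int[OF c(2) A] d]) auto
  also have "\<dots> \<le> ennreal (\<Sum>x\<in>range h - {0}. x\<^sup>2 * (\<kappa> * measure lborel (A \<inter> h -` {x})))"
    using c(2) A by (intro ennreal_leI sum_mono mult_left_mono variance_le bounded_borel_Int) auto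
  also have "\<dots> = ennreal \<kappa> * (\<Sum>x\<in>range h - {0}. ennreal (x\<^sup>2) * emeasure lborel (A \<inter> h -` {x}))"
    using nonneg em by (subst sum_ennreal[symmetric])
      (auto simp: sum_distrib_left ennreal_mult'' mult_ac intro!: sum.cong)
  also have "(\<Sum>x\<in>range h - {0}. ennreal (x\<^sup>2) * emeasure lborel (A \<inter> h -` {x})) =
      (\<integral>\<^sup>+s. (\<Sum>x\<in>range h - {0}. ennreal (x\<^sup>2) * indicator (A \<inter> h -` {x}) s) \<partial>lborel)"
    using mA by (subst nn_integral_sum) (auto simp: nn_integral_cmult_indicator intro!: sum.cong)
  also have "\<dots> = sqnorm lborel (\<lambda>s. indicator A s * h s)"
    unfolding sqnorm_def
  proof (intro nn_integral_cong)
    fix s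
    have "(\<Sum>x\<in>range h - {0}. ennreal (x\<^sup>2) * indicator (A \<inter> h -` {x}) s) =
        (\<Sum>x\<in>range h - {0}. if x = h s then ennreal ((h s)\<^sup>2) * indicator A s else 0)"
      by (intro sum.cong refl) (auto simp: indicator_def)
    also have "\<dots> = ennreal ((indicator A s * h s)\<^sup>2)"
      using c(1) by (auto simp: indicator_def)
    finally show "(\<Sum>x\<in>range h - {0}. ennreal (x\<^sup>2) * indicator (A \<inter> h -` {x}) s) =
        ennreal ((indicator A s * h s)\<^sup>2)" .
  qed
  finally show ?thesis .
qed

lemma sqnorm_levy_simple_integral_diff_le:
  assumes h: "levy_simple h" and k: "levy_simple k" and A: "A \<in> sets borel"
  shows "sqnorm P (\<lambda>w. levy_simple_integral \<Lambda> A h w - levy_simple_integral \<Lambda> A k w)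
    \<le> ennreal \<kappa> * sqnorm lborel (\<lambda>s. indicator A s * (h s - k s))"
proof -
  have "sqnorm P (\<lambda>w. levy_simple_integral \<Lambda> A h w - levy_simple_integral \<Lambda> A k w) =
      sqnorm P (levy_simple_integral \<Lambda> A (\<lambda>s. h s - k s))"
    by (rule sqnorm_cong_AE) (use AE_levy_simple_integral_diff[OF assms] in auto)
  also have "\<dots> \<le> ennreal \<kappa> * sqnorm lborel (\<lambda>s. indicator A s * (h s - k s))"
    by (rule sqnorm_levy_simple_integral_le[OF levy_simple_diff[OF h k] A])
  finally show ?thesis .
qed

end

section \<open>Second moments of Rajput--Rosinski integrals\<close>

text \<open>Pointwise null sequences need not be null in the mean, and the sets of bad points must be
  chosen so that they work for a whole subsequence: the \<open>k\<close>-th bad set is chosen after the first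
  \<open>k - 1\<close> functions, on which it then carries little mass. The set \<open>A\<close> collects the points whose
  last bad index is even.\<close>

lemma (in sigma_finite_measure) gliding_hump:
  fixes \<theta> :: "nat \<Rightarrow> 'a \<Rightarrow> ennreal"
  assumes [measurable]: "\<And>n. \<theta> n \<in> borel_measurable M"
    and fin: "\<And>n. (\<integral>\<^sup>+s. \<theta> n s \<partial>M) < \<infinity>"
    and lim: "AE s in M. (\<lambda>n. \<theta> n s) \<longlonglongrightarrow> 0"
  obtains r :: "nat \<Rightarrow> nat" and A where "strict_mono r" "A \<in> sets M"
    "(\<lambda>k. \<integral>\<^sup>+s. \<theta> (r k) s * indicator (if even k then space M - A else A) s \<partial>M) \<longlonglongrightarrow> 0"
proof -
  \<comment> \<open>On a space of infinite measure constant thresholds are not integrable; a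
    strictly positive integrable weight takes their place.\<close>
  obtain \<gamma> where [measurable]: "\<gamma> \<in> borel_measurable M" and \<gamma>fin: "integral\<^sup>N M \<gamma> \<noteq> \<infinity>"
    and \<gamma>pos: "\<And>s. s \<in> space M \<Longrightarrow> 0 < \<gamma> s"
    using Ex_finite_integrable_function by blast
  define e where "e k = ennreal ((1/2)^k)" for k
  have epos: "0 < e k" for k by (simp add: e_def)
  define D where "D n k = {s\<in>space M. e k * \<gamma> s < \<theta> n s}" for n k
  have [measurable]: "D n k \<in> sets M" for n k unfolding D_def by measurable
  have D_lim: "(\<lambda>n. \<integral>\<^sup>+s. \<theta> m s * indicator (D n k) s \<partial>M) \<longlonglongrightarrow> 0" for m k
  proof -
    have "(\<lambda>n. \<integral>\<^sup>+s. \<theta> m s * indicator (D n k) s \<partial>M) \<longlonglongrightarrow> (\<integral>\<^sup>+s. 0 \<partial>M)"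
    proof (rule nn_integral_dominated_convergence[where w="\<theta> m"])
      show "AE s in M. (\<lambda>n. \<theta> m s * indicator (D n k) s) \<longlonglongrightarrow> 0"
        using lim
      proof (eventually_elim, goal_cases)
        case (1 s)
        have "\<forall>\<^sub>F n in sequentially. \<theta> m s * indicator (D n k) s = 0"
        proof (cases "s \<in> space M")
          case True
          then have "0 < e k * \<gamma> s" using epos \<gamma>pos by (simp add: ennreal_zero_less_mult_iff)
          from order_tendstoD(2)[OF 1 this] show ?thesis
            by eventually_elim (auto simp: D_def indicator_def)
        qed (simp add: D_def)
        then show ?case by (rule tendsto_eventually)
      qed
      show "(\<integral>\<^sup>+s. \<theta> m s \<partial>M) < \<infinity>" by (rule fin)
    qed (auto simp: indicator_def)
    then show ?thesis by simp
  qed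
  have "\<exists>r. \<forall>n. True \<and> (r n < r (Suc n) \<and>
      (\<forall>m\<le>r n. (\<integral>\<^sup>+s. \<theta> m s * indicator (D (r (Suc n)) (Suc n)) s \<partial>M) < e (Suc n)))"
  proof (rule dependent_nat_choice)
    fix x n :: nat
    have "\<forall>\<^sub>F y in sequentially. \<forall>m\<in>{..x}. (\<integral>\<^sup>+s. \<theta> m s * indicator (D y (Suc n)) s \<partial>M) < e (Suc n)"
      using order_tendstoD(2)[OF D_lim epos] by (intro eventually_ball_finite) auto
    moreover have "\<forall>\<^sub>F y in sequentially. x < y" by (rule eventually_gt_at_top)
    ultimately have "\<forall>\<^sub>F y in sequentially. x < y \<and>
        (\<forall>m\<in>{..x}. (\<integral>\<^sup>+s. \<theta> m s * indicator (D y (Suc n)) s \<partial>M) < e (Suc n))"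
      by eventually_elim auto
    then show "\<exists>y. True \<and> (x < y \<and>
        (\<forall>m\<le>x. (\<integral>\<^sup>+s. \<theta> m s * indicator (D y (Suc n)) s \<partial>M) < e (Suc n)))"
      by (auto simp: eventually_sequentially)
  qed simp
  then obtain r where rinc: "\<And>n. r n < r (Suc n)"
    and r: "\<And>n m. m \<le> r n \<Longrightarrow> (\<integral>\<^sup>+s. \<theta> m s * indicator (D (r (Suc n)) (Suc n)) s \<partial>M) < e (Suc n)"
    by auto
  have mono: "strict_mono r" using rinc by (simp add: strict_mono_Suc_iff)
  define B where "B k = D (r k) k" for k
  have [measurable]: "B k \<in> sets M" for k by (simp add: B_def)
  \<comment> \<open>\<open>r (k + Suc j)\<close> was chosen with all functions up to index
    \<open>r (k + j)\<close> in view, among them \<open>\<theta> (r k)\<close>.\<close>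
  have rB: "(\<integral>\<^sup>+s. \<theta> (r k) s * indicator (B (k + Suc j)) s \<partial>M) \<le> e (k + Suc j)" for j k
    using r[of "r k" "k + j"] strict_mono_less_eq[OF mono] unfolding B_def by (simp add: less_imp_le)
  define A where "A = {s\<in>space M. \<exists>k. even k \<and> s \<in> B k \<and> (\<forall>j. k < j \<longrightarrow> s \<notin> B j)}"
  have A_meas [measurable]: "A \<in> sets M" unfolding A_def by measurable
  define S where "S k = (if even k then space M - A else A)" for k :: nat
  \<comment> \<open>If \<open>k\<close> were the last bad index of a point in \<open>S k\<close>,
    its parity would contradict the side of \<open>A\<close> on which the point lies. A point with
    infinitely many bad indices always has a later one.\<close>
  have S: "s \<notin> B k \<or> (\<exists>j. s \<in> B (k + Suc j))" if sS: "s \<in> S k" for s k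
  proof (rule ccontr)
    assume "\<not> ?thesis"
    then have sk: "s \<in> B k" and no: "\<And>j. k < j \<Longrightarrow> s \<notin> B j"
      by (auto dest: less_imp_Suc_add)
    have sp: "s \<in> space M" using sk by (auto simp: B_def D_def)
    show False
    proof (cases "even k")
      case True
      then have "s \<in> A" using sk no sp by (auto simp: A_def)
      then show False using sS True by (auto simp: S_def)
    next
      case False
      then obtain k' where k': "even k'" "s \<in> B k'" "\<And>j. k' < j \<Longrightarrow> s \<notin> B j"
        using sS by (auto simp: S_def A_def)
      then show False using sk no False by (metis linorder_neqE_nat)
    qed
  qed
  have [measurable]: "S k \<in> sets M" for k by (simp add: S_def)
  \<comment> \<open>Outside \<open>B k\<close> the threshold \<open>e k * \<gamma> s\<close>
    applies. Each later bad set adds at most \<open>e (k + Suc j)\<close>, and these terms sum to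
    \<open>e k\<close>.\<close>
  have bound: "(\<integral>\<^sup>+s. \<theta> (r k) s * indicator (S k) s \<partial>M) \<le> e k * (integral\<^sup>N M \<gamma> + 1)" for k
  proof -
    have "(\<integral>\<^sup>+s. \<theta> (r k) s * indicator (S k) s \<partial>M) \<le>
        (\<integral>\<^sup>+s. e k * \<gamma> s + (\<Sum>j. \<theta> (r k) s * indicator (B (k + Suc j)) s) \<partial>M)"
    proof (rule nn_integral_mono)
      fix s assume s: "s \<in> space M"
      show "\<theta> (r k) s * indicator (S k) s \<le> e k * \<gamma> s + (\<Sum>j. \<theta> (r k) s * indicator (B (k + Suc j)) s)"
      proof (cases "s \<in> S k")
        case True
        from S[OF True] show ?thesis
        proof
          assume "s \<notin> B k"
          then have "\<theta> (r k) s \<le> e k * \<gamma> s" using s by (auto simp: B_def D_def not_less)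
          then show ?thesis using True by (simp add: add_increasing2)
        next
          assume "\<exists>j. s \<in> B (k + Suc j)"
          then obtain j where j: "s \<in> B (k + Suc j)" ..
          have "\<theta> (r k) s * indicator (S k) s = (\<Sum>j\<in>{j}. \<theta> (r k) s * indicator (B (k + Suc j)) s)"
            using True j by simp
          also have "\<dots> \<le> (\<Sum>j. \<theta> (r k) s * indicator (B (k + Suc j)) s)"
            by (rule sum_le_suminf) auto
          finally show ?thesis by (simp add: add_increasing)
        qed
      qed simp
    qed
    also have "\<dots> = (\<integral>\<^sup>+s. e k * \<gamma> s \<partial>M) + (\<integral>\<^sup>+s. (\<Sum>j. \<theta> (r k) s * indicator (B (k + Suc j)) s) \<partial>M)"
      by (rule nn_integral_add) measurable
    also have "(\<integral>\<^sup>+s. e k * \<gamma> s \<partial>M) = e k * integral\<^sup>N M \<gamma>"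
      by (rule nn_integral_cmult) measurable
    also have "(\<integral>\<^sup>+s. (\<Sum>j. \<theta> (r k) s * indicator (B (k + Suc j)) s) \<partial>M) =
        (\<Sum>j. \<integral>\<^sup>+s. \<theta> (r k) s * indicator (B (k + Suc j)) s \<partial>M)"
      by (rule nn_integral_suminf) measurable
    also have "e k * integral\<^sup>N M \<gamma> + (\<Sum>j. \<integral>\<^sup>+s. \<theta> (r k) s * indicator (B (k + Suc j)) s \<partial>M) \<le>
        e k * integral\<^sup>N M \<gamma> + (\<Sum>j. e (k + Suc j))"
      by (intro add_left_mono suminf_le rB) auto
    also have "(\<Sum>j. e (k + Suc j)) = e k"
    proof -
      have "(\<lambda>j. (1/2)^k * (1/2::real)^Suc j) sums ((1/2)^k * 1)"
        by (intro sums_mult power_half_series)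
      then have "(\<lambda>j. (1/2::real)^(k + Suc j)) sums (1/2)^k"
        by (simp add: power_add)
      then have "(\<lambda>j. ennreal ((1/2)^(k + Suc j))) sums ennreal ((1/2)^k)"
        by (subst sums_ennreal) auto
      then show ?thesis unfolding e_def by (rule sums_unique[symmetric])
    qed
    finally show ?thesis by (simp add: distrib_left)
  qed
  have "(\<lambda>k. (integral\<^sup>N M \<gamma> + 1) * e k) \<longlonglongrightarrow> (integral\<^sup>N M \<gamma> + 1) * 0"
  proof (rule ennreal_tendsto_cmult)
    have "(\<lambda>k. (1/2::real)^k) \<longlonglongrightarrow> 0" by (intro LIMSEQ_realpow_zero) auto
    from tendsto_ennrealI[OF this] show "e \<longlonglongrightarrow> 0" by (simp add: e_def[abs_def])
  qed (use \<gamma>fin in \<open>auto simp: less_top\<close>)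
  then have "(\<lambda>k. e k * (integral\<^sup>N M \<gamma> + 1)) \<longlonglongrightarrow> 0" by (simp add: mult.commute)
  then have "(\<lambda>k. \<integral>\<^sup>+s. \<theta> (r k) s * indicator (S k) s \<partial>M) \<longlonglongrightarrow> 0"
    by (rule tendsto_sandwich[OF _ _ tendsto_const, rotated 2]) (use bound in auto)
  then show ?thesis using that[OF mono A_meas] by (simp add: S_def)
qed

lemma sqnorm_levy_simple_finite:
  fixes h :: "real ^ 'd \<Rightarrow> real"
  assumes "levy_simple h"
  shows "sqnorm lborel h < \<infinity>"
proof -
  obtain K where K: "\<And>s. \<bar>h s\<bar> \<le> K"
    using finite_imp_bounded[of "range h"] assms by (auto simp: levy_simple_def bounded_iff)
  have m: "{s. h s \<noteq> 0} \<in> sets borel" using assms by (auto simp: levy_simple_def)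
  have "sqnorm lborel h \<le> (\<integral>\<^sup>+s. ennreal (K\<^sup>2) * indicator {s. h s \<noteq> 0} s \<partial>lborel)"
    unfolding sqnorm_def
  proof (rule nn_integral_mono)
    fix s
    have "(h s)\<^sup>2 \<le> K\<^sup>2" using K[of s] by (metis abs_ge_zero power2_abs power_mono)
    then show "ennreal ((h s)\<^sup>2) \<le> ennreal (K\<^sup>2) * indicator {s. h s \<noteq> 0} s"
      by (auto simp: indicator_def ennreal_leI)
  qed
  also have "\<dots> = ennreal (K\<^sup>2) * emeasure lborel {s. h s \<noteq> 0}"
    using m by (simp add: nn_integral_cmult_indicator)
  also have "\<dots> < \<infinity>"
    using emeasure_bounded_finite[of "{s. h s \<noteq> 0}"] assms
    by (auto simp: levy_simple_def ennreal_mult_less_top)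
  finally show ?thesis .
qed

lemma (in prob_space) tendsto_in_probability_cong_AE_limit:
  assumes "tendsto_in_probability M X Y" "AE w in M. Y w = Y' w"
    and [measurable]: "Y' \<in> borel_measurable M"
  shows "tendsto_in_probability M X Y'"
proof -
  have [measurable]: "X n \<in> borel_measurable M" "Y \<in> borel_measurable M" for n
    using assms unfolding tendsto_in_probability_def by auto
  have "prob {w \<in> space M. \<epsilon> < \<bar>X n w - Y' w\<bar>} = prob {w \<in> space M. \<epsilon> < \<bar>X n w - Y w\<bar>}" for n and \<epsilon> :: real
    using assms(2) by (intro finite_measure_eq_AE) auto
  with assms(1) show ?thesis unfolding tendsto_in_probability_def by simp
qed

context centred_random_measure
begin

lemma AE_levy_simple_integral_split:
  assumes h: "levy_simple h" and k: "levy_simple k" and A: "A \<in> sets borel"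
  shows "AE w in P. levy_simple_integral \<Lambda> UNIV (\<lambda>s. indicator (- A) s * h s + indicator A s * k s) w =
    levy_simple_integral \<Lambda> (- A) h w + levy_simple_integral \<Lambda> A k w"
proof -
  have A': "- A \<in> sets borel" using A by auto
  have U: "(UNIV :: (real ^ 'd) set) \<in> sets borel" by simp
  from AE_levy_simple_integral_add[OF levy_simple_indicator[OF h A'] levy_simple_indicator[OF k A] U]
    AE_levy_simple_integral_indicator[OF h U A'] AE_levy_simple_integral_indicator[OF k U A]
  show ?thesis
    by eventually_elim simp
qed

text \<open>Along the subsequence from \<open>gliding_hump\<close> the members with even index
  converge in mean square off \<open>A\<close>, those with odd index on \<open>A\<close>.
  \<open>\<eta>\<close> splices the two.\<close>

lemma has_levy_integral_approx:
  assumes Y: "has_levy_integral P \<Lambda> f Y" and f: "sqnorm lborel f < \<infinity>"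
  obtains \<eta> where "\<And>n. levy_simple (\<eta> n)" "(\<lambda>n. sqnorm lborel (\<lambda>s. \<eta> n s - f s)) \<longlonglongrightarrow> 0"
    "tendsto_in_probability P (\<lambda>n. levy_simple_integral \<Lambda> UNIV (\<eta> n)) Y"
proof -
  have [measurable]: "f \<in> borel_measurable borel" using Y by (simp add: has_levy_integral_def)
  obtain \<phi> where \<phi>: "\<And>n. levy_simple (\<phi> n)" and ae: "AE s in lborel. (\<lambda>n. \<phi> n s) \<longlonglongrightarrow> f s"
    and ex: "\<And>A. A \<in> sets borel \<Longrightarrow> \<exists>X. tendsto_in_probability P (\<lambda>n. levy_simple_integral \<Lambda> A (\<phi> n)) X"
    and lim: "tendsto_in_probability P (\<lambda>n. levy_simple_integral \<Lambda> UNIV (\<phi> n)) Y"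
    using Y unfolding has_levy_integral_def by auto
  have [measurable]: "\<phi> n \<in> borel_measurable borel" for n using \<phi>[of n] by (simp add: levy_simple_def)
  define \<theta> where "\<theta> n s = ennreal ((\<phi> n s - f s)\<^sup>2)" for n s
  obtain r A where r: "strict_mono r" and A: "A \<in> sets lborel" and
    hump: "(\<lambda>k. \<integral>\<^sup>+s. \<theta> (r k) s * indicator (if even k then space lborel - A else A) s \<partial>lborel) \<longlonglongrightarrow> 0"
  proof (rule lborel.gliding_hump[of \<theta>])
    show "\<theta> n \<in> borel_measurable lborel" for n unfolding \<theta>_def[abs_def] by measurable
    show "(\<integral>\<^sup>+s. \<theta> n s \<partial>lborel) < \<infinity>" for n
      using sqnorm_diff[of "\<phi> n" lborel f] sqnorm_levy_simple_finite[OF \<phi>] f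
      unfolding \<theta>_def sqnorm_def[symmetric, of lborel "\<lambda>s. \<phi> n s - f s"]
      by (auto simp: ennreal_mult_less_top intro: le_less_trans)
    show "AE s in lborel. (\<lambda>n. \<theta> n s) \<longlonglongrightarrow> 0"
      using ae
    proof eventually_elim
      case (elim s)
      then have "(\<lambda>n. (\<phi> n s - f s)\<^sup>2) \<longlonglongrightarrow> (f s - f s)\<^sup>2"
        by (intro tendsto_power tendsto_diff tendsto_const)
      from tendsto_ennrealI[OF this] show ?case by (simp add: \<theta>_def)
    qed
  qed blast
  have A [measurable]: "A \<in> sets borel" and A': "- A \<in> sets borel" using A by auto
  define r0 where "r0 k = r (2 * k)" for k
  define r1 where "r1 k = r (2 * k + 1)" for k
  have r0: "strict_mono r0" and r1: "strict_mono r1"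
    using r by (auto simp: r0_def r1_def strict_mono_def)
  define \<eta> where "\<eta> k s = indicator (- A) s * \<phi> (r0 k) s + indicator A s * \<phi> (r1 k) s" for k s
  have \<eta>: "levy_simple (\<eta> k)" for k
    unfolding \<eta>_def[abs_def] using \<phi> A A' by (intro levy_simple_add levy_simple_indicator)
  have sub: "strict_mono (\<lambda>k::nat. 2 * k)" "strict_mono (\<lambda>k::nat. 2 * k + 1)"
    by (auto simp: strict_mono_def)
  have h0: "(\<lambda>k. \<integral>\<^sup>+s. \<theta> (r0 k) s * indicator (- A) s \<partial>lborel) \<longlonglongrightarrow> 0"
    using LIMSEQ_subseq_LIMSEQ[OF hump sub(1)] by (simp add: comp_def r0_def Compl_eq_Diff_UNIV)
  have h1: "(\<lambda>k. \<integral>\<^sup>+s. \<theta> (r1 k) s * indicator A s \<partial>lborel) \<longlonglongrightarrow> 0"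
    using LIMSEQ_subseq_LIMSEQ[OF hump sub(2)] by (simp add: comp_def r1_def)
  have "sqnorm lborel (\<lambda>s. \<eta> k s - f s) =
      (\<integral>\<^sup>+s. \<theta> (r0 k) s * indicator (- A) s \<partial>lborel) + (\<integral>\<^sup>+s. \<theta> (r1 k) s * indicator A s \<partial>lborel)" for k
    unfolding sqnorm_def
    by (subst nn_integral_add[symmetric])
      (auto simp: \<eta>_def \<theta>_def indicator_def intro!: nn_integral_cong)
  then have \<eta>lim: "(\<lambda>k. sqnorm lborel (\<lambda>s. \<eta> k s - f s)) \<longlonglongrightarrow> 0"
    using tendsto_add[OF h0 h1] by simp
  \<comment> \<open>These limits belong to the whole sequence \<open>\<phi>\<close>, so the even and
    the odd subsequence share them and the spliced integrals still converge to \<open>Y\<close>.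
    Convergence over arbitrary Borel sets is used here, since \<open>A\<close> is not known in
    advance.\<close>
  obtain Z0 Z1 where Z0: "tendsto_in_probability P (\<lambda>n. levy_simple_integral \<Lambda> (- A) (\<phi> n)) Z0"
    and Z1: "tendsto_in_probability P (\<lambda>n. levy_simple_integral \<Lambda> A (\<phi> n)) Z1"
    using ex[OF A] ex[OF A'] by auto
  have meas: "levy_simple_integral \<Lambda> UNIV h \<in> borel_measurable P" if "levy_simple h" for h
    using that by (intro levy_simple_integral_measurable) auto
  have "tendsto_in_probability P (\<lambda>n. levy_simple_integral \<Lambda> UNIV (\<phi> n)) (\<lambda>w. Z0 w + Z1 w)"
  proof (rule tendsto_in_probability_cong_AE[OF tendsto_in_probability_add[OF Z0 Z1]])
    fix n
    have eq: "(\<lambda>s. indicator (- A) s * \<phi> n s + indicator A s * \<phi> n s) = \<phi> n"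
      by (auto simp: indicator_def)
    from AE_levy_simple_integral_split[OF \<phi> \<phi> A, of n n, unfolded eq]
    show "AE w in P. levy_simple_integral \<Lambda> (- A) (\<phi> n) w + levy_simple_integral \<Lambda> A (\<phi> n) w =
        levy_simple_integral \<Lambda> UNIV (\<phi> n) w" by eventually_elim simp
  qed (rule meas[OF \<phi>])
  then have eq: "AE w in P. Z0 w + Z1 w = Y w"
    using lim by (rule tendsto_in_probability_unique)
  have "tendsto_in_probability P (\<lambda>k. levy_simple_integral \<Lambda> UNIV (\<eta> k)) (\<lambda>w. Z0 w + Z1 w)"
  proof (rule tendsto_in_probability_cong_AE[OF tendsto_in_probability_add[OF
        tendsto_in_probability_subseq[OF Z0 r0] tendsto_in_probability_subseq[OF Z1 r1]]])
    fix k
    show "AE w in P. levy_simple_integral \<Lambda> (- A) (\<phi> (r0 k)) w + levy_simple_integral \<Lambda> A (\<phi> (r1 k)) w =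
        levy_simple_integral \<Lambda> UNIV (\<eta> k) w"
      using AE_levy_simple_integral_split[OF \<phi> \<phi> A, of "r0 k" "r1 k"] by (simp add: \<eta>_def[abs_def] eq_commute)
  qed (rule meas[OF \<eta>])
  then have "tendsto_in_probability P (\<lambda>k. levy_simple_integral \<Lambda> UNIV (\<eta> k)) Y"
    using eq by (rule tendsto_in_probability_cong_AE_limit)
      (use lim in \<open>simp add: tendsto_in_probability_def\<close>)
  with \<eta> \<eta>lim show ?thesis by (rule that)
qed

text \<open>\<open>h\<close> is compared with L^2 approximants of \<open>f\<close>, and the bound
  survives the limit in probability. The 2 arises when \<open>f\<close> is inserted between
  \<open>h\<close> and the approximant.\<close>

lemma sqnorm_levy_integral_diff_le:
  assumes h: "levy_simple h" and Y: "has_levy_integral P \<Lambda> f Y" and f: "sqnorm lborel f < \<infinity>"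
  shows "sqnorm P (\<lambda>w. levy_simple_integral \<Lambda> UNIV h w - Y w) \<le>
    ennreal (2 * \<kappa>) * sqnorm lborel (\<lambda>s. h s - f s)"
proof -
  have [measurable]: "f \<in> borel_measurable borel" "h \<in> borel_measurable borel"
    using Y h by (auto simp: has_levy_integral_def levy_simple_def)
  obtain \<eta> where \<eta>: "\<And>n. levy_simple (\<eta> n)" and lim: "(\<lambda>n. sqnorm lborel (\<lambda>s. \<eta> n s - f s)) \<longlonglongrightarrow> 0"
    and prob: "tendsto_in_probability P (\<lambda>n. levy_simple_integral \<Lambda> UNIV (\<eta> n)) Y"
    by (rule has_levy_integral_approx[OF Y f]) (rule that; simp)
  have [measurable]: "\<eta> n \<in> borel_measurable borel" for n using \<eta>[of n] by (simp add: levy_simple_def)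
  have [measurable]: "Y \<in> borel_measurable P" using prob by (simp add: tendsto_in_probability_def)
  have [measurable]: "levy_simple_integral \<Lambda> UNIV h \<in> borel_measurable P" if "levy_simple h" for h
    using that by (intro levy_simple_integral_measurable) auto
  show ?thesis
  proof (rule sqnorm_le_in_probability)
    show "tendsto_in_probability P (\<lambda>n w. levy_simple_integral \<Lambda> UNIV h w - levy_simple_integral \<Lambda> UNIV (\<eta> n) w)
        (\<lambda>w. levy_simple_integral \<Lambda> UNIV h w - Y w)"
      using prob h \<eta> by (simp add: tendsto_in_probability_def abs_minus_commute)
    have le: "sqnorm lborel (\<lambda>s. h s - \<eta> n s) \<le>
        2 * (sqnorm lborel (\<lambda>s. h s - f s) + sqnorm lborel (\<lambda>s. \<eta> n s - f s))" for n
      using sqnorm_triangle[of h lborel f "\<eta> n"] by (simp add: sqnorm_minus_commute[of lborel f])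
    show "sqnorm P (\<lambda>w. levy_simple_integral \<Lambda> UNIV h w - levy_simple_integral \<Lambda> UNIV (\<eta> n) w) \<le>
      ennreal \<kappa> * (2 * (sqnorm lborel (\<lambda>s. h s - f s) + sqnorm lborel (\<lambda>s. \<eta> n s - f s)))" for n
      using sqnorm_levy_simple_integral_diff_le[OF h \<eta>, of UNIV n] mult_left_mono[OF le, of "ennreal \<kappa>" n]
      by simp
    have "(\<lambda>n. ennreal \<kappa> * (2 * (sqnorm lborel (\<lambda>s. h s - f s) + sqnorm lborel (\<lambda>s. \<eta> n s - f s))))
        \<longlonglongrightarrow> ennreal \<kappa> * (2 * (sqnorm lborel (\<lambda>s. h s - f s) + 0))"
      by (intro ennreal_tendsto_cmult tendsto_add lim tendsto_const) (auto simp: nonneg)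
    then show "(\<lambda>n. ennreal \<kappa> * (2 * (sqnorm lborel (\<lambda>s. h s - f s) + sqnorm lborel (\<lambda>s. \<eta> n s - f s))))
        \<longlonglongrightarrow> ennreal (2 * \<kappa>) * sqnorm lborel (\<lambda>s. h s - f s)"
      using nonneg by (simp add: ennreal_mult' mult_ac)
  qed
qed

text \<open>Cutting the approximating functions off at \<open>A\<close> keeps them simple and
  convergent. This later separates the part of the kernel on a box from its tail.\<close>

lemma has_levy_integral_restrict:
  assumes Y: "has_levy_integral P \<Lambda> f Y" and A: "A \<in> sets borel"
  obtains X X' where "has_levy_integral P \<Lambda> (\<lambda>s. indicator A s * f s) X"
    "has_levy_integral P \<Lambda> (\<lambda>s. indicator (- A) s * f s) X'"
    "AE w in P. Y w = X w + X' w"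
proof -
  have [measurable]: "f \<in> borel_measurable borel" using Y by (simp add: has_levy_integral_def)
  obtain \<phi> where \<phi>: "\<And>n. levy_simple (\<phi> n)" and ae: "AE s in lborel. (\<lambda>n. \<phi> n s) \<longlonglongrightarrow> f s"
    and ex: "\<And>A. A \<in> sets borel \<Longrightarrow> \<exists>X. tendsto_in_probability P (\<lambda>n. levy_simple_integral \<Lambda> A (\<phi> n)) X"
    and lim: "tendsto_in_probability P (\<lambda>n. levy_simple_integral \<Lambda> UNIV (\<phi> n)) Y"
    using Y unfolding has_levy_integral_def by auto
  have *: "has_levy_integral P \<Lambda> (\<lambda>s. indicator B s * f s) X"
    if B: "B \<in> sets borel" and X: "tendsto_in_probability P (\<lambda>n. levy_simple_integral \<Lambda> B (\<phi> n)) X" for B X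
    unfolding has_levy_integral_def
  proof (intro conjI exI[of _ "\<lambda>n s. indicator B s * \<phi> n s"] allI ballI)
    show "(\<lambda>s. indicator B s * f s) \<in> borel_measurable borel" using B by measurable
    show ls: "levy_simple (\<lambda>s. indicator B s * \<phi> n s)" for n
      using \<phi> B by (intro levy_simple_indicator)
    show "AE s in lborel. (\<lambda>n. indicator B s * \<phi> n s) \<longlonglongrightarrow> indicator B s * f s"
      using ae by eventually_elim (intro tendsto_mult tendsto_const)
    have cong: "tendsto_in_probability P (\<lambda>n. levy_simple_integral \<Lambda> C (\<lambda>s. indicator B s * \<phi> n s)) V"
      if "tendsto_in_probability P (\<lambda>n. levy_simple_integral \<Lambda> (C \<inter> B) (\<phi> n)) V" "C \<in> sets borel" for C V
      using that(1)
    proof (rule tendsto_in_probability_cong_AE)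
      show "AE w in P. levy_simple_integral \<Lambda> (C \<inter> B) (\<phi> n) w =
          levy_simple_integral \<Lambda> C (\<lambda>s. indicator B s * \<phi> n s) w" for n
        using AE_levy_simple_integral_indicator[OF \<phi> that(2) B, of n] by (simp add: eq_commute)
      show "levy_simple_integral \<Lambda> C (\<lambda>s. indicator B s * \<phi> n s) \<in> borel_measurable P" for n
        by (rule levy_simple_integral_measurable[OF ls that(2)])
    qed
    show "\<exists>X. tendsto_in_probability P (\<lambda>n. levy_simple_integral \<Lambda> C (\<lambda>s. indicator B s * \<phi> n s)) X"
      if "C \<in> sets borel" for C
      using cong[OF _ that] ex[of "C \<inter> B"] that B by auto
    show "tendsto_in_probability P (\<lambda>n. levy_simple_integral \<Lambda> UNIV (\<lambda>s. indicator B s * \<phi> n s)) X"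
      using cong[of UNIV X] X by simp
  qed
  have A': "- A \<in> sets borel" using A by auto
  obtain X X' where X: "tendsto_in_probability P (\<lambda>n. levy_simple_integral \<Lambda> A (\<phi> n)) X"
    and X': "tendsto_in_probability P (\<lambda>n. levy_simple_integral \<Lambda> (- A) (\<phi> n)) X'"
    using ex[OF A] ex[OF A'] by auto
  have "tendsto_in_probability P (\<lambda>n. levy_simple_integral \<Lambda> UNIV (\<phi> n)) (\<lambda>w. X w + X' w)"
  proof (rule tendsto_in_probability_cong_AE[OF tendsto_in_probability_add[OF X X']])
    fix n
    have eq: "(\<lambda>s. indicator (- A) s * \<phi> n s + indicator A s * \<phi> n s) = \<phi> n"
      by (auto simp: indicator_def)
    from AE_levy_simple_integral_split[OF \<phi> \<phi> A, of n n, unfolded eq]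
    show "AE w in P. levy_simple_integral \<Lambda> A (\<phi> n) w + levy_simple_integral \<Lambda> (- A) (\<phi> n) w =
        levy_simple_integral \<Lambda> UNIV (\<phi> n) w" by eventually_elim simp
  qed (rule levy_simple_integral_measurable[OF \<phi>], simp)
  from tendsto_in_probability_unique[OF lim this]
  show ?thesis using *[OF A X] *[OF A' X'] that by blast
qed

end

section \<open>Maximal inequalities\<close>

context centred_random_measure
begin

text \<open>The values of the basis on the intersections of the \<open>D j\<close> with the level
  sets form one finite independent family, and grouping it by \<open>j\<close> preserves
  independence.\<close>

lemma indep_levy_simple_integrals:
  fixes D :: "nat \<Rightarrow> (real ^ 'd) set"
  assumes h: "levy_simple h" and D: "\<And>j. D j \<in> sets borel" "disjoint_family D"
  shows "indep_vars (\<lambda>_. borel) (\<lambda>j. levy_simple_integral \<Lambda> (D j) h) {..<n}"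
proof -
  note c = levy_simple_canonical[OF h]
  define R where "R = range h - {0}"
  define C where "C z = D (fst z) \<inter> h -` {snd z}" for z
  have "indep_vars (\<lambda>_. borel) (\<lambda>z. \<Lambda> (C z)) ({..<n} \<times> R)"
  proof (rule indep_family)
    show "finite ({..<n} \<times> R)" using c(1) by (simp add: R_def)
    show "bounded_borel (C z)" if "z \<in> {..<n} \<times> R" for z
      unfolding C_def using that by (intro bounded_borel_Int c(2) D) (auto simp: R_def)
    show "disjoint_family_on C ({..<n} \<times> R)"
      unfolding disjoint_family_on_def
    proof (intro ballI impI)
      fix z z' :: "nat \<times> real" assume "z \<noteq> z'"
      then have "fst z \<noteq> fst z' \<or> snd z \<noteq> snd z'" by (simp add: prod_eq_iff)
      moreover have "D (fst z) \<inter> D (fst z') = {}" if "fst z \<noteq> fst z'"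
        using D(2) that by (simp add: disjoint_family_on_def)
      ultimately show "C z \<inter> C z' = {}" unfolding C_def by auto
    qed
  qed
  then have "indep_vars (\<lambda>j. PiM ({j} \<times> R) (\<lambda>_. borel))
      (\<lambda>j w. restrict (\<lambda>z. \<Lambda> (C z) w) ({j} \<times> R)) {..<n}"
    by (rule indep_vars_restrict) (auto simp: disjoint_family_on_def)
  then have "indep_vars (\<lambda>_. borel)
      (\<lambda>j w. \<Sum>x\<in>R. x * restrict (\<lambda>z. \<Lambda> (C z) w) ({j} \<times> R) (j, x)) {..<n}"
  proof (rule indep_vars_compose2[where Y="\<lambda>j f. \<Sum>x\<in>R. x * f (j, x)"])
    fix j :: nat
    have "(\<lambda>f. f (j, x)) \<in> borel_measurable (PiM ({j} \<times> R) (\<lambda>_. borel :: real measure))" if "x \<in> R" for x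
      using that by (intro measurable_component_singleton) simp
    then show "(\<lambda>f. \<Sum>x\<in>R. x * f (j, x)) \<in> borel_measurable (PiM ({j} \<times> R) (\<lambda>_. borel))"
      by (intro borel_measurable_sum borel_measurable_times borel_measurable_const)
  qed
  moreover have "(\<Sum>x\<in>R. x * restrict (\<lambda>z. \<Lambda> (C z) w) ({j} \<times> R) (j, x)) =
      levy_simple_integral \<Lambda> (D j) h w" for j w
    unfolding levy_simple_integral_def R_def[symmetric] by (intro sum.cong refl) (simp add: C_def)
  ultimately show ?thesis by simp
qed

text \<open>Integrals over growing sets are partial sums of integrals over the successive
  differences, which are independent and centred.\<close>

lemma simple_maximal_inequality:
  fixes A :: "nat \<Rightarrow> (real ^ 'd) set"
  assumes h: "levy_simple h" and A: "\<And>k. A k \<in> sets borel" "mono A" and a: "a > 0"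
  shows "ennreal (a\<^sup>2 * prob {w\<in>space P. \<exists>k\<le>n. a \<le> \<bar>levy_simple_integral \<Lambda> (A k) h w\<bar>}) \<le>
    ennreal \<kappa> * sqnorm lborel (\<lambda>s. indicator (A n) s * h s)"
proof -
  note c = levy_simple_canonical[OF h]
  define D where "D = disjointed A"
  have D: "D j \<in> sets borel" for j
    unfolding D_def using A(1) by (auto simp: disjointed_def)
  have disj: "disjoint_family D" unfolding D_def by (rule disjoint_family_disjointed)
  define X where "X j = levy_simple_integral \<Lambda> (D j) h" for j
  \<comment> \<open>\<open>A k\<close> collects the first \<open>Suc k\<close> differences, so the
    partial sums below run up to \<open>Suc n\<close>.\<close>
  have AD: "A k = (\<Union>j\<in>{..<Suc k}. D j)" for k
  proof -
    have "A i \<subseteq> A k" if "i < Suc k" for i using that by (intro monoD[OF A(2)]) simp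
    then have "(\<Union>j\<in>{0..<Suc k}. A j) = A k" by (intro equalityI UN_least UN_upper) auto
    then show ?thesis
      using finite_UN_disjointed_eq[of A "Suc k"] by (simp add: D_def lessThan_atLeast0)
  qed
  have meas [measurable]: "levy_simple_integral \<Lambda> B h \<in> borel_measurable P" if "B \<in> sets borel" for B
    by (rule levy_simple_integral_measurable[OF h that])
  have sum_eq: "AE w in P. (\<Sum>j<Suc k. X j w) = levy_simple_integral \<Lambda> (A k) h w" for k
  proof -
    have "AE w in P. \<forall>x\<in>range h - {0}. \<Lambda> (A k \<inter> h -` {x}) w = (\<Sum>j<Suc k. \<Lambda> (D j \<inter> h -` {x}) w)"
    proof (rule AE_finite_allI[OF c(1)])
      fix x assume x: "x \<in> range h - {0}"
      have "A k \<inter> h -` {x} = (\<Union>j\<in>{..<Suc k}. D j \<inter> h -` {x})" unfolding AD by auto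
      moreover have "AE w in P. \<Lambda> (\<Union>j\<in>{..<Suc k}. D j \<inter> h -` {x}) w = (\<Sum>j<Suc k. \<Lambda> (D j \<inter> h -` {x}) w)"
        using disj by (intro AE_additive bounded_borel_Int c(2)[OF x] D)
          (auto simp: disjoint_family_on_def)
      ultimately show "AE w in P. \<Lambda> (A k \<inter> h -` {x}) w = (\<Sum>j<Suc k. \<Lambda> (D j \<inter> h -` {x}) w)" by simp
    qed
    then show ?thesis
    proof eventually_elim
      case (elim w)
      have "levy_simple_integral \<Lambda> (A k) h w = (\<Sum>x\<in>range h - {0}. \<Sum>j<Suc k. x * \<Lambda> (D j \<inter> h -` {x}) w)"
        unfolding levy_simple_integral_def
      proof (rule sum.cong[OF refl])
        fix x assume "x \<in> range h - {0}"
        show "x * \<Lambda> (A k \<inter> h -` {x}) w = (\<Sum>j<Suc k. x * \<Lambda> (D j \<inter> h -` {x}) w)"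
          unfolding bspec[OF elim \<open>x \<in> range h - {0}\<close>] by (rule sum_distrib_left)
      qed
      also have "\<dots> = (\<Sum>j<Suc k. X j w)"
        unfolding X_def levy_simple_integral_def by (rule sum.swap)
      finally show ?case ..
    qed
  qed
  have X0: "expectation (X j) = 0" for j
  proof -
    have "integrable P (\<Lambda> (D j \<inter> h -` {x}))" "expectation (\<Lambda> (D j \<inter> h -` {x})) = 0" if "x \<in> range h - {0}" for x
      using square_integrable_mult[OF square_integrable[OF bounded_borel_Int[OF c(2)[OF that] D]], of "\<lambda>_. 1" j]
        mean[OF bounded_borel_Int[OF c(2)[OF that] D]]
      by (auto simp: square_integrable_def)
    then show ?thesis
      unfolding X_def levy_simple_integral_def by (subst Bochner_Integration.integral_sum) auto
  qed
  have Xm: "X j \<in> borel_measurable P" for j unfolding X_def by (rule meas[OF D])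
  have "a\<^sup>2 * prob {w\<in>space P. \<exists>k\<le>n. a \<le> \<bar>levy_simple_integral \<Lambda> (A k) h w\<bar>}
      \<le> a\<^sup>2 * prob {w\<in>space P. \<exists>k\<le>Suc n. a \<le> \<bar>\<Sum>i<k. X i w\<bar>}"
  proof (intro mult_left_mono finite_measure_mono_AE)
    have "AE w in P. \<forall>k\<in>{..n}. (\<Sum>j<Suc k. X j w) = levy_simple_integral \<Lambda> (A k) h w"
      by (rule AE_finite_allI) (auto intro: sum_eq simp del: sum.lessThan_Suc)
    then show "AE w in P. w \<in> {w\<in>space P. \<exists>k\<le>n. a \<le> \<bar>levy_simple_integral \<Lambda> (A k) h w\<bar>} \<longrightarrow>
        w \<in> {w\<in>space P. \<exists>k\<le>Suc n. a \<le> \<bar>\<Sum>i<k. X i w\<bar>}"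
    proof eventually_elim
      case (elim w)
      show ?case
      proof
        assume "w \<in> {w\<in>space P. \<exists>k\<le>n. a \<le> \<bar>levy_simple_integral \<Lambda> (A k) h w\<bar>}"
        then obtain k where k: "w \<in> space P" "k \<le> n" "a \<le> \<bar>levy_simple_integral \<Lambda> (A k) h w\<bar>" by auto
        then have "a \<le> \<bar>\<Sum>j<Suc k. X j w\<bar>" using elim by simp
        then show "w \<in> {w\<in>space P. \<exists>k\<le>Suc n. a \<le> \<bar>\<Sum>i<k. X i w\<bar>}"
          using k by (auto simp del: sum.lessThan_Suc intro!: exI[of _ "Suc k"])
      qed
    qed
    have "(\<lambda>w. \<Sum>i<k. X i w) \<in> borel_measurable P" for k
      using Xm by (intro borel_measurable_sum)
    then show "{w\<in>space P. \<exists>k\<le>Suc n. a \<le> \<bar>\<Sum>i<k. X i w\<bar>} \<in> events"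
      by measurable
  qed simp
  also have "\<dots> \<le> expectation (\<lambda>w. (\<Sum>i<Suc n. X i w)\<^sup>2)"
    unfolding X_def using X0 D disj a
    by (intro kolmogorov_maximal_inequality indep_levy_simple_integrals[OF h]
        levy_simple_integral_square_integrable[OF h]) (auto simp: X_def)
  also have "\<dots> = expectation (\<lambda>w. (levy_simple_integral \<Lambda> (A n) h w)\<^sup>2)"
    using sum_eq[of n] meas[OF A(1)] Xm
    by (intro integral_cong_AE borel_measurable_power borel_measurable_sum)
      (auto simp del: sum.lessThan_Suc)
  finally have "ennreal (a\<^sup>2 * prob {w\<in>space P. \<exists>k\<le>n. a \<le> \<bar>levy_simple_integral \<Lambda> (A k) h w\<bar>}) \<le>
      sqnorm P (levy_simple_integral \<Lambda> (A n) h)"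
    using sqnorm_eq_integral[OF levy_simple_integral_square_integrable[OF h A(1)[of n]]]
    by (simp add: ennreal_leI)
  also have "\<dots> \<le> ennreal \<kappa> * sqnorm lborel (\<lambda>s. indicator (A n) s * h s)"
    by (rule sqnorm_levy_simple_integral_le[OF h A(1)])
  finally show ?thesis .
qed

text \<open>Half of the level \<open>a\<close> is spent on an approximating simple function, the
  other half on Chebyshev's inequality for each of the \<open>Suc n\<close> approximation errors. As
  \<open>n\<close> is fixed, these errors vanish when the approximation improves.\<close>

lemma levy_integral_maximal_inequality:
  fixes A :: "nat \<Rightarrow> (real ^ 'd) set"
  assumes Y: "has_levy_integral P \<Lambda> f Y" and f: "sqnorm lborel f < \<infinity>"
    and A: "\<And>k. A k \<in> sets borel" "mono A"
    and W: "\<And>k. has_levy_integral P \<Lambda> (\<lambda>s. indicator (A k) s * f s) (W k)" and a: "a > 0"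
  shows "ennreal ((a/2)\<^sup>2 * prob {w\<in>space P. \<exists>k\<le>n. a \<le> \<bar>W k w\<bar>}) \<le>
    ennreal (2 * \<kappa>) * sqnorm lborel (\<lambda>s. indicator (A n) s * f s)"
proof -
  have [measurable]: "f \<in> borel_measurable borel" using Y by (simp add: has_levy_integral_def)
  note A(1)[measurable]
  obtain \<eta> where \<eta>: "\<And>n. levy_simple (\<eta> n)" and lim: "(\<lambda>n. sqnorm lborel (\<lambda>s. \<eta> n s - f s)) \<longlonglongrightarrow> 0"
    by (rule has_levy_integral_approx[OF Y f]) (rule that; simp)
  have [measurable]: "\<eta> n \<in> borel_measurable borel" for n using \<eta>[of n] by (simp add: levy_simple_def)
  have [measurable]: "W k \<in> borel_measurable P" for k
    using W[of k] by (auto simp: has_levy_integral_def tendsto_in_probability_def)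
  let ?J = "\<lambda>m k. levy_simple_integral \<Lambda> (A k) (\<eta> m)"
  have [measurable]: "?J m k \<in> borel_measurable P" for m k
    by (rule levy_simple_integral_measurable[OF \<eta> A(1)])
  have ind: "sqnorm lborel (\<lambda>s. indicator (A k) s * g s) \<le> sqnorm lborel g" for k g
    by (rule sqnorm_mono) (auto simp: indicator_def)
  define e where "e m = sqnorm lborel (\<lambda>s. \<eta> m s - f s)" for m
  have close: "sqnorm P (\<lambda>w. ?J m k w - W k w) \<le> ennreal (2 * \<kappa>) * e m" for m k
  proof -
    have "sqnorm P (\<lambda>w. ?J m k w - W k w) =
        sqnorm P (\<lambda>w. levy_simple_integral \<Lambda> UNIV (\<lambda>s. indicator (A k) s * \<eta> m s) w - W k w)"
      using AE_levy_simple_integral_indicator[OF \<eta> _ A(1), of UNIV k m]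
      by (intro sqnorm_cong_AE) (simp add: eq_commute)
    also have "\<dots> \<le> ennreal (2 * \<kappa>) * sqnorm lborel (\<lambda>s. indicator (A k) s * \<eta> m s - indicator (A k) s * f s)"
      using ind[of k f] f
      by (intro sqnorm_levy_integral_diff_le[OF levy_simple_indicator[OF \<eta> A(1)] W]) auto
    also have "\<dots> \<le> ennreal (2 * \<kappa>) * e m"
      using ind[of k "\<lambda>s. \<eta> m s - f s"] unfolding e_def
      by (intro mult_left_mono) (auto simp: right_diff_distrib)
    finally show ?thesis .
  qed
  have norm_le: "sqnorm lborel (\<lambda>s. indicator (A n) s * \<eta> m s) \<le>
      2 * (e m + sqnorm lborel (\<lambda>s. indicator (A n) s * f s))" for m
  proof -
    have "sqnorm lborel (\<lambda>s. indicator (A n) s * \<eta> m s) =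
        sqnorm lborel (\<lambda>s. indicator (A n) s * (\<eta> m s - f s) + indicator (A n) s * f s)"
      by (simp add: algebra_simps)
    also have "\<dots> \<le> 2 * (sqnorm lborel (\<lambda>s. indicator (A n) s * (\<eta> m s - f s)) +
        sqnorm lborel (\<lambda>s. indicator (A n) s * f s))"
      by (rule sqnorm_add) measurable
    also have "\<dots> \<le> 2 * (e m + sqnorm lborel (\<lambda>s. indicator (A n) s * f s))"
      unfolding e_def by (intro mult_left_mono add_right_mono ind) auto
    finally show ?thesis .
  qed
  have bound: "ennreal ((a/2)\<^sup>2 * prob {w\<in>space P. \<exists>k\<le>n. a \<le> \<bar>W k w\<bar>}) \<le>
      ennreal \<kappa> * (2 * (e m + sqnorm lborel (\<lambda>s. indicator (A n) s * f s))) +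
      of_nat (Suc n) * (ennreal (2 * \<kappa>) * e m)" for m
  proof -
    let ?E = "{w\<in>space P. \<exists>k\<le>n. a/2 \<le> \<bar>?J m k w\<bar>}"
    let ?F = "\<lambda>k. {w\<in>space P. a/2 \<le> \<bar>?J m k w - W k w\<bar>}"
    have "{w\<in>space P. \<exists>k\<le>n. a \<le> \<bar>W k w\<bar>} \<subseteq> ?E \<union> (\<Union>k\<in>{..n}. ?F k)"
    proof
      fix w assume "w \<in> {w\<in>space P. \<exists>k\<le>n. a \<le> \<bar>W k w\<bar>}"
      then obtain k where k: "w \<in> space P" "k \<le> n" "a \<le> \<bar>W k w\<bar>" by auto
      then have "a/2 \<le> \<bar>?J m k w\<bar> \<or> a/2 \<le> \<bar>?J m k w - W k w\<bar>" by arith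
      then show "w \<in> ?E \<union> (\<Union>k\<in>{..n}. ?F k)" using k by auto
    qed
    then have "prob {w\<in>space P. \<exists>k\<le>n. a \<le> \<bar>W k w\<bar>} \<le> prob (?E \<union> (\<Union>k\<in>{..n}. ?F k))"
      by (intro finite_measure_mono) auto
    also have "\<dots> \<le> prob ?E + prob (\<Union>k\<in>{..n}. ?F k)"
      by (intro measure_Un_le) auto
    also have "prob (\<Union>k\<in>{..n}. ?F k) \<le> (\<Sum>k\<le>n. prob (?F k))"
      by (intro measure_UNION_le) auto
    finally have "(a/2)\<^sup>2 * prob {w\<in>space P. \<exists>k\<le>n. a \<le> \<bar>W k w\<bar>} \<le>
        (a/2)\<^sup>2 * prob ?E + (\<Sum>k\<le>n. (a/2)\<^sup>2 * prob (?F k))"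
      by (simp add: sum_distrib_left[symmetric] distrib_left[symmetric] mult_left_mono)
    then have "ennreal ((a/2)\<^sup>2 * prob {w\<in>space P. \<exists>k\<le>n. a \<le> \<bar>W k w\<bar>}) \<le>
        ennreal ((a/2)\<^sup>2 * prob ?E + (\<Sum>k\<le>n. (a/2)\<^sup>2 * prob (?F k)))"
      by (rule ennreal_leI)
    also have "\<dots> = ennreal ((a/2)\<^sup>2 * prob ?E) + (\<Sum>k\<le>n. ennreal ((a/2)\<^sup>2 * prob (?F k)))"
      by (subst ennreal_plus) (auto simp: sum_nonneg sum_ennreal)
    also have "\<dots> \<le> ennreal \<kappa> * (2 * (e m + sqnorm lborel (\<lambda>s. indicator (A n) s * f s))) +
        (\<Sum>k\<le>n. ennreal (2 * \<kappa>) * e m)"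
    proof (intro add_mono sum_mono)
      show "ennreal ((a/2)\<^sup>2 * prob ?E) \<le>
          ennreal \<kappa> * (2 * (e m + sqnorm lborel (\<lambda>s. indicator (A n) s * f s)))"
        using a by (intro order_trans[OF simple_maximal_inequality[OF \<eta> A] mult_left_mono[OF norm_le]]) auto
      show "ennreal ((a/2)\<^sup>2 * prob (?F k)) \<le> ennreal (2 * \<kappa>) * e m" for k
        using a by (intro order_trans[OF chebyshev_sqnorm close]) auto
    qed
    finally show ?thesis by (simp add: mult.assoc)
  qed
  have "(\<lambda>m. ennreal \<kappa> * (2 * (e m + sqnorm lborel (\<lambda>s. indicator (A n) s * f s))) +
      of_nat (Suc n) * (ennreal (2 * \<kappa>) * e m)) \<longlonglongrightarrow>
      ennreal \<kappa> * (2 * (0 + sqnorm lborel (\<lambda>s. indicator (A n) s * f s))) +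
      of_nat (Suc n) * (ennreal (2 * \<kappa>) * 0)"
    using lim unfolding e_def
    by (intro ennreal_tendsto_cmult tendsto_add tendsto_const) (auto simp: ennreal_of_nat_eq_real_of_nat)
  then have "(\<lambda>m. ennreal \<kappa> * (2 * (e m + sqnorm lborel (\<lambda>s. indicator (A n) s * f s))) +
      of_nat (Suc n) * (ennreal (2 * \<kappa>) * e m)) \<longlonglongrightarrow>
      ennreal (2 * \<kappa>) * sqnorm lborel (\<lambda>s. indicator (A n) s * f s)"
    using nonneg by (simp add: ennreal_mult' mult_ac)
  then show ?thesis by (rule LIMSEQ_le_const) (use bound in auto)
qed

text \<open>The maximal inequality wants nested sets, but \<open>R\<close> need not be monotone.
  Finitely many indices can be ordered by \<open>R\<close>; the bound then involves only the largest
  tail set, hence at most \<open>T r\<close> if \<open>r\<close> lies below all \<open>R k\<close>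
  concerned. It does not see how many indices there are, so it covers all late indices at
  once.\<close>

lemma AE_tendsto_levy_integral_tails:
  fixes Q :: "real \<Rightarrow> (real ^ 'd) set" and R :: "nat \<Rightarrow> real"
  assumes Y: "has_levy_integral P \<Lambda> f Y" and f: "sqnorm lborel f < \<infinity>"
    and Q: "\<And>r. Q r \<in> sets borel" "antimono Q"
    and tail: "((\<lambda>r. sqnorm lborel (\<lambda>s. indicator (Q r) s * f s)) \<longlongrightarrow> 0) at_top"
    and R: "filterlim R at_top sequentially"
    and V: "\<And>k. has_levy_integral P \<Lambda> (\<lambda>s. indicator (Q (R k)) s * f s) (V k)"
  shows "AE w in P. (\<lambda>k. V k w) \<longlonglongrightarrow> 0"
proof -
  define T where "T r = sqnorm lborel (\<lambda>s. indicator (Q r) s * f s)" for r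
  have [measurable]: "V k \<in> borel_measurable P" for k
    using V[of k] by (auto simp: has_levy_integral_def tendsto_in_probability_def)
  have T_mono: "T r' \<le> T r" if "r \<le> r'" for r r'
    unfolding T_def using antimonoD[OF Q(2) that]
    by (intro sqnorm_mono) (auto simp: indicator_def)
  have fin: "ennreal ((a/2)\<^sup>2 * prob {w\<in>space P. \<exists>k\<in>K. a \<le> \<bar>V k w\<bar>}) \<le> ennreal (2 * \<kappa>) * T r"
    if K: "finite K" "\<And>k. k \<in> K \<Longrightarrow> r \<le> R k" and a: "a > 0" for K r a
  proof (cases "K = {}")
    case False
    \<comment> \<open>Sorting by \<open>- R\<close> makes \<open>R\<close> decrease along the list,
      so the sets \<open>Q (R k)\<close> increase.\<close>
    define ks where "ks = sort_key (\<lambda>k. - R k) (sorted_list_of_set K)"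
    have set_ks: "set ks = K" using K(1) by (simp add: ks_def)
    have sorted: "sorted (map (\<lambda>k. - R k) ks)" unfolding ks_def by (rule sorted_sort_key)
    define n where "n = length ks - 1"
    have len: "length ks > 0" using False set_ks by auto
    \<comment> \<open>Capping the position at \<open>n\<close> extends the finite list to an
      infinite sequence, constant from \<open>n\<close> on, as the maximal inequality
      expects.\<close>
    define i where "i j = ks ! min j n" for j
    have i_in: "i j \<in> K" for j
    proof -
      have "min j n < length ks" using len by (simp add: n_def min_less_iff_disj)
      then show ?thesis unfolding i_def set_ks[symmetric] by (rule nth_mem)
    qed
    have R_anti: "R (i k) \<le> R (i j)" if "j \<le> k" for j k
    proof -
      have "min j n \<le> min k n" "min k n < length ks" "min j n < length ks"
        using that len by (auto simp: n_def min_less_iff_disj)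
      then show ?thesis
        using sorted_nth_mono[OF sorted, of "min j n" "min k n"] by (simp add: i_def)
    qed
    have "{w\<in>space P. \<exists>k\<in>K. a \<le> \<bar>V k w\<bar>} \<subseteq> {w\<in>space P. \<exists>j\<le>n. a \<le> \<bar>V (i j) w\<bar>}"
    proof
      fix w assume "w \<in> {w\<in>space P. \<exists>k\<in>K. a \<le> \<bar>V k w\<bar>}"
      then obtain k where k: "w \<in> space P" "k \<in> K" "a \<le> \<bar>V k w\<bar>" by auto
      then obtain j where j: "j < length ks" "ks ! j = k"
        unfolding set_ks[symmetric] by (auto simp: in_set_conv_nth)
      then have "j \<le> n" "i j = k" by (auto simp: n_def i_def min_def)
      then show "w \<in> {w\<in>space P. \<exists>j\<le>n. a \<le> \<bar>V (i j) w\<bar>}" using k by auto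
    qed
    then have "ennreal ((a/2)\<^sup>2 * prob {w\<in>space P. \<exists>k\<in>K. a \<le> \<bar>V k w\<bar>}) \<le>
        ennreal ((a/2)\<^sup>2 * prob {w\<in>space P. \<exists>j\<le>n. a \<le> \<bar>V (i j) w\<bar>})"
      by (intro ennreal_leI mult_left_mono finite_measure_mono) auto
    also have "\<dots> \<le> ennreal (2 * \<kappa>) * T (R (i n))"
      unfolding T_def
      by (rule levy_integral_maximal_inequality[OF Y f Q(1) _ V a])
        (use R_anti antimonoD[OF Q(2)] in \<open>auto simp: mono_def\<close>)
    also have "\<dots> \<le> ennreal (2 * \<kappa>) * T r"
      using T_mono K(2)[OF i_in] by (intro mult_left_mono) auto
    finally show ?thesis .
  qed simp
  have small: "prob {w\<in>space P. \<forall>k0. \<exists>k\<ge>k0. a \<le> \<bar>V k w\<bar>} = 0" (is "prob ?N = 0") if a: "a > 0" for a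
  proof -
    have "ennreal ((a/2)\<^sup>2 * prob ?N) \<le> ennreal (2 * \<kappa>) * T r" for r
    proof -
      obtain k0 where k0: "\<And>k. k \<ge> k0 \<Longrightarrow> r \<le> R k"
        using R unfolding filterlim_at_top eventually_sequentially by meson
      \<comment> \<open>The bound for finitely many indices is independent of \<open>m\<close> and
        passes to the increasing union.\<close>
      let ?E = "\<lambda>m. {w\<in>space P. \<exists>k\<in>{k0..<m}. a \<le> \<bar>V k w\<bar>}"
      have "(\<lambda>m. prob (?E m)) \<longlonglongrightarrow> prob (\<Union>m. ?E m)"
        by (rule finite_Lim_measure_incseq) (auto simp: incseq_def intro!: sets.sets_Collect_finite_Ex)
      then have "(\<lambda>m. ennreal ((a/2)\<^sup>2 * prob (?E m))) \<longlonglongrightarrow> ennreal ((a/2)\<^sup>2 * prob (\<Union>m. ?E m))"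
        by (intro tendsto_ennrealI tendsto_mult tendsto_const)
      then have "ennreal ((a/2)\<^sup>2 * prob (\<Union>m. ?E m)) \<le> ennreal (2 * \<kappa>) * T r"
        by (rule LIMSEQ_le_const2) (use fin[of "{k0..<_}" r a] k0 a in auto)
      moreover have "?N \<subseteq> (\<Union>m. ?E m)"
      proof
        fix w assume "w \<in> ?N"
        then obtain k where "w \<in> space P" "k \<ge> k0" "a \<le> \<bar>V k w\<bar>" by auto
        then show "w \<in> (\<Union>m. ?E m)" by (intro UN_I[of "Suc k"]) auto
      qed
      then have "ennreal ((a/2)\<^sup>2 * prob ?N) \<le> ennreal ((a/2)\<^sup>2 * prob (\<Union>m. ?E m))"
        by (intro ennreal_leI mult_left_mono finite_measure_mono) auto
      ultimately show ?thesis by (rule order_trans[rotated])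
    qed
    moreover have "((\<lambda>r. ennreal (2 * \<kappa>) * T r) \<longlongrightarrow> ennreal (2 * \<kappa>) * 0) at_top"
      using tail unfolding T_def by (intro ennreal_tendsto_cmult) auto
    ultimately have "ennreal ((a/2)\<^sup>2 * prob ?N) \<le> ennreal (2 * \<kappa>) * 0"
      by (intro tendsto_lowerbound[where F=at_top]) auto
    then show ?thesis using a measure_nonneg[of P ?N] by (auto simp: mult_le_0_iff ennreal_eq_0_iff intro: antisym)
  qed
  have "AE w in P. \<exists>k0. \<forall>k\<ge>k0. \<bar>V k w\<bar> < 1 / real (Suc m)" for m
  proof (rule AE_I[where N="{w\<in>space P. \<forall>k0. \<exists>k\<ge>k0. 1 / real (Suc m) \<le> \<bar>V k w\<bar>}"])
    show "emeasure P {w\<in>space P. \<forall>k0. \<exists>k\<ge>k0. 1 / real (Suc m) \<le> \<bar>V k w\<bar>} = 0"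
      using small[of "1 / real (Suc m)"] by (simp add: emeasure_eq_measure)
  qed (auto simp: not_less)
  then have "AE w in P. \<forall>m. \<exists>k0. \<forall>k\<ge>k0. \<bar>V k w\<bar> < 1 / real (Suc m)"
    by (subst AE_all_countable) blast
  then show ?thesis
  proof eventually_elim
    case (elim w)
    show ?case
    proof (rule LIMSEQ_I)
      fix r :: real assume "0 < r"
      then obtain m where "1 / real (Suc m) < r" using nat_approx_posE by blast
      then show "\<exists>no. \<forall>n\<ge>no. norm (V n w - 0) < r"
        using elim[rule_format, of m] by (auto intro: less_trans)
    qed
  qed
qed

end

section \<open>The variance of a homogeneous basis\<close>

lemma (in centred_scattered_measure) expectation_square_Un:
  assumes "bounded_borel B" "bounded_borel C" "B \<inter> C = {}"
  shows "expectation (\<lambda>w. (\<Lambda> (B \<union> C) w)\<^sup>2) =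
    expectation (\<lambda>w. (\<Lambda> B w)\<^sup>2) + expectation (\<lambda>w. (\<Lambda> C w)\<^sup>2)"
proof -
  define D where "D i = (if i then B else C)" for i
  have D: "bounded_borel (D i)" for i using assms by (simp add: D_def)
  have disj: "disjoint_family_on D UNIV" using assms(3) by (auto simp: disjoint_family_on_def D_def)
  have "B \<union> C = (\<Union>i\<in>UNIV. D i)" by (auto simp: D_def split: if_splits)
  then have "AE w in P. \<Lambda> (B \<union> C) w = (\<Sum>i\<in>UNIV. 1 * \<Lambda> (D i) w)"
    using AE_additive[OF _ D disj] by simp
  moreover have "bounded_borel (B \<union> C)" using assms by auto
  ultimately have "expectation (\<lambda>w. (\<Lambda> (B \<union> C) w)\<^sup>2) = expectation (\<lambda>w. (\<Sum>i\<in>UNIV. 1 * \<Lambda> (D i) w)\<^sup>2)"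
    using measurable_basis D
    by (intro integral_cong_AE borel_measurable_power borel_measurable_sum) auto
  also have "\<dots> = (\<Sum>i\<in>UNIV. 1\<^sup>2 * expectation (\<lambda>w. (\<Lambda> (D i) w)\<^sup>2))"
    by (rule expectation_sum_square[OF _ D disj]) simp
  finally show ?thesis by (simp add: UNIV_bool D_def)
qed

text \<open>Cauchy's functional equation under a sign condition: nonnegativity makes
  \<open>w\<close> increasing on the half-line, so \<open>w m\<close> is at most its value at a
  fraction just above \<open>m\<close>.\<close>

lemma nonneg_additive_le_linear:
  fixes w :: "real \<Rightarrow> real"
  assumes add: "\<And>x y. 0 \<le> x \<Longrightarrow> 0 \<le> y \<Longrightarrow> w (x + y) = w x + w y"
    and nn: "\<And>x. 0 \<le> x \<Longrightarrow> 0 \<le> w x" and m: "0 \<le> m"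
  shows "w m \<le> w 1 * m"
proof (rule field_le_epsilon)
  fix e :: real assume e: "0 < e"
  have mult: "w (real n * x) = real n * w x" if "0 \<le> x" for n x
  proof (induction n)
    case 0
    show ?case using add[of 0 0] by simp
  next
    case (Suc n)
    have "w (real (Suc n) * x) = w (real n * x + x)" by (simp add: algebra_simps)
    also have "\<dots> = real (Suc n) * w x" using Suc add[of "real n * x" x] that by (simp add: algebra_simps)
    finally show ?case .
  qed
  \<comment> \<open>Rounding \<open>m\<close> up to a multiple of \<open>1 / n\<close> costs at most
    \<open>w 1 / n\<close>, which this choice keeps below \<open>e\<close>.\<close>
  obtain n :: nat where n: "w 1 < real n * e" using reals_Archimedean3[OF e] by blast
  have n0: "0 < real n" using n e nn[of 1] by (cases n) auto
  define k where "k = nat \<lceil>m * real n\<rceil>"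
  have k: "m * real n \<le> real k" "real k \<le> m * real n + 1"
    using m n0 by (auto simp: k_def intro: of_nat_ceiling)
  have "w m \<le> w (real k / real n)"
    using add[of m "real k / real n - m"] nn[of "real k / real n - m"] m k n0
    by (simp add: field_simps)
  also have "\<dots> = real k * w (1 / real n)" using mult[of "1 / real n" k] by simp
  also have "w (1 / real n) = w 1 / real n"
    using mult[of "1 / real n" n] n0 by (simp add: field_simps)
  also have "real k * (w 1 / real n) \<le> (m * real n + 1) * (w 1 / real n)"
    using k nn[of 1] n0 by (intro mult_right_mono) auto
  also have "\<dots> = w 1 * m + w 1 / real n" using n0 by (simp add: field_simps)
  also have "\<dots> \<le> w 1 * m + e" using n n0 by (simp add: field_simps)
  finally show "w m \<le> w 1 * m + e" .
qed

text \<open>One free side and unit sides otherwise realise every volume, whatever the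
  dimension.\<close>

lemma measure_slab:
  fixes i0 :: "'d::finite"
  assumes "a \<le> b"
  shows "measure lborel (cbox (\<chi> i. if i = i0 then a else 0) (\<chi> i. if i = i0 then b else 1)) = b - a"
proof -
  let ?l = "\<chi> i. if i = i0 then a else 0" and ?u = "\<chi> i. if i = i0 then b else 1"
  have "cbox ?l ?u \<noteq> {}"
    using assms by (auto simp: interval_ne_empty_cart)
  then have "measure lborel (cbox ?l ?u) = (\<Prod>i\<in>UNIV. ?u $ i - ?l $ i)"
    by (rule content_cbox_cart)
  also have "\<dots> = (\<Prod>i\<in>UNIV. if i = i0 then b - a else 1)"
    by (intro prod.cong) auto
  also have "\<dots> = b - a" by simp
  finally show ?thesis .
qed

text \<open>The characteristic function involves the set only through its volume, so Levy's
  uniqueness theorem applies.\<close>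

lemma homogeneous_levy_basis_distr_eq:
  assumes hb: "homogeneous_levy_basis P \<Lambda> \<beta> \<sigma>2 \<nu>"
    and B: "bounded_borel B" "bounded_borel C" "measure lborel B = measure lborel C"
  shows "distr P borel (\<Lambda> B) = distr P borel (\<Lambda> C)"
proof (rule Levy_uniqueness)
  interpret prob_space P using hb by (simp add: homogeneous_levy_basis_def)
  have "\<Lambda> B \<in> borel_measurable P" "\<Lambda> C \<in> borel_measurable P"
    using hb B unfolding homogeneous_levy_basis_def independently_scattered_def by auto
  then show "real_distribution (distr P borel (\<Lambda> B))" "real_distribution (distr P borel (\<Lambda> C))"
    by (auto intro: real_distribution_distr)
  show "char (distr P borel (\<Lambda> B)) = char (distr P borel (\<Lambda> C))"
    using hb B unfolding homogeneous_levy_basis_def by auto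
qed

text \<open>The variance is a function \<open>w\<close> of the volume alone. It is additive because
  any two volumes occur as those of disjoint slabs, hence at most linear with slope
  \<open>w 1\<close>.\<close>

lemma homogeneous_levy_basis_centred:
  fixes \<Lambda> :: "(real ^ 'd) set \<Rightarrow> 'w \<Rightarrow> real"
  assumes hb: "homogeneous_levy_basis P \<Lambda> \<beta> \<sigma>2 \<nu>"
    and mz: "mean_zero P \<Lambda>" and fs: "finite_second_moment P \<Lambda>"
  obtains \<kappa> where "centred_random_measure P \<Lambda> \<kappa>"
proof -
  interpret prob_space P using hb by (simp add: homogeneous_levy_basis_def)
  interpret centred_scattered_measure P \<Lambda>
    using hb mz fs
    by unfold_locales (auto simp: homogeneous_levy_basis_def mean_zero_def finite_second_moment_def)
  define v where "v B = expectation (\<lambda>w. (\<Lambda> B w)\<^sup>2)" for B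
  have v_eq: "v B = v C" if "bounded_borel B" "bounded_borel C" "measure lborel B = measure lborel C" for B C
  proof -
    have "v B = (\<integral>x. x\<^sup>2 \<partial>distr P borel (\<Lambda> B))"
      unfolding v_def using measurable_basis[OF that(1)] by (subst integral_distr) auto
    also have "\<dots> = (\<integral>x. x\<^sup>2 \<partial>distr P borel (\<Lambda> C))"
      using homogeneous_levy_basis_distr_eq[OF hb that] by simp
    also have "\<dots> = v C"
      unfolding v_def using measurable_basis[OF that(2)] by (subst integral_distr) auto
    finally show ?thesis .
  qed
  fix i0 :: 'd
  define S :: "real \<Rightarrow> real \<Rightarrow> (real ^ 'd) set" where
    "S a b = cbox (\<chi> i. if i = i0 then a else 0) (\<chi> i. if i = i0 then b else 1)" for a b
  have S: "bounded_borel (S a b)" for a b by (simp add: S_def)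
  have Sm: "measure lborel (S a b) = b - a" if "a \<le> b" for a b
    unfolding S_def using that by (rule measure_slab)
  define w where "w x = v (S 0 x)" for x
  have w: "v B = w (measure lborel B)" if "bounded_borel B" for B
    unfolding w_def using that S by (intro v_eq) (auto simp: Sm)
  have add: "w (x + y) = w x + w y" if "0 \<le> x" "0 \<le> y" for x y
  proof -
    \<comment> \<open>The second slab starts at \<open>x + 1\<close> because closed slabs that touch
      would share a face.\<close>
    have disj: "S 0 x \<inter> S (x + 1) (x + 1 + y) = {}"
      using that by (auto simp: S_def mem_box_cart dest!: spec[of _ i0])
    have "v (S 0 x \<union> S (x + 1) (x + 1 + y)) = v (S 0 x) + v (S (x + 1) (x + 1 + y))"
      unfolding v_def using S disj by (intro expectation_square_Un) auto
    moreover have "measure lborel (S 0 x \<union> S (x + 1) (x + 1 + y)) = x + y"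
    proof -
      have "emeasure lborel (S a b) \<noteq> \<infinity>" for a b
        using emeasure_bounded_finite[of "S a b"] S[of a b] by auto
      then show ?thesis
        using that S disj by (subst measure_Union) (auto simp: Sm)
    qed
    moreover have "bounded_borel (S 0 x \<union> S (x + 1) (x + 1 + y))" using S by auto
    ultimately show ?thesis using that w S by (simp add: Sm)
  qed
  have nn: "0 \<le> w x" for x by (simp add: w_def v_def)
  have "centred_random_measure P \<Lambda> (w 1)"
  proof unfold_locales
    fix B :: "(real ^ 'd) set" assume "bounded_borel B"
    from w[OF this] show "expectation (\<lambda>w. (\<Lambda> B w)\<^sup>2) \<le> w 1 * measure lborel B"
      using nonneg_additive_le_linear[OF add nn, of "measure lborel B"] by (simp add: v_def)
  qed (rule nn)
  then show ?thesis by (rule that)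
qed

section \<open>Decay and regularity of the kernel\<close>

text \<open>\<open>W l k\<close> is the \<open>k\<close>-th coefficient of the Lagrange polynomial
  of the node \<open>l\<close>. The identity says that interpolation at \<open>p\<close> nodes
  reproduces the monomial of degree \<open>j < p\<close>.\<close>

lemma lagrange_coefficients:
  fixes S :: "complex set"
  assumes S: "card S = p" "p > 0"
  obtains W :: "complex \<Rightarrow> nat \<Rightarrow> complex"
  where "\<And>j k. j < p \<Longrightarrow> (\<Sum>l\<in>S. l ^ j * W l k) = (if k = j then 1 else 0)"
proof -
  have fin: "finite S" using S by (auto intro: card_ge_0_finite)
  define L where "L l = (\<Prod>m\<in>S - {l}. Polynomial.smult (1 / (l - m)) [:- m, 1:])" for l
  have deg: "degree (L l) < p" if "l \<in> S" for l
  proof -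
    have "degree (L l) \<le> (\<Sum>m\<in>S - {l}. degree (Polynomial.smult (1 / (l - m)) [:- m, 1:]))"
      unfolding L_def using degree_prod_sum_le[of "S - {l}" "\<lambda>m. Polynomial.smult (1 / (l - m)) [:- m, 1:]"] fin
      by (simp add: comp_def)
    also have "\<dots> \<le> (\<Sum>m\<in>S - {l}. 1)" by (intro sum_mono) simp
    also have "\<dots> < p" using S that fin by simp
    finally show ?thesis .
  qed
  have val: "poly (L l) z = (if z = l then 1 else 0)" if "l \<in> S" "z \<in> S" for l z
  proof (cases "z = l")
    case True
    have "poly (L l) l = (\<Prod>m\<in>S - {l}. 1)"
      unfolding L_def poly_prod by (intro prod.cong refl) (auto simp: field_simps)
    then show ?thesis using True by simp
  next
    case False
    then show ?thesis using fin that unfolding L_def poly_prod by (auto simp: prod_zero_iff)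
  qed
  show ?thesis
  proof (rule that)
    fix j k :: nat assume j: "j < p"
    let ?q = "\<Sum>l\<in>S. Polynomial.smult (l ^ j) (L l)"
    have "?q = Polynomial.monom 1 j"
    proof (rule poly_eqI_degree[of S])
      fix z assume z: "z \<in> S"
      have "poly ?q z = (\<Sum>l\<in>S. if l = z then z ^ j else 0)"
        unfolding poly_sum using val z by (intro sum.cong refl) auto
      then show "poly ?q z = poly (Polynomial.monom 1 j) z" using fin z by (simp add: poly_monom)
    next
      show "degree (Polynomial.monom (1::complex) j) < card S" using j S by (simp add: degree_monom_eq)
      have "degree ?q \<le> p - 1"
        using deg by (intro degree_sum_le fin) (metis Suc_diff_1 S(2) degree_smult_le less_Suc_eq_le order_trans)
      then show "degree ?q < card S" using S by simp
    qed
    then have "coeff ?q k = (if k = j then 1 else 0)" by (simp add: coeff_monom)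
    then show "(\<Sum>l\<in>S. l ^ j * coeff (L l) k) = (if k = j then 1 else 0)"
      by (simp add: coeff_sum)
  qed
qed

section \<open>Spectrum, powers and exponentials of companion matrices\<close>

lemma companion_mat_carrier [simp]: "companion_mat c \<in> carrier_mat (degree c) (degree c)"
  by (simp add: companion_mat_def)

text \<open>The superdiagonal rows force the entries of an eigenvector to be the powers of
  \<open>l\<close> times the first entry, which is therefore nonzero. The last row then says that
  \<open>l\<close> is a root.\<close>

lemma companion_mat_spectrum:
  assumes c: "lead_coeff c = 1" "degree c > 0"
    and l: "l \<in> spectrum (map_mat complex_of_real (companion_mat c))"
  shows "poly (map_poly complex_of_real c) l = 0"
proof -
  define p where "p = degree c"
  let ?A = "map_mat complex_of_real (companion_mat c)"
  have A: "?A \<in> carrier_mat p p" by (simp add: p_def)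
  obtain v where "eigenvector ?A v l"
    using l unfolding spectrum_def eigenvalue_def by blast
  then have v: "dim_vec v = p" "v \<noteq> 0\<^sub>v p" and eig: "?A *\<^sub>v v = l \<cdot>\<^sub>v v"
    using A unfolding eigenvector_def carrier_vec_def carrier_mat_def by simp_all
  have row: "(\<Sum>j<p. complex_of_real (companion_mat c $$ (i, j)) * vec_index v j) = l * vec_index v i" if "i < p" for i
  proof -
    have "vec_index (?A *\<^sub>v v) i = (\<Sum>j<p. complex_of_real (companion_mat c $$ (i, j)) * vec_index v j)"
      using that A v by (auto simp: scalar_prod_def atLeast0LessThan p_def companion_mat_def intro!: sum.cong)
    then show ?thesis using eig that v by simp
  qed
  have step: "vec_index v (Suc i) = l * vec_index v i" if "Suc i < p" for i
  proof -
    have "(\<Sum>j<p. complex_of_real (companion_mat c $$ (i, j)) * vec_index v j) =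
        (\<Sum>j<p. if j = Suc i then vec_index v (Suc i) else 0)"
      using that by (intro sum.cong refl) (auto simp: companion_mat_def p_def)
    then show ?thesis using row[of i] that by simp
  qed
  have pow: "vec_index v i = l ^ i * vec_index v 0" if "i < p" for i
    using that by (induction i) (auto simp: step)
  have v0: "vec_index v 0 \<noteq> 0"
  proof
    assume v0: "vec_index v 0 = 0"
    have "vec_index v i = 0" if "i < p" for i unfolding pow[OF that] v0 by simp
    then have "v = 0\<^sub>v p" using v(1) by (intro eq_vecI) auto
    then show False using v by simp
  qed
  have p: "p > 0" using c by (simp add: p_def)
  have "(\<Sum>j<p. - complex_of_real (coeff c j) * (l ^ j * vec_index v 0)) = l * (l ^ (p - 1) * vec_index v 0)"
  proof -
    have "(\<Sum>j<p. - complex_of_real (coeff c j) * (l ^ j * vec_index v 0)) =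
        (\<Sum>j<p. complex_of_real (companion_mat c $$ (p - 1, j)) * vec_index v j)"
    proof (intro sum.cong refl)
      fix j assume j: "j \<in> {..<p}"
      then have "vec_index v j = l ^ j * vec_index v 0" by (intro pow) simp
      moreover have "companion_mat c $$ (p - 1, j) = - coeff c j"
        using j p by (simp add: companion_mat_def p_def)
      ultimately show "- complex_of_real (coeff c j) * (l ^ j * vec_index v 0) =
          complex_of_real (companion_mat c $$ (p - 1, j)) * vec_index v j" by simp
    qed
    also have "\<dots> = l * vec_index v (p - 1)" using row[of "p - 1"] p by simp
    also have "vec_index v (p - 1) = l ^ (p - 1) * vec_index v 0" using pow[of "p - 1"] p by simp
    finally show ?thesis .
  qed
  moreover have "(\<Sum>j<p. - complex_of_real (coeff c j) * (l ^ j * vec_index v 0)) =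
      - (\<Sum>j<p. complex_of_real (coeff c j) * l ^ j) * vec_index v 0"
    by (simp only: sum_negf[symmetric] sum_distrib_right mult.assoc mult_minus_left)
  moreover have "l * (l ^ (p - 1) * vec_index v 0) = l ^ p * vec_index v 0"
    using p by (cases p) (simp_all add: mult.assoc)
  ultimately have "- (\<Sum>j<p. complex_of_real (coeff c j) * l ^ j) * vec_index v 0 = l ^ p * vec_index v 0"
    by simp
  then have "l ^ p = - (\<Sum>j<p. complex_of_real (coeff c j) * l ^ j)"
    using v0 by (simp only: mult_cancel_right) simp
  then have "l ^ p + (\<Sum>j<p. complex_of_real (coeff c j) * l ^ j) = 0" by simp
  moreover have "poly (map_poly complex_of_real c) l = (\<Sum>j\<le>p. complex_of_real (coeff c j) * l ^ j)"
    by (simp add: poly_altdef coeff_map_poly degree_map_poly p_def)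
  moreover have "(\<Sum>j\<le>p. complex_of_real (coeff c j) * l ^ j) =
      complex_of_real (coeff c p) * l ^ p + (\<Sum>j<p. complex_of_real (coeff c j) * l ^ j)"
    by (simp add: lessThan_Suc_atMost[symmetric] add.commute)
  ultimately show ?thesis using c by (simp add: p_def)
qed

lemma pow_mat_Suc_left:
  assumes "A \<in> carrier_mat n n"
  shows "A ^\<^sub>m Suc k = A * A ^\<^sub>m k"
proof (induction k)
  case (Suc k)
  have "A ^\<^sub>m Suc (Suc k) = (A * A ^\<^sub>m k) * A" using Suc by simp
  also have "\<dots> = A * (A ^\<^sub>m k * A)"
    using assms by (intro assoc_mult_mat[of _ n n _ n _ n]) auto
  finally show ?case by simp
qed (use assms in auto)

lemma index_mult_mat_sum:
  assumes "A \<in> carrier_mat n n" "B \<in> carrier_mat n n" "j < n" "k < n"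
  shows "(A * B) $$ (j, k) = (\<Sum>m<n. A $$ (j, m) * B $$ (m, k))"
  using assms by (auto simp: scalar_prod_def atLeast0LessThan intro!: sum.cong)

lemma index_smult_pow_mat:
  fixes A :: "real mat"
  assumes A: "A \<in> carrier_mat n n" and "j < n" "k < n"
  shows "((x \<cdot>\<^sub>m A) ^\<^sub>m m) $$ (j, k) = x ^ m * (A ^\<^sub>m m) $$ (j, k)"
  using assms(2,3)
proof (induction m arbitrary: j k)
  case 0
  then show ?case using A by simp
next
  case (Suc m)
  have xA: "x \<cdot>\<^sub>m A \<in> carrier_mat n n" using A by simp
  have "((x \<cdot>\<^sub>m A) ^\<^sub>m Suc m) $$ (j, k) = (\<Sum>i<n. ((x \<cdot>\<^sub>m A) ^\<^sub>m m) $$ (j, i) * (x \<cdot>\<^sub>m A) $$ (i, k))"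
    using index_mult_mat_sum[OF pow_carrier_mat[OF xA] xA Suc.prems] by simp
  also have "\<dots> = x ^ Suc m * (\<Sum>i<n. (A ^\<^sub>m m) $$ (j, i) * A $$ (i, k))"
    unfolding sum_distrib_left using Suc A by (intro sum.cong refl) auto
  also have "(\<Sum>i<n. (A ^\<^sub>m m) $$ (j, i) * A $$ (i, k)) = (A ^\<^sub>m Suc m) $$ (j, k)"
    using index_mult_mat_sum[OF pow_carrier_mat[OF A] A Suc.prems] by simp
  finally show ?case .
qed

text \<open>A root \<open>l\<close> of \<open>c\<close> has the eigenvector \<open>(1, l, \<dots>, l ^ (p - 1))\<close>, so the eigenvector
  matrix is a Vandermonde matrix and its inverse consists of the coefficients of the Lagrange
  polynomials.\<close>

lemma companion_mat_power:
  fixes c :: "real poly" and W :: "complex \<Rightarrow> nat \<Rightarrow> complex"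
  assumes c: "lead_coeff c = 1" "degree c = p" "p > 0"
    and roots: "\<And>l. l \<in> S \<Longrightarrow> poly (map_poly complex_of_real c) l = 0"
    and W: "\<And>j k. j < p \<Longrightarrow> (\<Sum>l\<in>S. l ^ j * W l k) = (if k = j then 1 else 0)"
    and jk: "j < p" "k < p"
  shows "complex_of_real ((companion_mat c ^\<^sub>m n) $$ (j, k)) = (\<Sum>l\<in>S. l ^ (n + j) * W l k)"
  using jk
proof (induction n arbitrary: j k)
  case 0
  then show ?case using W[of j k] c companion_mat_carrier[of c] by (auto simp: one_mat_def)
next
  case (Suc n)
  let ?A = "companion_mat c"
  have A: "?A \<in> carrier_mat p p" using companion_mat_carrier[of c] c by simp
  have row: "(\<Sum>m<p. complex_of_real (?A $$ (j, m)) * l ^ m) = l ^ Suc j" if l: "l \<in> S" for l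
  proof (cases "Suc j < p")
    case True
    have "(\<Sum>m<p. complex_of_real (?A $$ (j, m)) * l ^ m) = (\<Sum>m<p. if m = Suc j then l ^ Suc j else 0)"
      using True c by (intro sum.cong refl) (auto simp: companion_mat_def)
    then show ?thesis using True by simp
  next
    case False
    then have j: "Suc j = p" using Suc.prems by simp
    have "poly (map_poly complex_of_real c) l = (\<Sum>m\<le>p. complex_of_real (coeff c m) * l ^ m)"
      using c by (simp add: poly_altdef coeff_map_poly degree_map_poly)
    also have "\<dots> = l ^ p + (\<Sum>m<p. complex_of_real (coeff c m) * l ^ m)"
      using c by (simp add: lessThan_Suc_atMost[symmetric] add.commute)
    finally have "l ^ p = - (\<Sum>m<p. complex_of_real (coeff c m) * l ^ m)"
      using roots[OF l] by (simp add: eq_neg_iff_add_eq_0)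
    also have "\<dots> = (\<Sum>m<p. complex_of_real (?A $$ (j, m)) * l ^ m)"
      unfolding sum_negf[symmetric] using j c by (intro sum.cong refl) (auto simp: companion_mat_def)
    finally show ?thesis using j by simp
  qed
  have "complex_of_real ((?A ^\<^sub>m Suc n) $$ (j, k)) =
      (\<Sum>m<p. complex_of_real (?A $$ (j, m)) * complex_of_real ((?A ^\<^sub>m n) $$ (m, k)))"
    unfolding pow_mat_Suc_left[OF A] index_mult_mat_sum[OF A pow_carrier_mat[OF A] Suc.prems] by simp
  also have "\<dots> = (\<Sum>m<p. \<Sum>l\<in>S. complex_of_real (?A $$ (j, m)) * (l ^ (n + m) * W l k))"
    using Suc by (intro sum.cong refl) (simp add: sum_distrib_left)
  also have "\<dots> = (\<Sum>l\<in>S. \<Sum>m<p. complex_of_real (?A $$ (j, m)) * (l ^ (n + m) * W l k))"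
    by (rule sum.swap)
  also have "\<dots> = (\<Sum>l\<in>S. (\<Sum>m<p. complex_of_real (?A $$ (j, m)) * l ^ m) * (l ^ n * W l k))"
    unfolding sum_distrib_right by (intro sum.cong refl) (simp add: power_add mult_ac)
  also have "\<dots> = (\<Sum>l\<in>S. l ^ (Suc n + j) * W l k)"
    by (intro sum.cong refl) (simp only: row, simp add: power_add mult_ac)
  finally show ?case .
qed

text \<open>The formula for the powers is summed against the exponential series. The matrix entries
  are real, so taking real parts of the complex series loses nothing.\<close>

lemma mat_exp_companion:
  fixes c :: "real poly" and W :: "complex \<Rightarrow> nat \<Rightarrow> complex"
  assumes c: "lead_coeff c = 1" "degree c = p" "p > 0"
    and roots: "\<And>l. l \<in> S \<Longrightarrow> poly (map_poly complex_of_real c) l = 0"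
    and W: "\<And>j k. j < p \<Longrightarrow> (\<Sum>l\<in>S. l ^ j * W l k) = (if k = j then 1 else 0)"
    and jk: "j < p" "k < p"
  shows "mat_exp (x \<cdot>\<^sub>m companion_mat c) $$ (j, k) = Re (\<Sum>l\<in>S. l ^ j * W l k * exp (complex_of_real x * l))"
proof -
  have A: "companion_mat c \<in> carrier_mat p p" using companion_mat_carrier[of c] c by simp
  have "(\<lambda>n. \<Sum>l\<in>S. l ^ j * W l k * ((complex_of_real x * l) ^ n /\<^sub>R fact n)) sums
      (\<Sum>l\<in>S. l ^ j * W l k * exp (complex_of_real x * l))"
    by (intro sums_sum sums_mult exp_converges)
  moreover have "(\<Sum>l\<in>S. l ^ j * W l k * ((complex_of_real x * l) ^ n /\<^sub>R fact n)) =
      complex_of_real (((x \<cdot>\<^sub>m companion_mat c) ^\<^sub>m n) $$ (j, k) / fact n)" for n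
  proof -
    have "complex_of_real (((x \<cdot>\<^sub>m companion_mat c) ^\<^sub>m n) $$ (j, k) / fact n) =
        complex_of_real (x ^ n / fact n) * (\<Sum>l\<in>S. l ^ (n + j) * W l k)"
      unfolding index_smult_pow_mat[OF A jk] using companion_mat_power[OF c roots W jk, of n] by simp
    also have "\<dots> = (\<Sum>l\<in>S. l ^ j * W l k * ((complex_of_real x * l) ^ n /\<^sub>R fact n))"
      unfolding sum_distrib_left
      by (intro sum.cong refl) (simp add: power_add power_mult_distrib scaleR_conv_of_real divide_inverse mult_ac)
    finally show ?thesis by simp
  qed
  ultimately have "(\<lambda>n. complex_of_real (((x \<cdot>\<^sub>m companion_mat c) ^\<^sub>m n) $$ (j, k) / fact n)) sums
      (\<Sum>l\<in>S. l ^ j * W l k * exp (complex_of_real x * l))" by simp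
  from sums_Re[OF this] have "(\<lambda>n. ((x \<cdot>\<^sub>m companion_mat c) ^\<^sub>m n) $$ (j, k) / fact n) sums
      Re (\<Sum>l\<in>S. l ^ j * W l k * exp (complex_of_real x * l))"
    by (simp only: Re_complex_of_real)
  then show ?thesis
    using jk A by (simp add: mat_exp_def sums_iff)
qed

section \<open>Lipschitz functions with exponential decay\<close>

lemma norm_exp_diff_le:
  assumes z: "Re z \<le> 0" shows "cmod (exp z - 1) \<le> cmod z"
proof -
  have "norm (exp z - exp 0) \<le> 1 * norm (z - 0)"
  proof (rule field_differentiable_bound[where S="{z. Re z \<le> 0}" and f'=exp])
    show "convex {z. Re z \<le> 0}" by (rule convex_halfspace_Re_le)
  qed (use z in \<open>auto intro!: derivative_eq_intros\<close>)
  then show ?thesis by simp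
qed

text \<open>\<open>x\<close> is the lower corner of a cube of side \<open>\<delta>\<close>
  containing \<open>y\<close>, like a grid point and a point of its cell. Decay is measured at the
  corner and only in the coordinates of \<open>S\<close>, so that factors in separate coordinates
  multiply to decay in all of them.\<close>

definition exp_lipschitz_bound :: "real \<Rightarrow> real \<Rightarrow> 'd set \<Rightarrow> (real ^ 'd \<Rightarrow> real) \<Rightarrow> bool" where
  "exp_lipschitz_bound C c S F \<longleftrightarrow> 0 \<le> C \<and> (\<forall>x y \<delta>. 0 \<le> \<delta> \<longrightarrow>
     (\<forall>i. 0 \<le> x $ i \<and> x $ i \<le> y $ i \<and> y $ i \<le> x $ i + \<delta>) \<longrightarrow>
     \<bar>F x\<bar> \<le> C * exp (- c * (\<Sum>i\<in>S. x $ i)) \<and>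
     \<bar>F x - F y\<bar> \<le> C * \<delta> * exp (- c * (\<Sum>i\<in>S. x $ i)))"

definition exp_lipschitz :: "real \<Rightarrow> 'd set \<Rightarrow> (real ^ 'd \<Rightarrow> real) \<Rightarrow> bool" where
  "exp_lipschitz c S F \<longleftrightarrow> (\<exists>C. exp_lipschitz_bound C c S F)"

lemma exp_lipschitzI:
  assumes "0 \<le> C"
    and "\<And>x y \<delta>. 0 \<le> \<delta> \<Longrightarrow> (\<And>i. 0 \<le> x $ i \<and> x $ i \<le> y $ i \<and> y $ i \<le> x $ i + \<delta>) \<Longrightarrow>
      \<bar>F x\<bar> \<le> C * exp (- c * (\<Sum>i\<in>S. x $ i)) \<and>
      \<bar>F x - F y\<bar> \<le> C * \<delta> * exp (- c * (\<Sum>i\<in>S. x $ i))"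
  shows "exp_lipschitz c S F"
  unfolding exp_lipschitz_def exp_lipschitz_bound_def using assms by (intro exI[of _ C]) auto

lemma exp_lipschitz_boundD:
  assumes "exp_lipschitz_bound C c S F" "0 \<le> \<delta>"
    and "\<And>i. 0 \<le> x $ i \<and> x $ i \<le> y $ i \<and> y $ i \<le> x $ i + \<delta>"
  shows "\<bar>F x\<bar> \<le> C * exp (- c * (\<Sum>i\<in>S. x $ i))"
    and "\<bar>F x - F y\<bar> \<le> C * \<delta> * exp (- c * (\<Sum>i\<in>S. x $ i))"
  using assms unfolding exp_lipschitz_bound_def by blast+

lemma exp_lipschitz_bound_nonneg: "exp_lipschitz_bound C c S F \<Longrightarrow> 0 \<le> C"
  unfolding exp_lipschitz_bound_def by blast

lemma exp_lipschitz_const: "exp_lipschitz c {} (\<lambda>x. a)"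
  by (rule exp_lipschitzI[of "\<bar>a\<bar>"]) auto

lemma exp_lipschitz_add:
  assumes "exp_lipschitz c S F" "exp_lipschitz c S G"
  shows "exp_lipschitz c S (\<lambda>x. F x + G x)"
proof -
  obtain C where C: "exp_lipschitz_bound C c S F"
    using assms(1) unfolding exp_lipschitz_def ..
  note C0 = exp_lipschitz_bound_nonneg[OF C]
  obtain D where D: "exp_lipschitz_bound D c S G"
    using assms(2) unfolding exp_lipschitz_def ..
  note D0 = exp_lipschitz_bound_nonneg[OF D]
  show ?thesis
  proof (rule exp_lipschitzI[of "C + D"])
    fix x y :: "real ^ 'a" and \<delta> :: real
    assume *: "0 \<le> \<delta>" "\<And>i. 0 \<le> x $ i \<and> x $ i \<le> y $ i \<and> y $ i \<le> x $ i + \<delta>"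
    have "\<bar>F x + G x - (F y + G y)\<bar> \<le> \<bar>F x - F y\<bar> + \<bar>G x - G y\<bar>" by simp
    then show "\<bar>F x + G x\<bar> \<le> (C + D) * exp (- c * (\<Sum>i\<in>S. x $ i)) \<and>
        \<bar>F x + G x - (F y + G y)\<bar> \<le> (C + D) * \<delta> * exp (- c * (\<Sum>i\<in>S. x $ i))"
      using exp_lipschitz_boundD[OF C *] exp_lipschitz_boundD[OF D *] abs_triangle_ineq[of "F x" "G x"]
      unfolding distrib_right by linarith
  qed (use C0 D0 in simp)
qed

lemma exp_lipschitz_zero: "exp_lipschitz c S (\<lambda>x. 0)"
  by (rule exp_lipschitzI[of 0]) auto

lemma exp_lipschitz_sum:
  assumes "\<And>m. m \<in> I \<Longrightarrow> exp_lipschitz c S (F m)"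
  shows "exp_lipschitz c S (\<lambda>x. \<Sum>m\<in>I. F m x)"
  using assms
  by (induction I rule: infinite_finite_induct) (auto intro: exp_lipschitz_zero exp_lipschitz_add)

text \<open>The exponents add because \<open>S\<close> and \<open>T\<close> are disjoint. The
  increment follows the product rule, whose two terms give the factor 2; \<open>F y\<close> inherits
  the decay at \<open>x\<close> because \<open>y\<close> lies above \<open>x\<close>.\<close>

lemma exp_lipschitz_mult:
  assumes F: "exp_lipschitz c S F" and G: "exp_lipschitz c T G" and ST: "S \<inter> T = {}" and c: "0 < c"
  shows "exp_lipschitz c (S \<union> T) (\<lambda>x. F x * G x :: real)"
proof -
  obtain C where C: "exp_lipschitz_bound C c S F"
    using F unfolding exp_lipschitz_def ..
  note C0 = exp_lipschitz_bound_nonneg[OF C]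
  obtain D where D: "exp_lipschitz_bound D c T G"
    using G unfolding exp_lipschitz_def ..
  note D0 = exp_lipschitz_bound_nonneg[OF D]
  show ?thesis
  proof (rule exp_lipschitzI[of "2 * C * D"])
    fix x y :: "real ^ 'a" and \<delta> :: real
    assume *: "0 \<le> \<delta>" "\<And>i. 0 \<le> x $ i \<and> x $ i \<le> y $ i \<and> y $ i \<le> x $ i + \<delta>"
    let ?s = "exp (- c * (\<Sum>i\<in>S. x $ i))" and ?t = "exp (- c * (\<Sum>i\<in>T. x $ i))"
    have st: "exp (- c * (\<Sum>i\<in>S \<union> T. x $ i)) = ?s * ?t"
      using ST by (subst sum.union_disjoint) (auto simp: exp_add[symmetric] algebra_simps)
    have Fx: "\<bar>F x\<bar> \<le> C * ?s" and Fd: "\<bar>F x - F y\<bar> \<le> C * \<delta> * ?s" by (fact exp_lipschitz_boundD[OF C *])+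
    have Gx: "\<bar>G x\<bar> \<le> D * ?t" and Gd: "\<bar>G x - G y\<bar> \<le> D * \<delta> * ?t" by (fact exp_lipschitz_boundD[OF D *])+
    have "0 \<le> y $ i" for i using *(2)[of i] by linarith
    then have "\<bar>F y\<bar> \<le> C * exp (- c * (\<Sum>i\<in>S. y $ i))" by (intro exp_lipschitz_boundD(1)[OF C, of 0 y y]) auto
    also have "\<dots> \<le> C * ?s"
      using *(2) c C0 by (intro mult_left_mono) (auto intro!: sum_mono)
    finally have Fy: "\<bar>F y\<bar> \<le> C * ?s" .
    have 1: "\<bar>F x * G x\<bar> \<le> (C * ?s) * (D * ?t)"
      unfolding abs_mult using Fx Gx by (intro mult_mono) auto
    have "\<bar>F x * G x - F y * G y\<bar> = \<bar>(F x - F y) * G x + F y * (G x - G y)\<bar>"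
      by (simp add: algebra_simps)
    also have "\<dots> \<le> \<bar>F x - F y\<bar> * \<bar>G x\<bar> + \<bar>F y\<bar> * \<bar>G x - G y\<bar>"
      unfolding abs_mult[symmetric] by (rule abs_triangle_ineq)
    also have "\<dots> \<le> (C * \<delta> * ?s) * (D * ?t) + (C * ?s) * (D * \<delta> * ?t)"
      using Fd Gd Fy Gx by (intro add_mono mult_mono) auto
    finally have 2: "\<bar>F x * G x - F y * G y\<bar> \<le> 2 * C * D * \<delta> * (?s * ?t)"
      by (simp add: mult_ac)
    have "0 \<le> (C * ?s) * (D * ?t)" using C0 D0 by simp
    then have "(C * ?s) * (D * ?t) \<le> 2 * C * D * (?s * ?t)" by (simp add: mult_ac)
    with 1 2 show "\<bar>F x * G x\<bar> \<le> 2 * C * D * exp (- c * (\<Sum>i\<in>S \<union> T. x $ i)) \<and>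
        \<bar>F x * G x - F y * G y\<bar> \<le> 2 * C * D * \<delta> * exp (- c * (\<Sum>i\<in>S \<union> T. x $ i))"
      unfolding st by linarith
  qed (use C0 D0 in simp)
qed

text \<open>The exponential at the lower point is factored out of the increment. In the constant, 1
  accounts for the size and \<open>cmod l\<close> for the slope.\<close>

lemma exp_lipschitz_exponential:
  assumes l: "Re l \<le> - c" and c: "0 < c"
  shows "exp_lipschitz c {i} (\<lambda>x. Re (a * exp (complex_of_real (x $ i) * l)))"
proof (rule exp_lipschitzI[of "cmod a * (1 + cmod l)"])
  fix x y :: "real ^ 'a" and \<delta> :: real
  assume *: "0 \<le> \<delta>" "\<And>i. 0 \<le> x $ i \<and> x $ i \<le> y $ i \<and> y $ i \<le> x $ i + \<delta>"
  let ?u = "x $ i" and ?v = "y $ i"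
  have e: "cmod (exp (complex_of_real ?u * l)) \<le> exp (- c * ?u)"
    using mult_left_mono[OF l, of ?u] *(2)[of i] by (simp add: mult.commute)
  have "\<bar>Re (a * exp (complex_of_real ?u * l))\<bar> \<le> cmod a * cmod (exp (complex_of_real ?u * l))"
    using abs_Re_le_cmod[of "a * exp (complex_of_real ?u * l)"] by (simp only: norm_mult)
  also have "\<dots> \<le> cmod a * exp (- c * ?u)" using e by (rule mult_left_mono) simp
  also have "\<dots> \<le> cmod a * (1 + cmod l) * exp (- c * ?u)"
    by (intro mult_right_mono) (simp_all add: distrib_left)
  finally have 1: "\<bar>Re (a * exp (complex_of_real ?u * l))\<bar> \<le> cmod a * (1 + cmod l) * exp (- c * ?u)" .
  have "exp (complex_of_real ?v * l) = exp (complex_of_real ?u * l) * exp (complex_of_real (?v - ?u) * l)"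
    by (simp add: exp_add[symmetric] algebra_simps)
  then have eq: "a * exp (complex_of_real ?u * l) - a * exp (complex_of_real ?v * l) =
      - (a * (exp (complex_of_real ?u * l) * (exp (complex_of_real (?v - ?u) * l) - 1)))"
    by (simp add: algebra_simps)
  have "\<bar>Re (a * exp (complex_of_real ?u * l)) - Re (a * exp (complex_of_real ?v * l))\<bar>
      \<le> cmod (a * exp (complex_of_real ?u * l) - a * exp (complex_of_real ?v * l))"
    using abs_Re_le_cmod[of "a * exp (complex_of_real ?u * l) - a * exp (complex_of_real ?v * l)"] by simp
  also have "\<dots> = cmod a * (cmod (exp (complex_of_real ?u * l)) * cmod (exp (complex_of_real (?v - ?u) * l) - 1))"
    unfolding eq norm_minus_cancel norm_mult ..
  also have "\<dots> \<le> cmod a * (exp (- c * ?u) * (\<delta> * cmod l))"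
  proof (intro mult_left_mono mult_mono e)
    have "Re (complex_of_real (?v - ?u) * l) \<le> 0"
      using *(2)[of i] l c by (simp add: mult_nonneg_nonpos)
    then have "cmod (exp (complex_of_real (?v - ?u) * l) - 1) \<le> cmod (complex_of_real (?v - ?u) * l)"
      by (rule norm_exp_diff_le)
    also have "\<dots> = \<bar>?v - ?u\<bar> * cmod l" by (simp only: norm_mult norm_of_real)
    also have "\<dots> \<le> \<delta> * cmod l" using *(2)[of i] by (intro mult_right_mono) auto
    finally show "cmod (exp (complex_of_real (?v - ?u) * l) - 1) \<le> \<delta> * cmod l" .
  qed simp_all
  also have "\<dots> = cmod a * cmod l * (\<delta> * exp (- c * ?u))" by (simp add: mult_ac)
  also have "\<dots> \<le> cmod a * (1 + cmod l) * (\<delta> * exp (- c * ?u))"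
    using *(1) by (intro mult_right_mono mult_left_mono) auto
  finally have 2: "\<bar>Re (a * exp (complex_of_real ?u * l)) - Re (a * exp (complex_of_real ?v * l))\<bar>
      \<le> cmod a * (1 + cmod l) * \<delta> * exp (- c * ?u)" by (simp only: mult.assoc)
  show "\<bar>Re (a * exp (complex_of_real (x $ i) * l))\<bar> \<le> cmod a * (1 + cmod l) * exp (- c * (\<Sum>i\<in>{i}. x $ i)) \<and>
      \<bar>Re (a * exp (complex_of_real (x $ i) * l)) - Re (a * exp (complex_of_real (y $ i) * l))\<bar>
        \<le> cmod a * (1 + cmod l) * \<delta> * exp (- c * (\<Sum>i\<in>{i}. x $ i))"
    using 1 2 by simp
qed simp

lemma exp_lipschitz_Re_sum:
  assumes "\<And>l. l \<in> S \<Longrightarrow> Re l \<le> - c" and "0 < c"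
  shows "exp_lipschitz c {i} (\<lambda>x. Re (\<Sum>l\<in>S. a l * exp (complex_of_real (x $ i) * l)))"
  unfolding Re_sum using assms by (intro exp_lipschitz_sum exp_lipschitz_exponential) auto

text \<open>The spectrum consists of roots and has \<open>p\<close> elements, so it serves as the
  set of interpolation nodes; only pure exponentials occur, without polynomial factors.\<close>

lemma companion_mat_exp_lipschitz:
  assumes a: "lead_coeff a = 1" "degree a = p" "0 < p"
    and roots: "\<forall>z. poly (map_poly complex_of_real a) z = 0 \<longrightarrow> Re z \<le> - c"
    and c: "0 < c"
    and distinct: "distinct_eigenvalues (companion_mat a)"
    and jk: "j < p" "k < p"
  shows "exp_lipschitz c {i} (\<lambda>x. mat_exp ((x $ i) \<cdot>\<^sub>m companion_mat a) $$ (j, k))"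
proof -
  define S where "S = spectrum (map_mat complex_of_real (companion_mat a))"
  have card: "card S = p"
    using distinct companion_mat_carrier[of a] a unfolding distinct_eigenvalues_def S_def by auto
  have root: "poly (map_poly complex_of_real a) l = 0" if "l \<in> S" for l
    using companion_mat_spectrum[of a l] a that by (simp add: S_def)
  obtain W where W: "\<And>j k. j < p \<Longrightarrow> (\<Sum>l\<in>S. l ^ j * W l k) = (if k = j then 1 else 0 :: complex)"
    by (rule lagrange_coefficients[OF card a(3)]) (rule that)
  have "mat_exp (x \<cdot>\<^sub>m companion_mat a) $$ (j, k) = Re (\<Sum>l\<in>S. l ^ j * W l k * exp (complex_of_real x * l))" for x
    by (rule mat_exp_companion[OF a root W jk])
  then show ?thesis
    using root roots c by (simp only:) (intro exp_lipschitz_Re_sum, auto)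
qed

lemma exists_common_decay_rate:
  fixes a :: "'d::finite \<Rightarrow> real poly"
  assumes "\<And>i. a i \<noteq> 0"
    and "\<And>i z. poly (map_poly complex_of_real (a i)) z = 0 \<Longrightarrow> Re z < 0"
  obtains c where "0 < c" "\<And>i z. poly (map_poly complex_of_real (a i)) z = 0 \<Longrightarrow> Re z \<le> - c"
proof -
  define T where "T = (\<Union>i. {z. poly (map_poly complex_of_real (a i)) z = 0})"
  have "map_poly complex_of_real (a i) \<noteq> 0" for i
    using assms(1)[of i] by (simp add: map_poly_eq_0_iff)
  from poly_roots_finite[OF this] have fin: "finite T" unfolding T_def by simp
  \<comment> \<open>The element 1 keeps the set nonempty when there are no roots at all.\<close>
  define c where "c = Min (insert 1 ((\<lambda>z. - Re z) ` T))"
  have "0 < c" unfolding c_def using fin assms(2) by (subst Min_gr_iff) (auto simp: T_def)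
  moreover have "Re z \<le> - c" if "poly (map_poly complex_of_real (a i)) z = 0" for i z
  proof -
    have "- Re z \<in> insert 1 ((\<lambda>z. - Re z) ` T)" using that by (auto simp: T_def)
    then have "c \<le> - Re z" unfolding c_def using fin by (intro Min_le) auto
    then show ?thesis by simp
  qed
  ultimately show ?thesis by (rule that)
qed

lemma mat_exp_carrier: "A \<in> carrier_mat n n \<Longrightarrow> mat_exp A \<in> carrier_mat n n"
  by (simp add: mat_exp_def)

text \<open>Each matrix factor depends on a coordinate of its own, so induction along the coordinate
  list multiplies entries with disjoint coordinate sets and never permutes the matrices.\<close>

lemma carma_kernel_exp_lipschitz:
  fixes A :: "'d::{finite,linorder} \<Rightarrow> real mat"
  assumes b: "b \<in> carrier_vec p" and p: "0 < p"
    and A: "\<And>i. A i = companion_mat (a i)"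
    and a: "\<And>i. lead_coeff (a i) = 1" "\<And>i. degree (a i) = p"
    and roots: "\<And>i z. poly (map_poly complex_of_real (a i)) z = 0 \<Longrightarrow> Re z < 0"
    and distinct: "\<And>i. distinct_eigenvalues (A i)"
  obtains c where "0 < c" "exp_lipschitz c UNIV (carma_kernel p b A)"
proof -
  have "a i \<noteq> 0" for i using a[of i] p by auto
  then obtain c where c: "0 < c" and decay: "\<And>i z. poly (map_poly complex_of_real (a i)) z = 0 \<Longrightarrow> Re z \<le> - c"
    by (rule exists_common_decay_rate[of a]) (use roots in auto)
  have Ac: "A i \<in> carrier_mat p p" for i using companion_mat_carrier[of "a i"] a A by simp
  have E: "exp_lipschitz c {i} (\<lambda>x. mat_exp ((x $ i) \<cdot>\<^sub>m A i) $$ (j, k))" if "j < p" "k < p" for i j k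
    unfolding A using decay distinct that unfolding A
    by (intro companion_mat_exp_lipschitz[OF a p _ c]) auto
  let ?P = "\<lambda>xs x. foldr (\<lambda>i B. mat_exp ((x $ i) \<cdot>\<^sub>m A i) * B) xs (1\<^sub>m p)"
  have Ec: "mat_exp (y \<cdot>\<^sub>m A i) \<in> carrier_mat p p" for y i
    using Ac[of i] by (intro mat_exp_carrier) simp
  have Pc: "?P xs x \<in> carrier_mat p p" for xs and x :: "real ^ 'd::{finite,linorder}"
    using Ec by (induction xs) (auto intro: mult_carrier_mat)
  have P: "exp_lipschitz c (set xs) (\<lambda>x. ?P xs x $$ (j, k))" if "distinct xs" "j < p" "k < p" for xs j k
    using that
  proof (induction xs arbitrary: j k)
    case Nil
    then show ?case using exp_lipschitz_const[of c "if j = k then 1 else 0"] by (simp add: one_mat_def)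
  next
    case (Cons i xs)
    have "exp_lipschitz c ({i} \<union> set xs) (\<lambda>x. mat_exp ((x $ i) \<cdot>\<^sub>m A i) $$ (j, m) * ?P xs x $$ (m, k))"
      if "m < p" for m
      using Cons that c by (intro exp_lipschitz_mult E Cons.IH) auto
    then have "exp_lipschitz c ({i} \<union> set xs) (\<lambda>x. \<Sum>m<p. mat_exp ((x $ i) \<cdot>\<^sub>m A i) $$ (j, m) * ?P xs x $$ (m, k))"
      by (intro exp_lipschitz_sum) simp
    moreover have "?P (i # xs) x $$ (j, k) = (\<Sum>m<p. mat_exp ((x $ i) \<cdot>\<^sub>m A i) $$ (j, m) * ?P xs x $$ (m, k))" for x
      using index_mult_mat_sum[OF Ec Pc Cons.prems(2,3)] by simp
    ultimately show ?case by simp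
  qed
  define xs where "xs = sorted_list_of_set (UNIV :: 'd set)"
  have xs: "set xs = UNIV" "distinct xs" by (simp_all add: xs_def)
  define G where "G x = (\<Sum>j<p. vec_index b j * ?P xs x $$ (j, p - 1))" for x
  \<comment> \<open>The constant factor counts as a function of no coordinates, which fits the
    product rule.\<close>
  have "exp_lipschitz c ({} \<union> UNIV) (\<lambda>x. vec_index b j * ?P xs x $$ (j, p - 1))" if "j < p" for j
    using P[OF xs(2) that, of "p - 1"] p c xs(1)
    by (intro exp_lipschitz_mult exp_lipschitz_const) auto
  then have G: "exp_lipschitz c UNIV G"
    unfolding G_def[abs_def] by (intro exp_lipschitz_sum) simp
  \<comment> \<open>\<open>exp_lipschitz\<close> compares points with nonnegative coordinates only.
    There the indicator equals 1, so the jump of the kernel at the boundary of the quadrant does no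
    harm.\<close>
  have kernel: "carma_kernel p b A x = G x" if "\<And>i. 0 \<le> x $ i" for x
  proof -
    have "vec_index (?P xs x *\<^sub>v unit_vec p (p - 1)) j = ?P xs x $$ (j, p - 1)" if "j < p" for j
      using Pc[of x xs] that p by (auto simp: row_def scalar_prod_right_unit)
    then have "scalar_prod b (?P xs x *\<^sub>v unit_vec p (p - 1)) = G x"
      using Pc[of x xs] unfolding G_def scalar_prod_def by (auto simp: atLeast0LessThan intro!: sum.cong)
    then show ?thesis using that by (simp add: carma_kernel_def xs_def)
  qed
  obtain C where C: "exp_lipschitz_bound C c UNIV G"
    using G unfolding exp_lipschitz_def ..
  note C0 = exp_lipschitz_bound_nonneg[OF C]
  have "exp_lipschitz c UNIV (carma_kernel p b A)"
  proof (rule exp_lipschitzI[OF C0])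
    fix x y :: "real ^ 'd::{finite,linorder}" and \<delta> :: real
    assume *: "0 \<le> \<delta>" "\<And>i. 0 \<le> x $ i \<and> x $ i \<le> y $ i \<and> y $ i \<le> x $ i + \<delta>"
    have "carma_kernel p b A x = G x" "carma_kernel p b A y = G y"
      using *(2) by (auto intro!: kernel intro: order_trans)
    then show "\<bar>carma_kernel p b A x\<bar> \<le> C * exp (- c * (\<Sum>i\<in>UNIV. x $ i)) \<and>
        \<bar>carma_kernel p b A x - carma_kernel p b A y\<bar> \<le> C * \<delta> * exp (- c * (\<Sum>i\<in>UNIV. x $ i))"
      using exp_lipschitz_boundD[OF C *] by simp
  qed
  with c show ?thesis by (rule that)
qed

section \<open>Step functions on a grid\<close>

text \<open>The envelope of the reflected kernel: exponential decay on the quadrant below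
  \<open>t\<close>.\<close>

definition quadrant_exp :: "real \<Rightarrow> real ^ 'd \<Rightarrow> real ^ 'd \<Rightarrow> real" where
  "quadrant_exp c t u = indicator {u. \<forall>i. u $ i \<le> t $ i} u * exp (- c * (\<Sum>i\<in>UNIV. (t - u) $ i))"

text \<open>Half-open, so that for side \<open>real (Suc M) * \<delta>\<close> it is exactly the
  union of the half-open grid cells.\<close>

definition quadrant_box :: "real ^ 'd \<Rightarrow> real \<Rightarrow> (real ^ 'd) set" where
  "quadrant_box t r = {u. \<forall>i. 0 \<le> (t - u) $ i \<and> (t - u) $ i < r}"

lemma quadrant_box_borel [measurable]: "quadrant_box t r \<in> sets borel"
  unfolding quadrant_box_def by measurable

lemma quadrant_box_mono: "r \<le> r' \<Longrightarrow> quadrant_box t r \<subseteq> quadrant_box t r'"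
  unfolding quadrant_box_def by (blast intro: less_le_trans)

lemma nn_integral_exp_left_halfline:
  assumes "0 < a"
  shows "(\<integral>\<^sup>+y. ennreal (indicator {..b} y * exp (- a * (b - y))) \<partial>lborel) < \<infinity>"
proof -
  have "(\<integral>\<^sup>+y. ennreal (indicator {..b} y * exp (- a * (b - y))) \<partial>lborel) =
      (\<integral>\<^sup>+x. ennreal (indicator {..b} (b + (-1) * x) * exp (- a * (b - (b + (-1) * x)))) \<partial>lborel)"
    using nn_integral_real_affine[of "\<lambda>y. ennreal (indicator {..b} y * exp (- a * (b - y)))" "-1" b] by simp
  also have "\<dots> = (\<integral>\<^sup>+x. ennreal (exp (- a * x)) * indicator {0..} x \<partial>lborel)"
    by (intro nn_integral_cong) (auto simp: indicator_def)
  also have "\<dots> = ennreal (0 - (- exp (- a * 0) / a))"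
  proof (rule nn_integral_FTC_atLeast)
    show "((\<lambda>x. - exp (- a * x) / a) \<longlongrightarrow> 0) at_top" using assms by real_asymp
    show "DERIV (\<lambda>x. - exp (- a * x) / a) x :> exp (- a * x)" for x
      using assms by (auto intro!: derivative_eq_intros)
  qed auto
  finally show ?thesis by simp
qed

lemma quadrant_exp_measurable [measurable]: "quadrant_exp c t \<in> borel_measurable borel"
  unfolding quadrant_exp_def[abs_def] vector_minus_component
  by (intro borel_measurable_times borel_measurable_indicator borel_measurable_continuous_onI
      closed_Collect_all[THEN borel_closed] closed_Collect_le continuous_intros)

text \<open>The squared envelope is a product of functions of one coordinate, so its integral
  factorises into integrals of exponentials over half-lines.\<close>

lemma sqnorm_quadrant_exp_finite:
  fixes t :: "real ^ 'd"
  assumes "0 < c"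
  shows "sqnorm lborel (quadrant_exp c t) < \<infinity>"
proof -
  define F where "F b y = indicator {..t \<bullet> b} y * exp (- (2 * c) * (t \<bullet> b - y))" for b :: "real ^ 'd" and y :: real
  have [measurable]: "F b \<in> borel_measurable borel" for b unfolding F_def[abs_def] by measurable
  have F0: "0 \<le> F b y" for b y by (simp add: F_def)
  have B: "Basis = (\<lambda>i. axis i (1::real)) ` (UNIV :: 'd set)"
    by (auto simp: Basis_vec_def)
  have inj: "inj (\<lambda>i::'d. axis i (1::real))" by (auto simp: inj_on_def axis_eq_axis)
  have "(quadrant_exp c t u)\<^sup>2 = (\<Prod>b\<in>Basis. F b (u \<bullet> b))" for u
  proof -
    have "(\<Prod>b\<in>Basis. F b (u \<bullet> b)) = (\<Prod>i\<in>UNIV. indicator {..t $ i} (u $ i) * exp (- (2 * c) * (t $ i - u $ i)))"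
      unfolding B by (simp add: prod.reindex[OF inj] F_def inner_axis)
    also have "\<dots> = (\<Prod>i\<in>UNIV. indicator {..t $ i} (u $ i)) * exp (\<Sum>i\<in>UNIV. - (2 * c) * (t $ i - u $ i))"
      by (simp only: prod.distrib exp_sum[OF finite])
    also have "(\<Prod>i\<in>UNIV. indicator {..t $ i} (u $ i)) = (indicator {u. \<forall>i. u $ i \<le> t $ i} u :: real)"
    proof (cases "\<forall>i. u $ i \<le> t $ i")
      case False
      then obtain i where "\<not> u $ i \<le> t $ i" by auto
      then have "\<exists>i\<in>UNIV. indicator {..t $ i} (u $ i) = (0::real)" by (intro bexI[of _ i]) auto
      then have "(\<Prod>i\<in>UNIV. indicator {..t $ i} (u $ i)) = (0::real)" by (intro prod_zero) auto
      then show ?thesis using False by simp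
    qed simp
    also have "(\<Sum>i\<in>UNIV. - (2 * c) * (t $ i - u $ i)) = 2 * (- c * (\<Sum>i\<in>UNIV. (t - u) $ i))"
      by (simp add: sum_distrib_left mult_ac)
    also have "indicator {u. \<forall>i. u $ i \<le> t $ i} u * exp (2 * (- c * (\<Sum>i\<in>UNIV. (t - u) $ i))) = (quadrant_exp c t u)\<^sup>2"
      unfolding quadrant_exp_def exp_double by (auto simp: indicator_def)
    finally show ?thesis by simp
  qed
  then have "sqnorm lborel (quadrant_exp c t) = (\<integral>\<^sup>+u. (\<Prod>b\<in>Basis. ennreal (F b (u \<bullet> b))) \<partial>lborel)"
    unfolding sqnorm_def by (simp add: prod_ennreal F0)
  also have "\<dots> = (\<Prod>b\<in>Basis. \<integral>\<^sup>+y. ennreal (F b y) \<partial>lborel)"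
    by (rule nn_integral_lborel_prod) auto
  also have "\<dots> < \<infinity>"
  proof -
    have fin: "(\<integral>\<^sup>+y. ennreal (F b y) \<partial>lborel) < \<top>" for b
      using nn_integral_exp_left_halfline[of "2 * c" "t \<bullet> b"] assms unfolding F_def by simp
    have "(\<Prod>b\<in>S. \<integral>\<^sup>+y. ennreal (F b y) \<partial>lborel) < \<top>" if "finite S" for S
      using that by (induction S rule: finite_induct) (auto simp: ennreal_mult_less_top fin)
    then show ?thesis by simp
  qed
  finally show ?thesis .
qed

text \<open>Dominated convergence: a point of the support lies in the box once \<open>r\<close>
  exceeds all coordinates of \<open>t - u\<close>.\<close>

lemma sqnorm_tail_tendsto_0:
  fixes f :: "real ^ 'd \<Rightarrow> real"
  assumes [measurable]: "f \<in> borel_measurable borel" and fin: "sqnorm lborel f < \<infinity>"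
    and supp: "\<And>u. f u \<noteq> 0 \<Longrightarrow> \<forall>i. u $ i \<le> t $ i"
  shows "((\<lambda>r. sqnorm lborel (\<lambda>u. indicator (- quadrant_box t r) u * f u)) \<longlongrightarrow> 0) at_top"
proof (rule tendsto_at_topI_sequentially)
  fix X :: "nat \<Rightarrow> real" assume X: "filterlim X at_top sequentially"
  have "(\<lambda>n. \<integral>\<^sup>+u. ennreal ((indicator (- quadrant_box t (X n)) u * f u)\<^sup>2) \<partial>lborel) \<longlonglongrightarrow> (\<integral>\<^sup>+u. 0 \<partial>(lborel :: (real ^ 'd) measure))"
  proof (rule nn_integral_dominated_convergence[where w="\<lambda>u. ennreal ((f u)\<^sup>2)"])
    show "(\<integral>\<^sup>+u. ennreal ((f u)\<^sup>2) \<partial>lborel) < \<infinity>" using fin by (simp add: sqnorm_def)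
    show "AE u in lborel. (\<lambda>n. ennreal ((indicator (- quadrant_box t (X n)) u * f u)\<^sup>2)) \<longlonglongrightarrow> 0"
    proof (intro AE_I2 tendsto_eventually)
      fix u
      show "\<forall>\<^sub>F n in sequentially. ennreal ((indicator (- quadrant_box t (X n)) u * f u)\<^sup>2) = 0"
      proof (cases "f u = 0")
        case False
        have "\<forall>\<^sub>F n in sequentially. \<forall>i\<in>UNIV. (t - u) $ i < X n"
          using X by (intro eventually_ball_finite) (auto simp: filterlim_at_top_dense)
        then show ?thesis
          by eventually_elim (use supp[OF False] in \<open>auto simp: quadrant_box_def\<close>)
      qed simp
    qed
  qed (auto simp: indicator_def)
  then show "(\<lambda>n. sqnorm lborel (\<lambda>u. indicator (- quadrant_box t (X n)) u * f u)) \<longlonglongrightarrow> 0"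
    by (simp add: sqnorm_def)
qed

text \<open>Half-open version of the closed boxes in \<open>Y_S2\<close>, whose faces overlap.
  Reflection at \<open>t\<close> makes the kernel argument \<open>t - u\<close> range over a cube
  with lower corner \<open>s\<close>.\<close>

definition grid_cell :: "real \<Rightarrow> real ^ 'd \<Rightarrow> real ^ 'd \<Rightarrow> (real ^ 'd) set" where
  "grid_cell \<delta> t s = {u. \<forall>i. s $ i \<le> (t - u) $ i \<and> (t - u) $ i < s $ i + \<delta>}"

definition grid_step :: "(real ^ 'd \<Rightarrow> real) \<Rightarrow> real \<Rightarrow> nat \<Rightarrow> real ^ 'd \<Rightarrow> real ^ 'd \<Rightarrow> real" where
  "grid_step g \<delta> M t u = (\<Sum>s\<in>grid \<delta> {0..M}. g s * indicator (grid_cell \<delta> t s) u)"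

section \<open>Geometry of grid cells and step functions\<close>

lemma finite_grid: "finite (grid \<delta> {0..M} :: (real ^ 'd) set)"
proof -
  have "grid \<delta> {0..M} \<subseteq> (\<lambda>m. \<chi> i. real (m i) * \<delta>) ` ((UNIV :: 'd set) \<rightarrow>\<^sub>E {0..M})"
  proof
    fix s :: "real ^ 'd" assume "s \<in> grid \<delta> {0..M}"
    then have "\<forall>i. \<exists>j. j \<in> {0..M} \<and> s $ i = real j * \<delta>" unfolding grid_def by blast
    then obtain m where m: "\<forall>i. m i \<in> {0..M} \<and> s $ i = real (m i) * \<delta>" by (rule choice[THEN exE])
    then have "s = (\<chi> i. real (m i) * \<delta>)" by (simp add: Finite_Cartesian_Product.vec_eq_iff)
    moreover have "m \<in> UNIV \<rightarrow>\<^sub>E {0..M}" using m by auto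
    ultimately show "s \<in> (\<lambda>m. \<chi> i. real (m i) * \<delta>) ` ((UNIV :: 'd set) \<rightarrow>\<^sub>E {0..M})" by blast
  qed
  then show ?thesis by (rule finite_subset) (intro finite_imageI finite_PiE, auto)
qed

lemma grid_cell_disjoint:
  fixes t :: "real ^ 'd"
  assumes "0 < \<delta>"
  shows "disjoint_family_on (grid_cell \<delta> t) (grid \<delta> {0..M})"
  unfolding disjoint_family_on_def
proof (intro ballI impI)
  fix s s' :: "real ^ 'd" assume s: "s \<in> grid \<delta> {0..M}" "s' \<in> grid \<delta> {0..M}" "s \<noteq> s'"
  then obtain i where i: "s $ i \<noteq> s' $ i" by (auto simp: Finite_Cartesian_Product.vec_eq_iff)
  obtain j j' where j: "s $ i = real j * \<delta>" "s' $ i = real j' * \<delta>"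
    using s unfolding grid_def by blast
  then have "j \<noteq> j'" using i by auto
  then have "real j + 1 \<le> real j' \<or> real j' + 1 \<le> real j" by linarith
  then have "(real j + 1) * \<delta> \<le> real j' * \<delta> \<or> (real j' + 1) * \<delta> \<le> real j * \<delta>"
    using assms by (auto intro: mult_right_mono)
  then have "s $ i + \<delta> \<le> s' $ i \<or> s' $ i + \<delta> \<le> s $ i"
    unfolding j distrib_right by simp
  then show "grid_cell \<delta> t s \<inter> grid_cell \<delta> t s' = {}"
    unfolding grid_cell_def by (auto dest!: spec[of _ i])
qed

lemma grid_cell_subset: "grid_cell \<delta> t s \<subseteq> {t - s - \<delta> *\<^sub>R 1 .. t - s}"
proof
  fix u assume "u \<in> grid_cell \<delta> t s"
  then have *: "s $ i \<le> (t - u) $ i" "(t - u) $ i < s $ i + \<delta>" for i unfolding grid_cell_def by blast+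
  have "(t - s - \<delta> *\<^sub>R 1) $ i \<le> u $ i" "u $ i \<le> (t - s) $ i" for i
    using *[of i] by simp_all
  then show "u \<in> {t - s - \<delta> *\<^sub>R 1 .. t - s}" 
    unfolding atLeastAtMost_iff Finite_Cartesian_Product.less_eq_vec_def by blast
qed

lemma grid_cell_bounded_borel: "bounded_borel (grid_cell \<delta> t s)"
proof
  show "grid_cell \<delta> t s \<in> sets borel" unfolding grid_cell_def by measurable
  show "bounded (grid_cell \<delta> t s)"
    using grid_cell_subset by (rule bounded_subset[rotated]) (simp add: interval_cbox_cart[symmetric])
qed

lemma grid_cell_obtain:
  fixes t u :: "real ^ 'd"
  assumes \<delta>: "0 < \<delta>" and u: "u \<in> quadrant_box t (real (Suc M) * \<delta>)"
  obtains s where "s \<in> grid \<delta> {0..M}" "u \<in> grid_cell \<delta> t s"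
proof -
  define j where "j i = nat \<lfloor>(t - u) $ i / \<delta>\<rfloor>" for i
  define s where "s = (\<chi> i. real (j i) * \<delta>)"
  have x: "0 \<le> (t - u) $ i" "(t - u) $ i < real (Suc M) * \<delta>" for i
    using u unfolding quadrant_box_def by blast+
  have j: "real (j i) * \<delta> \<le> (t - u) $ i" "(t - u) $ i < real (j i) * \<delta> + \<delta>" for i
  proof -
    have q: "0 \<le> (t - u) $ i / \<delta>" using x(1)[of i] \<delta> by (intro divide_nonneg_pos)
    then have "real (j i) \<le> (t - u) $ i / \<delta>" "(t - u) $ i / \<delta> < real (j i) + 1"
      unfolding j_def by (auto simp: of_nat_nat)
    then show "real (j i) * \<delta> \<le> (t - u) $ i" "(t - u) $ i < real (j i) * \<delta> + \<delta>"
      using \<delta> by (simp_all only: pos_le_divide_eq pos_divide_less_eq distrib_right mult_1)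
  qed
  have "j i \<le> M" for i
  proof -
    have "real (j i) * \<delta> < real (Suc M) * \<delta>" using j(1)[of i] x(2)[of i] by linarith
    then have "real (j i) < real (Suc M)" using \<delta> by (simp only: mult_less_cancel_right_pos)
    then show ?thesis by simp
  qed
  then have "s \<in> grid \<delta> {0..M}" unfolding grid_def s_def by force
  moreover have "u \<in> grid_cell \<delta> t s" unfolding grid_cell_def s_def using j by auto
  ultimately show ?thesis by (rule that)
qed

lemma grid_step_cell:
  fixes t u :: "real ^ 'd"
  assumes "0 < \<delta>" "s \<in> grid \<delta> {0..M}" "u \<in> grid_cell \<delta> t s"
  shows "grid_step g \<delta> M t u = g s"
proof -
  have "grid_step g \<delta> M t u = (\<Sum>s'\<in>grid \<delta> {0..M}. if s' = s then g s else 0)"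
    unfolding grid_step_def
  proof (intro sum.cong refl)
    fix s' :: "real ^ 'd" assume s': "s' \<in> grid \<delta> {0..M}"
    have "u \<notin> grid_cell \<delta> t s'" if "s' \<noteq> s"
      using grid_cell_disjoint[OF assms(1), of t M] assms s' that
      unfolding disjoint_family_on_def by blast
    then show "g s' * indicator (grid_cell \<delta> t s') u = (if s' = s then g s else 0)"
      using assms(3) by auto
  qed
  also have "\<dots> = g s" using assms(2) by (subst sum.delta[OF finite_grid]) simp
  finally show ?thesis .
qed

lemma grid_step_outside:
  fixes t u :: "real ^ 'd"
  assumes \<delta>: "0 < \<delta>" and u: "u \<notin> quadrant_box t (real (Suc M) * \<delta>)"
  shows "grid_step g \<delta> M t u = 0"
  unfolding grid_step_def
proof (rule sum.neutral, rule ballI)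
  fix s :: "real ^ 'd" assume s: "s \<in> grid \<delta> {0..M}"
  have "u \<notin> grid_cell \<delta> t s"
  proof
    assume uc: "u \<in> grid_cell \<delta> t s"
    have "0 \<le> (t - u) $ i \<and> (t - u) $ i < real (Suc M) * \<delta>" for i
    proof -
      obtain j where j: "j \<le> M" "s $ i = real j * \<delta>" using s unfolding grid_def by fastforce
      have "s $ i \<le> (t - u) $ i" "(t - u) $ i < s $ i + \<delta>" using uc unfolding grid_cell_def by blast+
      moreover have "0 \<le> s $ i" using j \<delta> by simp
      moreover have "s $ i \<le> real M * \<delta>" unfolding j(2) using j(1) \<delta> by (intro mult_right_mono) auto
      ultimately show ?thesis by (simp add: distrib_right)
    qed
    then show False using u unfolding quadrant_box_def by blast
  qed
  then show "g s * indicator (grid_cell \<delta> t s) u = 0" by simp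
qed

lemma levy_simple_grid_step: "levy_simple (grid_step g \<delta> M t)"
proof -
  \<comment> \<open>Each value is a sum over the grid points whose cells contain \<open>u\<close>;
    subset sums bound the range without an appeal to disjointness, hence for every
    \<open>\<delta>\<close>.\<close>
  have "range (grid_step g \<delta> M t) \<subseteq> (\<lambda>J. \<Sum>s\<in>J. g s) ` Pow (grid \<delta> {0..M})"
  proof
    fix y assume "y \<in> range (grid_step g \<delta> M t)"
    then obtain u where "y = grid_step g \<delta> M t u" by auto
    also have "\<dots> = (\<Sum>s\<in>{s\<in>grid \<delta> {0..M}. u \<in> grid_cell \<delta> t s}. g s)"
      unfolding grid_step_def by (intro sum.mono_neutral_cong_right finite_grid) auto
    finally show "y \<in> (\<lambda>J. \<Sum>s\<in>J. g s) ` Pow (grid \<delta> {0..M})" by blast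
  qed
  then have "finite (range (grid_step g \<delta> M t))"
    by (rule finite_subset) (intro finite_imageI, simp add: finite_grid)
  moreover have "bounded {u. grid_step g \<delta> M t u \<noteq> 0}"
  proof (rule bounded_subset)
    show "bounded (\<Union>s\<in>grid \<delta> {0..M}. grid_cell \<delta> t s)"
      by (intro bounded_UN finite_grid ballI grid_cell_bounded_borel[THEN conjunct2])
    show "{u. grid_step g \<delta> M t u \<noteq> 0} \<subseteq> (\<Union>s\<in>grid \<delta> {0..M}. grid_cell \<delta> t s)"
    proof
      fix u assume "u \<in> {u. grid_step g \<delta> M t u \<noteq> 0}"
      then have "\<not> (\<forall>s\<in>grid \<delta> {0..M}. g s * indicator (grid_cell \<delta> t s) u = 0)"
        unfolding grid_step_def by (intro notI) simp
      then show "u \<in> (\<Union>s\<in>grid \<delta> {0..M}. grid_cell \<delta> t s)" by (auto simp: indicator_def split: if_splits)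
    qed
  qed
  moreover have "grid_step g \<delta> M t \<in> borel_measurable borel"
    unfolding grid_step_def[abs_def] using grid_cell_bounded_borel
    by (intro borel_measurable_sum borel_measurable_times borel_measurable_const borel_measurable_indicator) auto
  ultimately show ?thesis by (simp add: levy_simple_def)
qed

text \<open>On a cell this is the Lipschitz bound at the lower corner \<open>s\<close>. The factor
  \<open>exp (c * CARD('d))\<close> moves the decay from \<open>s\<close> to \<open>t - u\<close>,
  whose coordinates are larger by at most \<open>\<delta> \<le> 1\<close> each.\<close>

lemma grid_step_error:
  fixes g :: "real ^ 'd \<Rightarrow> real"
  assumes C: "exp_lipschitz_bound C c UNIV g"
    and c: "0 < c" and \<delta>: "0 < \<delta>" "\<delta> \<le> 1"
  shows "\<bar>grid_step g \<delta> M t u - indicator (quadrant_box t (real (Suc M) * \<delta>)) u * g (t - u)\<bar>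
    \<le> \<bar>C * exp (c * CARD('d)) * \<delta> * quadrant_exp c t u\<bar>"
proof (cases "u \<in> quadrant_box t (real (Suc M) * \<delta>)")
  case True
  obtain s where s: "s \<in> grid \<delta> {0..M}" "u \<in> grid_cell \<delta> t s"
    by (rule grid_cell_obtain[OF \<delta>(1) True]) (rule that)
  have sc: "0 \<le> s $ i \<and> s $ i \<le> (t - u) $ i \<and> (t - u) $ i \<le> s $ i + \<delta>" for i
  proof -
    have "0 \<le> s $ i" using s(1) \<delta> unfolding grid_def by (auto dest!: spec[of _ i])
    moreover have "s $ i \<le> (t - u) $ i" "(t - u) $ i < s $ i + \<delta>" using s(2) unfolding grid_cell_def by blast+
    ultimately show ?thesis by simp
  qed
  have "(\<Sum>i\<in>UNIV. (t - u) $ i) \<le> (\<Sum>i\<in>UNIV. s $ i + 1)"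
  proof (rule sum_mono)
    fix i show "(t - u) $ i \<le> s $ i + 1" using sc[of i] \<delta> by linarith
  qed
  also have "\<dots> = (\<Sum>i\<in>UNIV. s $ i) + CARD('d)" by (simp add: sum.distrib)
  finally have "c * (\<Sum>i\<in>UNIV. (t - u) $ i) \<le> c * ((\<Sum>i\<in>UNIV. s $ i) + CARD('d))"
    using c by (intro mult_left_mono) auto
  then have "- c * (\<Sum>i\<in>UNIV. s $ i) \<le> c * CARD('d) + - c * (\<Sum>i\<in>UNIV. (t - u) $ i)"
    by (simp add: distrib_left)
  then have e: "exp (- c * (\<Sum>i\<in>UNIV. s $ i)) \<le> exp (c * CARD('d)) * exp (- c * (\<Sum>i\<in>UNIV. (t - u) $ i))"
    unfolding exp_add[symmetric] by simp
  have "\<bar>g s - g (t - u)\<bar> \<le> C * \<delta> * exp (- c * (\<Sum>i\<in>UNIV. s $ i))"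
    using sc \<delta> by (intro exp_lipschitz_boundD(2)[OF C]) simp_all
  also have "\<dots> \<le> C * \<delta> * (exp (c * CARD('d)) * exp (- c * (\<Sum>i\<in>UNIV. (t - u) $ i)))"
    using exp_lipschitz_bound_nonneg[OF C] \<delta> by (intro mult_left_mono[OF e]) simp
  also have "\<dots> = C * exp (c * CARD('d)) * \<delta> * quadrant_exp c t u"
    using True by (simp add: quadrant_exp_def quadrant_box_def mult_ac)
  finally show ?thesis
    using True grid_step_cell[OF \<delta>(1) s] abs_ge_self order_trans by fastforce
next
  case False
  then show ?thesis using grid_step_outside[OF \<delta>(1) False] by simp
qed

lemma kernel_le_quadrant_exp:
  fixes g :: "real ^ 'd \<Rightarrow> real"
  assumes C: "exp_lipschitz_bound C c UNIV g"
    and supp: "\<And>x. g x \<noteq> 0 \<Longrightarrow> \<forall>i. 0 \<le> x $ i"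
  shows "\<bar>g (t - u)\<bar> \<le> \<bar>C * quadrant_exp c t u\<bar>"
proof (cases "g (t - u) = 0")
  case False
  then have "\<forall>i. 0 \<le> (t - u) $ i" by (rule supp)
  then show ?thesis
    using exp_lipschitz_boundD(1)[OF C, of 0 "t - u" "t - u"] exp_lipschitz_bound_nonneg[OF C]
    by (simp add: quadrant_exp_def)
qed simp

section \<open>Convergence of the step-function approximation\<close>

lemma sqnorm_cmult:
  assumes [measurable]: "X \<in> borel_measurable M"
  shows "sqnorm M (\<lambda>w. a * X w) = ennreal (a\<^sup>2) * sqnorm M X"
  unfolding sqnorm_def power_mult_distrib by (simp add: ennreal_mult' nn_integral_cmult)

text \<open>The sum of the squares has finite integral, so it is finite almost everywhere and its
  terms tend to 0.\<close>

lemma AE_tendsto_0_if_sqnorm_summable: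
  assumes [measurable]: "\<And>k. X k \<in> borel_measurable M"
    and fin: "(\<Sum>k. sqnorm M (X k)) < \<infinity>"
  shows "AE w in M. (\<lambda>k. X k w) \<longlonglongrightarrow> 0"
proof -
  have "(\<integral>\<^sup>+w. (\<Sum>k. ennreal ((X k w)\<^sup>2)) \<partial>M) = (\<Sum>k. sqnorm M (X k))"
    unfolding sqnorm_def by (rule nn_integral_suminf) measurable
  then have "AE w in M. (\<Sum>k. ennreal ((X k w)\<^sup>2)) \<noteq> \<infinity>"
    using fin by (intro nn_integral_PInf_AE) auto
  then show ?thesis
  proof eventually_elim
    case (elim w)
    then have "summable (\<lambda>k. (X k w)\<^sup>2)" by (intro summable_suminf_not_top) auto
    then have "(\<lambda>k. sqrt ((X k w)\<^sup>2)) \<longlonglongrightarrow> sqrt 0"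
      by (intro tendsto_real_sqrt summable_LIMSEQ_zero)
    then show ?case by (simp add: tendsto_rabs_zero_iff)
  qed
qed

context centred_random_measure
begin

text \<open>On the null set \<open>B - C\<close> the variance bound is 0, so the basis vanishes
  there almost surely.\<close>

lemma AE_eq_if_null_difference:
  assumes B: "bounded_borel B" and C: "bounded_borel C" "C \<subseteq> B" and null: "emeasure lborel (B - C) = 0"
  shows "AE w in P. \<Lambda> B w = \<Lambda> C w"
proof -
  define D where "D i = (if i then C else B - C)" for i
  have BC: "bounded_borel (B - C)" using B C bounded_subset[of B "B - C"] by auto
  have D: "bounded_borel (D i)" for i using BC C by (simp add: D_def)
  have "(\<Union>i\<in>UNIV. D i) = B" using C by (auto simp: D_def UNIV_bool)
  moreover have "disjoint_family_on D UNIV" by (auto simp: disjoint_family_on_def D_def)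
  ultimately have "AE w in P. \<Lambda> B w = (\<Sum>i\<in>UNIV. \<Lambda> (D i) w)"
    using AE_additive[of UNIV D] D by simp
  moreover have "AE w in P. \<Lambda> (B - C) w = 0"
  proof (rule sqnorm_zero_AE[OF measurable_basis[OF BC]])
    have "expectation (\<lambda>w. (\<Lambda> (B - C) w)\<^sup>2) \<le> 0"
      using variance_le[OF BC] null by (simp add: measure_def)
    then show "sqnorm P (\<Lambda> (B - C)) = 0"
      using sqnorm_eq_integral[OF square_integrable[OF BC]] by (simp add: ennreal_neg)
  qed
  ultimately show ?thesis by eventually_elim (simp add: UNIV_bool D_def)
qed

lemma AE_Y_S2:
  assumes \<delta>: "0 < \<delta>"
  shows "AE w in P. Y_S2 \<Lambda> g \<delta> M t w = levy_simple_integral \<Lambda> UNIV (grid_step g \<delta> M t) w"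
proof -
  have cell: "AE w in P. \<Lambda> {t - s - \<delta> *\<^sub>R 1 .. t - s} w = \<Lambda> (grid_cell \<delta> t s) w" for s
  proof (rule AE_eq_if_null_difference[OF _ grid_cell_bounded_borel grid_cell_subset])
    let ?B = "{t - s - \<delta> *\<^sub>R 1 .. t - s}"
    show B: "bounded_borel ?B" by (simp add: interval_cbox_cart[symmetric])
    \<comment> \<open>The closed box exceeds the cell by its lower faces only, which lie in finitely
      many hyperplanes.\<close>
    have "?B - grid_cell \<delta> t s \<subseteq> (\<Union>i. {u. u $ i = (t - s - \<delta> *\<^sub>R 1) $ i})"
    proof
      fix u assume u: "u \<in> ?B - grid_cell \<delta> t s"
      then have le: "(t - s - \<delta> *\<^sub>R 1) $ i \<le> u $ i" "u $ i \<le> (t - s) $ i" for i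
        by (auto simp: Finite_Cartesian_Product.less_eq_vec_def)
      obtain i where i: "\<not> (s $ i \<le> (t - u) $ i \<and> (t - u) $ i < s $ i + \<delta>)"
        using u unfolding grid_cell_def by blast
      have "u $ i = (t - s - \<delta> *\<^sub>R 1) $ i"
        using i le[of i] by simp
      then show "u \<in> (\<Union>i. {u. u $ i = (t - s - \<delta> *\<^sub>R 1) $ i})" by blast
    qed
    moreover have "negligible {u :: real ^ 'd. u $ i = a}" for i a
      unfolding cart_eq_inner_axis by (rule negligible_standard_hyperplane) (simp add: axis_in_Basis_iff)
    then have "negligible (\<Union>i. {u. u $ i = (t - s - \<delta> *\<^sub>R 1) $ i})"
      by (intro negligible_Union) auto
    ultimately have "negligible (?B - grid_cell \<delta> t s)" by (rule negligible_subset[rotated])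
    moreover have "?B - grid_cell \<delta> t s \<in> sets lborel"
      using B grid_cell_bounded_borel[of \<delta> t s] by auto
    ultimately have "?B - grid_cell \<delta> t s \<in> null_sets lborel"
      by (simp add: negligible_iff_null_sets null_sets_completion_iff)
    then show "emeasure lborel (?B - grid_cell \<delta> t s) = 0" by auto
  qed
  have "AE w in P. levy_simple_integral \<Lambda> UNIV (grid_step g \<delta> M t) w =
      (\<Sum>s\<in>grid \<delta> {0..M}. g s * \<Lambda> (UNIV \<inter> grid_cell \<delta> t s) w)"
    by (rule AE_levy_simple_integral_eq[OF finite_grid grid_cell_bounded_borel
          grid_cell_disjoint[OF \<delta>] levy_simple_grid_step]) (simp_all add: grid_step_def)
  moreover have "AE w in P. \<forall>s\<in>grid \<delta> {0..M}. \<Lambda> {t - s - \<delta> *\<^sub>R 1 .. t - s} w = \<Lambda> (grid_cell \<delta> t s) w"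
    by (rule AE_finite_allI[OF finite_grid cell])
  ultimately show ?thesis
    by eventually_elim (simp add: Y_S2_def Let_def)
qed

lemma Y_S2_square_integrable: "square_integrable P (Y_S2 \<Lambda> g \<delta> M t)"
  unfolding Y_S2_def[abs_def] Let_def
  by (intro square_integrable_sum square_integrable_cmult square_integrable)
    (simp add: interval_cbox_cart[symmetric])

lemma sqnorm_Y_S2_diff_le:
  assumes "0 < \<delta>" and Y: "has_levy_integral P \<Lambda> f Y" and f: "sqnorm lborel f < \<infinity>"
  shows "sqnorm P (\<lambda>w. Y_S2 \<Lambda> g \<delta> M t w - Y w) \<le>
    ennreal (2 * \<kappa>) * sqnorm lborel (\<lambda>u. grid_step g \<delta> M t u - f u)"
proof -
  have "sqnorm P (\<lambda>w. Y_S2 \<Lambda> g \<delta> M t w - Y w) =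
      sqnorm P (\<lambda>w. levy_simple_integral \<Lambda> UNIV (grid_step g \<delta> M t) w - Y w)"
    by (rule sqnorm_cong_AE) (use AE_Y_S2[OF assms(1)] in auto)
  then show ?thesis using sqnorm_levy_integral_diff_le[OF levy_simple_grid_step Y f] by simp
qed

text \<open>The difference bound, applied to the simple function 0.\<close>

lemma square_integrable_levy_integral:
  assumes Y: "has_levy_integral P \<Lambda> f Y" and f: "sqnorm lborel f < \<infinity>"
  shows "square_integrable P Y"
proof -
  have Ym: "Y \<in> borel_measurable P"
    using Y by (auto simp: has_levy_integral_def tendsto_in_probability_def)
  have "levy_simple (\<lambda>s :: real ^ 'd. 0)" by (simp add: levy_simple_def)
  from sqnorm_levy_integral_diff_le[OF this Y f]
  have "sqnorm P Y \<le> ennreal (2 * \<kappa>) * sqnorm lborel f"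
    by (simp add: levy_simple_integral_def sqnorm_def)
  also have "\<dots> < \<infinity>" using f by (simp add: ennreal_mult_less_top)
  finally show ?thesis using Ym by (simp add: square_integrable_iff_sqnorm)
qed

text \<open>Of the kernel only decay, regularity and support matter. For convergence in L^2 the
  integrand is split at the box covered by the cells; for almost sure convergence \<open>Y\<close>
  itself is split there, as the two parts vanish for different reasons.\<close>

lemma
  fixes g :: "real ^ 'd \<Rightarrow> real"
  assumes c: "0 < c" and g: "exp_lipschitz c UNIV g" and supp: "\<And>x. g x \<noteq> 0 \<Longrightarrow> \<forall>i. 0 \<le> x $ i"
    and Y: "has_levy_integral P \<Lambda> (\<lambda>s. g (t - s)) Y"
  shows Y_S2_tendsto_L2: "tendsto_L2 P (\<lambda>(\<Delta>, M). Y_S2 \<Lambda> g \<Delta> M t) Y refine_filter"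
    and Y_S2_tendsto_AE: "\<And>(\<Delta> :: nat \<Rightarrow> real) M. (\<And>k. 0 < \<Delta> k) \<Longrightarrow> summable (\<lambda>k. (\<Delta> k)\<^sup>2) \<Longrightarrow>
      filterlim (\<lambda>k. \<Delta> k * real (M k)) at_top sequentially \<Longrightarrow>
      AE w in P. (\<lambda>k. Y_S2 \<Lambda> g (\<Delta> k) (M k) t w) \<longlonglongrightarrow> Y w"
proof -
  obtain C where C: "exp_lipschitz_bound C c UNIV g"
    using g unfolding exp_lipschitz_def ..
  define f where "f u = g (t - u)" for u
  have Yf: "has_levy_integral P \<Lambda> f Y" using Y by (simp add: f_def[abs_def])
  have [measurable]: "f \<in> borel_measurable borel" using Yf by (simp add: has_levy_integral_def)
  define H where "H = sqnorm lborel (quadrant_exp c t)"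
  have H: "H < \<infinity>" unfolding H_def by (rule sqnorm_quadrant_exp_finite[OF c])
  have "sqnorm lborel f \<le> sqnorm lborel (\<lambda>u. C * quadrant_exp c t u)"
    unfolding f_def by (rule sqnorm_mono) (rule kernel_le_quadrant_exp[OF C supp])
  also have "\<dots> = ennreal (C\<^sup>2) * H" unfolding H_def by (rule sqnorm_cmult) measurable
  also have "\<dots> < \<infinity>" using H by (simp add: ennreal_mult_less_top)
  finally have f: "sqnorm lborel f < \<infinity>" .
  have fsupp: "f u \<noteq> 0 \<Longrightarrow> \<forall>i. u $ i \<le> t $ i" for u
    using supp[of "t - u"] by (simp add: f_def)
  define K where "K = C * exp (c * CARD('d))"
  let ?Q = "\<lambda>r. quadrant_box t r"
  have [measurable]: "grid_step g \<delta> M t \<in> borel_measurable borel" for \<delta> M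
    using levy_simple_grid_step[of g \<delta> M t] by (simp add: levy_simple_def)
  have step: "sqnorm lborel (\<lambda>u. grid_step g \<delta> M t u - indicator (?Q (real (Suc M) * \<delta>)) u * f u) \<le>
      ennreal ((K * \<delta>)\<^sup>2) * H" if "0 < \<delta>" "\<delta> \<le> 1" for \<delta> M
  proof -
    have "sqnorm lborel (\<lambda>u. grid_step g \<delta> M t u - indicator (?Q (real (Suc M) * \<delta>)) u * f u) \<le>
        sqnorm lborel (\<lambda>u. (K * \<delta>) * quadrant_exp c t u)"
      unfolding f_def K_def by (rule sqnorm_mono) (rule grid_step_error[OF C c that])
    also have "\<dots> = ennreal ((K * \<delta>)\<^sup>2) * H" unfolding H_def by (rule sqnorm_cmult) measurable
    finally show ?thesis .
  qed
  define T where "T r = sqnorm lborel (\<lambda>u. indicator (- ?Q r) u * f u)" for r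
  have T0: "(T \<longlongrightarrow> 0) at_top"
    unfolding T_def[abs_def] by (rule sqnorm_tail_tendsto_0[OF _ f fsupp]) measurable
  have T_mono: "T r' \<le> T r" if "r \<le> r'" for r r'
    unfolding T_def using quadrant_box_mono[OF that, of t]
    by (intro sqnorm_mono) (auto simp: indicator_def)
  have restrict_le: "sqnorm lborel (\<lambda>u. indicator B u * f u) < \<infinity>" for B
    using f by (rule le_less_trans[rotated]) (intro sqnorm_mono, auto simp: indicator_def)

  \<comment> \<open>The outer 2 belongs to \<open>sqnorm_Y_S2_diff_le\<close>, the inner one to
    separating discretization from truncation. The tail is taken at
    \<open>\<delta> * real M\<close>, below the true side of the box, because this is what the
    filter sends to infinity.\<close>
  let ?b = "\<lambda>\<delta> r. ennreal (2 * \<kappa>) * (2 * (ennreal ((K * \<delta>)\<^sup>2) * H + T r))"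
  have bound: "sqnorm P (\<lambda>w. Y_S2 \<Lambda> g \<delta> M t w - Y w) \<le> ?b \<delta> (\<delta> * real M)" if \<delta>: "0 < \<delta>" "\<delta> \<le> 1" for \<delta> M
  proof -
    let ?r = "real (Suc M) * \<delta>"
    have "sqnorm lborel (\<lambda>u. grid_step g \<delta> M t u - f u) \<le>
        2 * (sqnorm lborel (\<lambda>u. grid_step g \<delta> M t u - indicator (?Q ?r) u * f u) +
          sqnorm lborel (\<lambda>u. indicator (?Q ?r) u * f u - f u))"
      by (rule sqnorm_triangle) measurable
    also have "sqnorm lborel (\<lambda>u. indicator (?Q ?r) u * f u - f u) = T ?r"
      unfolding T_def sqnorm_def by (intro nn_integral_cong) (auto simp: indicator_def)
    also have "2 * (sqnorm lborel (\<lambda>u. grid_step g \<delta> M t u - indicator (?Q ?r) u * f u) + T ?r) \<le>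
        2 * (ennreal ((K * \<delta>)\<^sup>2) * H + T (\<delta> * real M))"
    proof (intro mult_left_mono add_mono step[OF \<delta>] T_mono)
      show "\<delta> * real M \<le> real (Suc M) * \<delta>" using \<delta> by (simp add: algebra_simps)
    qed simp
    finally show ?thesis
      by (intro order_trans[OF sqnorm_Y_S2_diff_le[OF \<delta>(1) Yf f]] mult_left_mono) auto
  qed

  have fst_lim: "filterlim fst (at_right 0) refine_filter"
    unfolding refine_filter_def by (rule filterlim_mono[OF filterlim_filtercomap order_refl inf_le1])
  have prod_lim: "filterlim (\<lambda>(\<Delta>, M). \<Delta> * real M) at_top refine_filter"
    unfolding refine_filter_def by (rule filterlim_mono[OF filterlim_filtercomap order_refl inf_le2])
  have "eventually (\<lambda>\<delta>::real. 0 < \<delta> \<and> \<delta> \<le> 1) (at_right 0)"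
    unfolding eventually_at_right_field by (intro exI[of _ 1]) auto
  then have ev: "\<forall>\<^sub>F z in refine_filter. 0 < fst z \<and> fst z \<le> (1::real)"
    using fst_lim unfolding filterlim_iff by blast
  let ?E = "\<lambda>z. case z of (\<Delta>, M) \<Rightarrow> Y_S2 \<Lambda> g \<Delta> M t"
  have sq: "((\<lambda>z. sqnorm P (\<lambda>w. ?E z w - Y w)) \<longlongrightarrow> 0) refine_filter"
  proof (rule tendsto_sandwich[OF _ _ tendsto_const])
    have "((\<lambda>z. ennreal ((K * fst z)\<^sup>2)) \<longlongrightarrow> ennreal ((K * 0)\<^sup>2)) refine_filter"
      using fst_lim by (intro tendsto_ennrealI tendsto_intros) (simp add: filterlim_at)
    then have "((\<lambda>z. H * ennreal ((K * fst z)\<^sup>2)) \<longlongrightarrow> H * 0) refine_filter"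
      using H by (intro ennreal_tendsto_cmult) auto
    moreover have "((\<lambda>z. T (fst z * real (snd z))) \<longlongrightarrow> 0) refine_filter"
      using filterlim_compose[OF T0 prod_lim] by (simp add: case_prod_unfold)
    ultimately have "((\<lambda>z. ?b (fst z) (fst z * real (snd z))) \<longlongrightarrow> ennreal (2 * \<kappa>) * (2 * (H * 0 + 0))) refine_filter"
      by (intro ennreal_tendsto_cmult tendsto_add) (auto simp: mult.commute)
    then show "((\<lambda>z. ?b (fst z) (fst z * real (snd z))) \<longlongrightarrow> 0) refine_filter" by simp
    show "\<forall>\<^sub>F z in refine_filter. sqnorm P (\<lambda>w. ?E z w - Y w) \<le>
        ?b (fst z) (fst z * real (snd z))"
      using ev
    proof eventually_elim
      case (elim z)
      then show ?case using bound[of "fst z" "snd z"] by (simp only: case_prod_unfold)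
    qed
  qed simp
  have Ysq: "square_integrable P Y" by (rule square_integrable_levy_integral[OF Yf f])
  show "tendsto_L2 P (\<lambda>(\<Delta>, M). Y_S2 \<Lambda> g \<Delta> M t) Y refine_filter"
    unfolding tendsto_L2_def
  proof (intro conjI always_eventually allI)
    show "square_integrable P Y" by (rule Ysq)
    show "square_integrable P (?E z)" for z
      by (cases z) (simp add: Y_S2_square_integrable)
    have "(\<integral>w. (?E z w - Y w)\<^sup>2 \<partial>P) =
        enn2real (sqnorm P (\<lambda>w. ?E z w - Y w))" for z
      using Ysq Y_S2_square_integrable
      by (cases z) (auto intro!: integral_square_eq_sqnorm borel_measurable_diff simp: square_integrable_def)
    then show "((\<lambda>z. \<integral>w. (?E z w - Y w)\<^sup>2 \<partial>P) \<longlongrightarrow> 0) refine_filter"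
      using tendsto_enn2real[of "\<lambda>z. sqnorm P (\<lambda>w. ?E z w - Y w)" 0] sq
      by simp
  qed

  fix \<Delta> :: "nat \<Rightarrow> real" and M :: "nat \<Rightarrow> nat"
  assume \<Delta>: "\<And>k. 0 < \<Delta> k" and summ: "summable (\<lambda>k. (\<Delta> k)\<^sup>2)"
    and lim: "filterlim (\<lambda>k. \<Delta> k * real (M k)) at_top sequentially"
  \<comment> \<open>The true side of the box, one cell longer than
    \<open>\<Delta> k * real (M k)\<close>.\<close>
  define R where "R k = real (Suc (M k)) * \<Delta> k" for k
  have R: "filterlim R at_top sequentially"
    using lim by (rule filterlim_at_top_mono) (use \<Delta> in \<open>auto simp: R_def algebra_simps less_imp_le\<close>)
  \<comment> \<open>Integrals are determined only up to null sets; a predicate on pairs lets both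
    parts of \<open>Y\<close> be chosen together for every \<open>k\<close>.\<close>
  define good where "good k Z \<longleftrightarrow> has_levy_integral P \<Lambda> (\<lambda>s. indicator (?Q (R k)) s * f s) (fst Z) \<and>
      has_levy_integral P \<Lambda> (\<lambda>s. indicator (- ?Q (R k)) s * f s) (snd Z) \<and>
      (AE w in P. Y w = fst Z w + snd Z w)" for k Z
  have "\<exists>Z. good k Z" for k
  proof (rule has_levy_integral_restrict[OF Yf quadrant_box_borel[of t "R k"]])
    fix X X'
    assume "has_levy_integral P \<Lambda> (\<lambda>s. indicator (?Q (R k)) s * f s) X"
      "has_levy_integral P \<Lambda> (\<lambda>s. indicator (- ?Q (R k)) s * f s) X'"
      "AE w in P. Y w = X w + X' w"
    then have "good k (X, X')" by (simp add: good_def)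
    then show ?thesis by blast
  qed
  then obtain Z where Z: "good k (Z k)" for k by metis
  define J V where "J k = fst (Z k)" and "V k = snd (Z k)" for k
  have J: "has_levy_integral P \<Lambda> (\<lambda>s. indicator (?Q (R k)) s * f s) (J k)"
    and V: "has_levy_integral P \<Lambda> (\<lambda>s. indicator (- ?Q (R k)) s * f s) (V k)"
    and JV: "AE w in P. Y w = J k w + V k w" for k
    using Z[of k] unfolding good_def J_def V_def by blast+
  have V0: "AE w in P. (\<lambda>k. V k w) \<longlonglongrightarrow> 0"
  proof (rule AE_tendsto_levy_integral_tails[where Q="\<lambda>r. - ?Q r" and R=R, OF Yf f _ _ _ R V])
    show "antimono (\<lambda>r. - ?Q r)" by (rule antimonoI) (use quadrant_box_mono in blast)
    show "((\<lambda>r. sqnorm lborel (\<lambda>s. indicator (- ?Q r) s * f s)) \<longlongrightarrow> 0) at_top"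
      using T0 by (simp add: T_def[abs_def])
  qed auto
  have "(\<lambda>k. (\<Delta> k)\<^sup>2) \<longlonglongrightarrow> 0" using summ by (rule summable_LIMSEQ_zero)
  then have "\<forall>\<^sub>F k in sequentially. (\<Delta> k)\<^sup>2 < 1" by (rule order_tendstoD) simp
  \<comment> \<open>The cellwise estimate asks for steps of at most 1, so finitely many indices are
    dropped.\<close>
  then obtain k0 where k0: "\<And>k. k0 \<le> k \<Longrightarrow> (\<Delta> k)\<^sup>2 < 1" by (auto simp: eventually_sequentially)
  have \<Delta>1: "\<Delta> (k + k0) \<le> 1" for k
    using k0[of "k + k0"] \<Delta>[of "k + k0"] power2_less_imp_less[of "\<Delta> (k + k0)" 1] by simp
  \<comment> \<open>Compared with the box part \<open>J k\<close> alone, only the discretization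
    error remains, and its second moments are summable.\<close>
  let ?D = "\<lambda>k w. Y_S2 \<Lambda> g (\<Delta> k) (M k) t w - J k w"
  have "AE w in P. (\<lambda>k. ?D (k + k0) w) \<longlonglongrightarrow> 0"
  proof (rule AE_tendsto_0_if_sqnorm_summable)
    have Jm: "J k \<in> borel_measurable P" for k
      using J[of k] by (auto simp: has_levy_integral_def tendsto_in_probability_def)
    show "(\<lambda>w. ?D (k + k0) w) \<in> borel_measurable P" for k
      using Y_S2_square_integrable Jm by (intro borel_measurable_diff) (auto simp: square_integrable_def)
    have "sqnorm P (\<lambda>w. ?D (k + k0) w) \<le>
        (ennreal (2 * \<kappa>) * H * ennreal (K\<^sup>2)) * ennreal ((\<Delta> (k + k0))\<^sup>2)" for k
    proof -
      have "sqnorm P (\<lambda>w. ?D (k + k0) w) \<le>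
          ennreal (2 * \<kappa>) * sqnorm lborel (\<lambda>u. grid_step g (\<Delta> (k + k0)) (M (k + k0)) t u -
            indicator (?Q (R (k + k0))) u * f u)"
        by (rule sqnorm_Y_S2_diff_le[OF \<Delta> J restrict_le])
      also have "\<dots> \<le> ennreal (2 * \<kappa>) * (ennreal ((K * \<Delta> (k + k0))\<^sup>2) * H)"
        unfolding R_def by (intro mult_left_mono step \<Delta> \<Delta>1) simp
      also have "\<dots> = (ennreal (2 * \<kappa>) * H * ennreal (K\<^sup>2)) * ennreal ((\<Delta> (k + k0))\<^sup>2)"
        by (simp add: power_mult_distrib ennreal_mult' mult_ac)
      finally show ?thesis .
    qed
    then have "(\<Sum>k. sqnorm P (\<lambda>w. ?D (k + k0) w)) \<le>
        (\<Sum>k. (ennreal (2 * \<kappa>) * H * ennreal (K\<^sup>2)) * ennreal ((\<Delta> (k + k0))\<^sup>2))"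
      by (intro suminf_le) auto
    also have "\<dots> = (ennreal (2 * \<kappa>) * H * ennreal (K\<^sup>2)) * (\<Sum>k. ennreal ((\<Delta> (k + k0))\<^sup>2))"
      by (rule ennreal_suminf_cmult)
    also have "\<dots> < \<infinity>"
    proof -
      have "summable (\<lambda>k. (\<Delta> (k + k0))\<^sup>2)" using summ by (subst summable_iff_shift)
      then have "(\<Sum>k. ennreal ((\<Delta> (k + k0))\<^sup>2)) \<noteq> \<top>" by (intro ennreal_suminf_neq_top) auto
      then show ?thesis using H by (simp add: ennreal_mult_less_top less_top)
    qed
    finally show "(\<Sum>k. sqnorm P (\<lambda>w. ?D (k + k0) w)) < \<infinity>" .
  qed
  moreover have "AE w in P. \<forall>k. Y w = J k w + V k w" using JV by (simp add: AE_all_countable)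
  ultimately show "AE w in P. (\<lambda>k. Y_S2 \<Lambda> g (\<Delta> k) (M k) t w) \<longlonglongrightarrow> Y w"
    using V0
  proof eventually_elim
    case (elim w)
    have "(\<lambda>k. Y_S2 \<Lambda> g (\<Delta> k) (M k) t w - J k w) \<longlonglongrightarrow> 0"
      using elim(1) by (rule LIMSEQ_offset)
    then have "(\<lambda>k. (Y_S2 \<Lambda> g (\<Delta> k) (M k) t w - J k w) + (Y w - V k w)) \<longlonglongrightarrow> 0 + (Y w - 0)"
      by (intro tendsto_add tendsto_diff tendsto_const elim(3))
    moreover have "(Y_S2 \<Lambda> g (\<Delta> k) (M k) t w - J k w) + (Y w - V k w) = Y_S2 \<Lambda> g (\<Delta> k) (M k) t w" for k
      using elim(2)[rule_format, of k] by simp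
    ultimately show ?case by simp
  qed
qed

end

lemma summable_square_bigo_powr:
  fixes \<Delta> :: "nat \<Rightarrow> real"
  assumes "\<Delta> \<in> O(\<lambda>k. real k powr (- 1 - \<epsilon>))" "0 < \<epsilon>"
  shows "summable (\<lambda>k. (\<Delta> k)\<^sup>2)"
proof -
  obtain B where B: "\<forall>\<^sub>F k in sequentially. norm (\<Delta> k) \<le> B * norm (real k powr (- 1 - \<epsilon>))"
    using landau_o.bigE[OF assms(1)] by blast
  show ?thesis
  proof (rule summable_comparison_test_ev)
    show "\<forall>\<^sub>F k in sequentially. norm ((\<Delta> k)\<^sup>2) \<le> B\<^sup>2 * real k powr (- 2 - 2 * \<epsilon>)"
      using B
    proof eventually_elim
      case (elim k)
      then have "\<bar>\<Delta> k\<bar>\<^sup>2 \<le> (B * real k powr (- 1 - \<epsilon>))\<^sup>2" by (intro power_mono) auto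
      also have "\<dots> = B\<^sup>2 * (real k powr (- 1 - \<epsilon>) * real k powr (- 1 - \<epsilon>))"
        by (simp add: power2_eq_square mult_ac)
      also have "real k powr (- 1 - \<epsilon>) * real k powr (- 1 - \<epsilon>) = real k powr (- 2 - 2 * \<epsilon>)"
        unfolding powr_add[symmetric] by (simp add: algebra_simps)
      finally show ?case by simp
    qed
    show "summable (\<lambda>k. B\<^sup>2 * real k powr (- 2 - 2 * \<epsilon>))"
      using assms(2) by (intro summable_mult) (simp add: summable_real_powr_iff)
  qed
qed

theorem theorem5p5:
  fixes P :: "'w measure"
    and \<Lambda> :: "(real ^ 'd::{finite,linorder}) set \<Rightarrow> 'w \<Rightarrow> real"
    and \<beta> \<sigma>2 :: real and \<nu> :: "real measure"
    and p q :: nat and b :: "real Matrix.vec" and A :: "'d::{finite,linorder} \<Rightarrow> real mat"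
    and Y :: "real ^ 'd::{finite,linorder} \<Rightarrow> 'w \<Rightarrow> real"
    and \<Delta>\<^sub>0 :: real and N :: nat
  assumes "causal_carma_field P \<Lambda> \<beta> \<sigma>2 \<nu> p q b A Y"
    and "\<And>i. distinct_eigenvalues (A i)"
    and "mean_zero P \<Lambda>" and "finite_second_moment P \<Lambda>"
    and "\<Delta>\<^sub>0 > 0"
  shows "(\<forall>t\<in>grid \<Delta>\<^sub>0 {1..N}.
            tendsto_L2 P (\<lambda>(\<Delta>, M). Y_S2 \<Lambda> (carma_kernel p b A) \<Delta> M t) (Y t) refine_filter) \<and>
         (\<forall>(\<Delta> :: nat \<Rightarrow> real) (M :: nat \<Rightarrow> nat) \<epsilon>::real.
            (\<forall>k. \<Delta> k > 0) \<longrightarrow> \<epsilon> > 0 \<longrightarrow>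
            \<Delta> \<in> O(\<lambda>k. real k powr (- 1 - \<epsilon>)) \<longrightarrow>
            filterlim (\<lambda>k. \<Delta> k * real (M k)) at_top sequentially \<longrightarrow>
            (\<forall>t\<in>grid \<Delta>\<^sub>0 {1..N}.
               AE \<omega> in P. (\<lambda>k. Y_S2 \<Lambda> (carma_kernel p b A) (\<Delta> k) (M k) t \<omega>) \<longlonglongrightarrow> Y t \<omega>))"
proof -
  note carma = assms(1)[unfolded causal_carma_field_def]
  have p: "0 < p" and b: "b \<in> carrier_vec p" using carma by auto
  have "\<forall>i. \<exists>a::real poly. lead_coeff a = 1 \<and> degree a = p \<and>
      (\<forall>z::complex. poly (map_poly complex_of_real a) z = 0 \<longrightarrow> Re z < 0) \<and> A i = companion_mat a"
    using carma by (elim conjE)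
  then obtain a where a: "\<And>i. lead_coeff (a i) = 1" "\<And>i. degree (a i) = p"
    and roots: "\<And>i z. poly (map_poly complex_of_real (a i)) z = 0 \<Longrightarrow> Re z < 0"
    and A: "\<And>i. A i = companion_mat (a i)"
    by metis
  obtain c where c: "0 < c" and g: "exp_lipschitz c UNIV (carma_kernel p b A)"
    by (rule carma_kernel_exp_lipschitz[OF b p A a roots assms(2)])
  have hb: "homogeneous_levy_basis P \<Lambda> \<beta> \<sigma>2 \<nu>" using carma by (elim conjE)
  obtain \<kappa> where "centred_random_measure P \<Lambda> \<kappa>"
    by (rule homogeneous_levy_basis_centred[OF hb assms(3,4)])
  then interpret centred_random_measure P \<Lambda> \<kappa> .
  have Y: "has_levy_integral P \<Lambda> (\<lambda>s. carma_kernel p b A (t - s)) (Y t)" for t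
    using carma by (elim conjE) (erule spec)
  have supp: "\<forall>i. 0 \<le> x $ i" if "carma_kernel p b A x \<noteq> 0" for x
    using that by (auto simp: carma_kernel_def indicator_def split: if_splits)
  show ?thesis
    using Y_S2_tendsto_L2[OF c g supp Y] Y_S2_tendsto_AE[OF c g supp Y] summable_square_bigo_powr
    by blast
qed

end
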